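(* Let $s\in(0,\tfrac12)$. There exists $\delta>0$ such that the following holds for every $\varkappa\in\mathbb{C}$ with $i\varkappa^2\in\mathbb{R}\setminus(-1,1)$. Let $I\ni 0$ be a time interval and let $q\in C^1(I;\mathscr{S}(\mathbb{R}))$ be a (Schwartz) solution to the derivative nonlinear Schrödinger equation $$ i\partial_t q+\partial_x^2 q+i\partial_x(|q|^2q)=0 $$ with initial data $q(0)\in H^s(\mathbb{R})\cap\mathscr{S}(\mathbb{R})$ of small mass, $\|q(0)\|_{L^2}\le\delta$. Put $r=-\bar q$. Then $$\partial_t\rho(\varkappa)+\partial_x j_{\mathrm{DNLS}}(\varkappa)=0,$$ where $$\rho(\varkappa):=-\varkappa\,\frac{q\,g_{21}(\varkappa)+r\,g_{12}(\varkappa)}{2+\gamma(\varkappa)},$$ $$j_{\mathrm{DNLS}}(\varkappa):= i\varkappa\,\frac{q' g_{21}(\varkappa)-r' g_{12}(\varkappa)}{2+\gamma(\varkappa)}-i\varkappa^2 qr-2\varkappa^2\rho(\varkappa)-qr\,\rho(\varkappa).$$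
   Context: Primes denote $\partial_x$; $\mathscr{S}(\mathbb{R})$ is the Schwartz space. For $\kappa\in\mathbb{C}$ with $i\kappa^2\in\mathbb{R}$, $|\kappa|\ge1$, and $r=-\bar q$, let $$L(\kappa)=\begin{bmatrix}\partial+i\kappa^2&-\kappa q\\-\kappa r&\partial-i\kappa^2\end{bmatrix},\qquad L_0(\kappa)=\begin{bmatrix}\partial+i\kappa^2&0\\0&\partial-i\kappa^2\end{bmatrix}$$ acting on $L^2(\mathbb{R};\mathbb{C}^2)$. When $\|q\|_{L^2}$ is sufficiently small (uniformly in such $\kappa$), $L(\kappa)$ is invertible; $G(x,y;\kappa)$ and $G_0(x,y;\kappa)$ denote the ($2\times2$ matrix valued) integral kernels of $L(\kappa)^{-1}$ and $L_0(\kappa)^{-1}$, and $G-G_0$ is a continuous function of $(x,y)$. Define $$\gamma(x;\kappa)=\mathrm{sgn}(i\kappa^2)\bigl[G_{11}(x,x;\kappa)-G_{22}(x,x;\kappa)\bigr]-1,$$ $$g_{12}(x;\kappa)=\mathrm{sgn}(i\kappa^2)G_{12}(x,x;\kappa),\qquad g_{21}(x;\kappa)=\mathrm{sgn}(i\kappa^2)G_{21}(x,x;\kappa),$$ where on the diagonal the contribution of $G_0$ to $G_{11}-G_{22}$ is $\mathrm{sgn}(i\kappa^2)$ (the common one-sided limit), i.e. $\gamma(x;\kappa)=\mathrm{sgn}(i\kappa^2)[(G-G_0)_{11}-(G-G_0)_{22}](x,x;\kappa)$. At each time $t$ these functions are computed from $q(t)$, $r(t)$; $\rho,j_{\mathrm{DNLS}}$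 are functions of $(t,x)$. *)

theory Defs
  imports "HOL-Analysis.Analysis"
begin

section \<open>Function spaces on the real line\<close>

definition dx :: "(real \<Rightarrow> 'a::real_normed_vector) \<Rightarrow> real \<Rightarrow> 'a" where
  "dx f = (\<lambda>x. vector_derivative f (at x))"

definition schwartz :: "(real \<Rightarrow> complex) set" where
  "schwartz = {f. (\<forall>n x. (dx ^^ n) f differentiable at x) \<and>
     (\<forall>m n. bdd_above (range (\<lambda>x. \<bar>x\<bar> ^ m * norm ((dx ^^ n) f x))))}"

definition schwartz_seminorm :: "nat \<Rightarrow> nat \<Rightarrow> (real \<Rightarrow> complex) \<Rightarrow> real" where
  "schwartz_seminorm m n f = (SUP x. \<bar>x\<bar> ^ m * norm ((dx ^^ n) f x))"

text \<open>Membership in $C^1(I; \mathscr{S}(\mathbb{R}))$: difference quotients converge, and the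
  derivative \<open>q'\<close> is continuous, in the Frechet topology generated by the seminorms above
  (one-sidedly at endpoints belonging to \<open>I\<close>).\<close>

definition C1_schwartz :: "real set \<Rightarrow> (real \<Rightarrow> real \<Rightarrow> complex) \<Rightarrow> bool" where
  "C1_schwartz I q \<longleftrightarrow> (\<forall>t\<in>I. q t \<in> schwartz) \<and>
     (\<exists>q'. \<forall>t\<in>I. q' t \<in> schwartz \<and> (\<forall>m n.
        ((\<lambda>\<tau>. schwartz_seminorm m n
            (\<lambda>x. (q \<tau> x - q t x) / of_real (\<tau> - t) - q' t x)) \<longlongrightarrow> 0) (at t within I) \<and>
        ((\<lambda>\<tau>. schwartz_seminorm m n (\<lambda>x. q' \<tau> x - q' t x)) \<longlongrightarrow> 0) (at t within I)))"

definition L2 :: "(real \<Rightarrow> 'a::{banach, second_countable_topology}) set" where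
  "L2 = {f. f \<in> borel_measurable borel \<and> integrable lborel (\<lambda>x. (norm (f x))\<^sup>2)}"

definition L2_norm :: "(real \<Rightarrow> 'a::{banach, second_countable_topology}) \<Rightarrow> real" where
  "L2_norm f = sqrt (\<integral>x. (norm (f x))\<^sup>2 \<partial>lborel)"

definition fourier :: "(real \<Rightarrow> complex) \<Rightarrow> real \<Rightarrow> complex" where
  "fourier f \<xi> = (\<integral>x. exp (- \<i> * of_real (\<xi> * x)) * f x \<partial>lborel) / of_real (sqrt (2 * pi))"

text \<open>$H^s(\mathbb{R})$ for $s \ge 0$.  The function \<open>F\<close> is the Fourier transform of \<open>f\<close> in the sense
  of tempered distributions, since the integral defining \<open>fourier f\<close> need not converge for
  \<open>f \<in> L2\<close>.\<close>

definition sobolev :: "real \<Rightarrow> (real \<Rightarrow> complex) set" where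
  "sobolev s = {f \<in> L2. \<exists>F\<in>L2.
     (\<forall>\<phi>\<in>schwartz. (\<integral>\<xi>. F \<xi> * \<phi> \<xi> \<partial>lborel) = (\<integral>x. f x * fourier \<phi> x \<partial>lborel)) \<and>
     integrable lborel (\<lambda>\<xi>. (1 + \<xi>\<^sup>2) powr s * (norm (F \<xi>))\<^sup>2)}"

definition weak_deriv :: "(real \<Rightarrow> complex) \<Rightarrow> (real \<Rightarrow> complex) \<Rightarrow> bool" where
  "weak_deriv u v \<longleftrightarrow>
     (\<forall>\<phi>\<in>schwartz. (\<integral>x. u x * dx \<phi> x \<partial>lborel) = - (\<integral>x. v x * \<phi> x \<partial>lborel))"


section \<open>The Lax operator and its Green's function\<close>

definition conj_pot :: "(real \<Rightarrow> complex) \<Rightarrow> real \<Rightarrow> complex" where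
  "conj_pot q x = - cnj (q x)"

definition lax_matrix :: "complex \<Rightarrow> (real \<Rightarrow> complex) \<Rightarrow> real \<Rightarrow> complex^2^2" where
  "lax_matrix \<kappa> q x = vector
     [vector [\<i> * \<kappa>\<^sup>2, - \<kappa> * q x],
      vector [- \<kappa> * conj_pot q x, - \<i> * \<kappa>\<^sup>2]]"

text \<open>\<open>lax_op \<kappa> q u f\<close> says that \<open>u\<close> lies in the domain $H^1(\mathbb{R};\mathbb{C}^2)$ of the
  operator $L(\kappa)$ on $L^2(\mathbb{R};\mathbb{C}^2)$ and that $L(\kappa) u = f$; it is a relation
  because elements of $L^2$ are represented by functions up to null sets.  The free operator
  $L_0(\kappa)$ is the case \<open>q = (\<lambda>_. 0)\<close>.\<close>

definition lax_op ::
  "complex \<Rightarrow> (real \<Rightarrow> complex) \<Rightarrow> (real \<Rightarrow> complex^2) \<Rightarrow> (real \<Rightarrow> complex^2) \<Rightarrow> bool" where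
  "lax_op \<kappa> q u f \<longleftrightarrow> u \<in> L2 \<and> f \<in> L2 \<and>
     (\<exists>v\<in>L2. (\<forall>i. weak_deriv (\<lambda>x. u x $ i) (\<lambda>x. v x $ i)) \<and>
        (AE x in lborel. f x = v x + lax_matrix \<kappa> q x *v u x))"

definition lax_invertible :: "complex \<Rightarrow> (real \<Rightarrow> complex) \<Rightarrow> bool" where
  "lax_invertible \<kappa> q \<longleftrightarrow>
     (\<forall>f\<in>L2. \<exists>u. lax_op \<kappa> q u f) \<and>
     (\<forall>f u u'. lax_op \<kappa> q u f \<and> lax_op \<kappa> q u' f \<longrightarrow> (AE x in lborel. u x = u' x)) \<and>
     (\<exists>C. \<forall>f u. lax_op \<kappa> q u f \<longrightarrow> L2_norm u \<le> C * L2_norm f)"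

text \<open>\<open>K\<close> is an integral kernel of $L(\kappa)^{-1}$.\<close>

definition inverse_kernel ::
  "complex \<Rightarrow> (real \<Rightarrow> complex) \<Rightarrow> (real \<Rightarrow> real \<Rightarrow> complex^2^2) \<Rightarrow> bool" where
  "inverse_kernel \<kappa> q K \<longleftrightarrow> lax_invertible \<kappa> q \<and>
     (\<lambda>(x, y). K x y) \<in> borel_measurable borel \<and>
     (\<forall>f u. lax_op \<kappa> q u f \<longrightarrow>
        (AE x in lborel. integrable lborel (\<lambda>y. K x y *v f y) \<and>
           u x = (\<integral>y. K x y *v f y \<partial>lborel)))"

text \<open>$G - G_0$.  The kernels are only determined almost everywhere, so the values on the diagonal
  are those of the (unique) continuous representative of the difference.\<close>

definition green_diff ::
  "complex \<Rightarrow> (real \<Rightarrow> complex) \<Rightarrow> real \<Rightarrow> real \<Rightarrow> complex^2^2" where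
  "green_diff \<kappa> q = (THE D. continuous_on UNIV (\<lambda>(x, y). D x y) \<and>
     (\<exists>G G\<^sub>0. inverse_kernel \<kappa> q G \<and> inverse_kernel \<kappa> (\<lambda>_. 0) G\<^sub>0 \<and>
        (\<forall>x y. D x y = G x y - G\<^sub>0 x y)))"

definition gam :: "complex \<Rightarrow> (real \<Rightarrow> complex) \<Rightarrow> real \<Rightarrow> complex" where
  "gam \<kappa> q x = sgn (\<i> * \<kappa>\<^sup>2) * (green_diff \<kappa> q x x $ 1 $ 1 - green_diff \<kappa> q x x $ 2 $ 2)"

text \<open>Since $L_0(\kappa)$ is diagonal, the off-diagonal entries of $G_0$ vanish, and the continuous
  functions $G_{12}$ and $G_{21}$ are the off-diagonal entries of $G - G_0$.\<close>

definition g12 :: "complex \<Rightarrow> (real \<Rightarrow> complex) \<Rightarrow> real \<Rightarrow> complex" where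
  "g12 \<kappa> q x = sgn (\<i> * \<kappa>\<^sup>2) * green_diff \<kappa> q x x $ 1 $ 2"

definition g21 :: "complex \<Rightarrow> (real \<Rightarrow> complex) \<Rightarrow> real \<Rightarrow> complex" where
  "g21 \<kappa> q x = sgn (\<i> * \<kappa>\<^sup>2) * green_diff \<kappa> q x x $ 2 $ 1"


section \<open>The equation, the density and the current\<close>

definition dnls_solution :: "real set \<Rightarrow> (real \<Rightarrow> real \<Rightarrow> complex) \<Rightarrow> bool" where
  "dnls_solution I q \<longleftrightarrow> (\<forall>t\<in>I. \<forall>x.
     \<i> * vector_derivative (\<lambda>\<tau>. q \<tau> x) (at t within I) + dx (dx (q t)) x
       + \<i> * dx (\<lambda>y. of_real ((cmod (q t y))\<^sup>2) * q t y) x = 0)"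

definition rho :: "complex \<Rightarrow> (real \<Rightarrow> complex) \<Rightarrow> real \<Rightarrow> complex" where
  "rho \<kappa> q x =
     - \<kappa> * ((q x * g21 \<kappa> q x + conj_pot q x * g12 \<kappa> q x) / (2 + gam \<kappa> q x))"

definition j_dnls :: "complex \<Rightarrow> (real \<Rightarrow> complex) \<Rightarrow> real \<Rightarrow> complex" where
  "j_dnls \<kappa> q x =
     \<i> * \<kappa> * ((dx q x * g21 \<kappa> q x - dx (conj_pot q) x * g12 \<kappa> q x) / (2 + gam \<kappa> q x))
     - \<i> * \<kappa>\<^sup>2 * q x * conj_pot q x
     - 2 * \<kappa>\<^sup>2 * rho \<kappa> q x
     - q x * conj_pot q x * rho \<kappa> q x"

end

theory Submission
  imports Defs "HOL-Probability.Sinc_Integral"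
begin

text \<open>Write \<open>c = \<i> \<kappa>\<^sup>2\<close>, which is real with \<open>\<bar>c\<bar> \<ge> 1\<close>, and \<open>r = conj_pot q\<close>.  Let
  \<open>(u, a u)\<close> and \<open>(b v, v)\<close> be the solutions of \<open>L(\<kappa>) \<psi> = 0\<close> that decay at opposite ends of
  the line.  The ratios are bounded solutions of the Riccati equations

  \<open>a' = 2 c a + \<kappa> r - \<kappa> q a\<^sup>2\<close> and \<open>b' = - 2 c b + \<kappa> q - \<kappa> r b\<^sup>2\<close>.

  The Green's function is built from these solutions by variation of constants, and on the
  diagonal only the ratios survive: \<open>\<gamma> = 2 a b / (1 - a b)\<close>, \<open>g\<^sub>1\<^sub>2 = - b / (1 - a b)\<close> and
  \<open>g\<^sub>2\<^sub>1 = a / (1 - a b)\<close> (\<open>diagonal_green\<close>).  Hence \<open>\<rho> = - (\<kappa> / 2) (q a - r b)\<close>, and since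
  \<open>(log u)' = - c + \<kappa> q a\<close> and \<open>(log v)' = c + \<kappa> r b\<close>, the density is half of
  \<open>(log v - log u)'\<close> up to the constant \<open>c\<close>.  The evolution equation is the compatibility
  condition of the spatial linear system with a system \<open>\<psi>\<^sub>t = [[A, B], [C, - A]] \<psi>\<close>, which gives \<open>(log u)\<^sub>t = A + B a\<close> and
  \<open>(log v)\<^sub>t = - A + C b\<close>.  Exchanging the order of the derivatives shows that the current is
  \<open>(2 A + B a - C b) / 2\<close> up to a constant, and this is the stated one.

  Four analytic facts support this computation.

  The Riccati equations have bounded solutions with \<open>\<bar>a\<bar>, \<bar>b\<bar> \<le> 1/2\<close> when the mass is small,
  uniformly in \<open>\<kappa>\<close>: the kernel of \<open>(\<partial> - 2 c)\<^sup>-\<^sup>1\<close> has \<open>L\<^sup>2\<close> norm of order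
  \<open>\<bar>c\<bar>\<^sup>-\<^sup>1\<^sup>/\<^sup>2 = \<bar>\<kappa>\<bar>\<^sup>-\<^sup>1\<close>, which cancels the factor \<open>\<kappa>\<close> in front of \<open>q\<close>, so a contraction
  argument applies (\<open>riccati_solution\<close>).

  The kernel so constructed is the kernel of \<open>L(\<kappa>)\<^sup>-\<^sup>1\<close> on \<open>L2\<close> (\<open>inverse_kernel_green\<close>).  It
  decays exponentially away from the diagonal, hence it defines a bounded operator.  That this
  operator inverts \<open>L(\<kappa>)\<close> in the weak sense is proved by duality: the adjoint equation can be
  solved within Schwartz space, and Schwartz functions separate the elements of \<open>L2\<close>.

  The ratios are differentiable in time, and \<open>a\<^sub>t = C - 2 A a - B a\<^sup>2\<close>.  Both sides solve the
  Riccati equation linearised at \<open>a\<close>, the right-hand side by zero curvature, and the linearised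
  equation has at most one bounded solution.  Its a priori bound (\<open>linear_estimate\<close>) in fact
  controls the difference quotients directly (\<open>riccati_time_derivative\<close>).

  The mass is conserved (\<open>mass_derivative\<close>, \<open>dnls_mass_stationary\<close>), so smallness at time zero
  persists.\<close>

section \<open>Schwartz functions\<close>

definition rapid :: "(real \<Rightarrow> complex) \<Rightarrow> bool" where
  "rapid f \<longleftrightarrow> (\<forall>m. \<exists>C. \<forall>x. \<bar>x\<bar> ^ m * norm (f x) \<le> C)"

lemma dx_eqI: "(f has_vector_derivative D) (at x) \<Longrightarrow> dx f x = D"
  by (simp add: dx_def vector_derivative_at)

text \<open>Schwartz space is the largest class of differentiable, rapidly decreasing functions that is
  stable under \<open>dx\<close>; bounds on derivatives of all orders thus reduce to exhibiting one such
  class.\<close>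

lemma schwartz_coinduct:
  assumes "f \<in> X"
    and diff: "\<And>f x. f \<in> X \<Longrightarrow> f differentiable at x"
    and rapid: "\<And>f. f \<in> X \<Longrightarrow> rapid f"
    and closed: "\<And>f. f \<in> X \<Longrightarrow> dx f \<in> X"
  shows "f \<in> schwartz"
proof -
  have "(dx ^^ n) f \<in> X" for n
    by (induction n) (auto simp: \<open>f \<in> X\<close> closed)
  then show ?thesis
    using diff rapid by (fastforce simp: schwartz_def rapid_def bdd_above_def)
qed

lemma schwartz_differentiable: "f \<in> schwartz \<Longrightarrow> f differentiable at x"
  using funpow_0 by (fastforce simp: schwartz_def dest: spec[of _ 0])

lemma schwartz_has_dx:
  "f \<in> schwartz \<Longrightarrow> (f has_vector_derivative dx f x) (at x)"
  using schwartz_differentiable[of f x] by (simp add: dx_def vector_derivative_works)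

lemma schwartz_dx:
  assumes "f \<in> schwartz" shows "dx f \<in> schwartz"
proof -
  have *: "(dx ^^ n) (dx f) = (dx ^^ Suc n) f" for n
    by (simp add: funpow_swap1)
  note A = assms[unfolded schwartz_def mem_Collect_eq]
  show ?thesis
    unfolding schwartz_def mem_Collect_eq *
    by (intro conjI allI) (rule A[THEN conjunct1, rule_format], rule A[THEN conjunct2, rule_format])
qed

lemma schwartz_seminorm_bdd:
  "f \<in> schwartz \<Longrightarrow> bdd_above (range (\<lambda>x. \<bar>x\<bar> ^ m * norm ((dx ^^ n) f x)))"
  by (simp add: schwartz_def)

lemma schwartz_seminorm_bound:
  assumes "f \<in> schwartz"
  shows "\<bar>x\<bar> ^ m * norm ((dx ^^ n) f x) \<le> schwartz_seminorm m n f"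
  unfolding schwartz_seminorm_def
  by (rule cSUP_upper[OF _ schwartz_seminorm_bdd[OF assms]]) simp

lemma schwartz_rapid: "f \<in> schwartz \<Longrightarrow> rapid f"
  using schwartz_seminorm_bound[of f _ _ 0] unfolding rapid_def by fastforce

lemma rapid_mult_bounded:
  assumes "rapid f" "bounded (range s)"
  shows "rapid (\<lambda>x. f x * s x)"
  unfolding rapid_def
proof
  fix m
  obtain B where B: "\<And>x. norm (s x) \<le> B"
    using assms(2) by (auto simp: bounded_iff)
  obtain C where C: "\<And>x. \<bar>x\<bar> ^ m * norm (f x) \<le> C"
    using assms(1) by (auto simp: rapid_def)
  have "\<bar>x\<bar> ^ m * norm (f x * s x) \<le> C * B" for x
    using mult_mono[OF C[of x] B[of x]] order_trans[OF _ C[of x], of 0]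
    by (simp add: norm_mult mult.assoc)
  then show "\<exists>C. \<forall>x. \<bar>x\<bar> ^ m * norm (f x * s x) \<le> C" by blast
qed

lemma rapid_add:
  assumes "rapid f" "rapid g"
  shows "rapid (\<lambda>x. f x + g x)"
  unfolding rapid_def
proof
  fix m
  obtain B where B: "\<And>x. \<bar>x\<bar> ^ m * norm (g x) \<le> B"
    using assms(2) by (auto simp: rapid_def)
  obtain C where C: "\<And>x. \<bar>x\<bar> ^ m * norm (f x) \<le> C"
    using assms(1) by (auto simp: rapid_def)
  have "\<bar>x\<bar> ^ m * norm (f x + g x) \<le> C + B" for x
  proof -
    have "\<bar>x\<bar> ^ m * norm (f x + g x) \<le> \<bar>x\<bar> ^ m * (norm (f x) + norm (g x))"
      by (intro mult_left_mono norm_triangle_ineq) auto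
    then show ?thesis using B[of x] C[of x] by (simp add: distrib_left)
  qed
  then show "\<exists>C. \<forall>x. \<bar>x\<bar> ^ m * norm (f x + g x) \<le> C" by blast
qed

lemma rapid_imp_bounded: "rapid f \<Longrightarrow> bounded (range f)"
  unfolding rapid_def bounded_iff by (metis mult_1 power_0 rangeE)

lemma schwartz_bounded: "f \<in> schwartz \<Longrightarrow> bounded (range f)"
  by (intro rapid_imp_bounded schwartz_rapid)

inductive_set module_hull ::
  "(real \<Rightarrow> complex) set \<Rightarrow> (real \<Rightarrow> complex) set \<Rightarrow> (real \<Rightarrow> complex) set" for F S where
  gen: "f \<in> F \<Longrightarrow> f \<in> module_hull F S"
| add: "f \<in> module_hull F S \<Longrightarrow> g \<in> module_hull F S \<Longrightarrow> (\<lambda>x. f x + g x) \<in> module_hull F S"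
| scale: "f \<in> module_hull F S \<Longrightarrow> (\<lambda>x. k * f x) \<in> module_hull F S"
| mult: "f \<in> module_hull F S \<Longrightarrow> s \<in> S \<Longrightarrow> (\<lambda>x. f x * s x) \<in> module_hull F S"

text \<open>By the Leibniz rule it suffices to look at first derivatives of the generators: the hull
  is then a class as in \<open>schwartz_coinduct\<close>.  Besides the algebraic closure properties of Schwartz
  space, this yields the regularity of solutions of linear differential equations whose
  coefficients lie in \<open>S\<close>.\<close>

lemma module_hull_schwartz:
  assumes F_diff: "\<And>f x. f \<in> F \<Longrightarrow> f differentiable at x"
    and F_rapid: "\<And>f. f \<in> F \<Longrightarrow> rapid f"
    and F_dx: "\<And>f. f \<in> F \<Longrightarrow> dx f \<in> module_hull F S"
    and S_diff: "\<And>s x. s \<in> S \<Longrightarrow> s differentiable at x"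
    and S_bounded: "\<And>s. s \<in> S \<Longrightarrow> bounded (range s)"
    and S_dx: "\<And>f s. f \<in> module_hull F S \<Longrightarrow> s \<in> S \<Longrightarrow> (\<lambda>x. f x * dx s x) \<in> module_hull F S"
  shows "module_hull F S \<subseteq> schwartz"
proof
  fix f assume "f \<in> module_hull F S"
  have *: "(\<forall>x. (f has_vector_derivative dx f x) (at x)) \<and> rapid f \<and> dx f \<in> module_hull F S"
    if "f \<in> module_hull F S" for f
    using that
  proof (induction rule: module_hull.induct)
    case (gen f)
    then show ?case
      using F_diff F_rapid F_dx by (simp add: dx_def vector_derivative_works)
  next
    case (add f g)
    then have "((\<lambda>x. f x + g x) has_vector_derivative dx f x + dx g x) (at x)" for x
      by (intro derivative_intros) auto
    moreover from this have "dx (\<lambda>x. f x + g x) = (\<lambda>x. dx f x + dx g x)"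
      by (intro ext dx_eqI)
    ultimately show ?case
      using add by (auto intro: rapid_add module_hull.add)
  next
    case (scale f k)
    then have "((\<lambda>x. k * f x) has_vector_derivative k * dx f x) (at x)" for x
      by (auto intro!: derivative_eq_intros)
    moreover from this have "dx (\<lambda>x. k * f x) = (\<lambda>x. k * dx f x)"
      by (intro ext dx_eqI)
    moreover have "rapid (\<lambda>x. f x * k)"
      using scale by (intro rapid_mult_bounded) auto
    ultimately show ?case
      using scale by (auto intro: module_hull.scale simp: mult.commute)
  next
    case (mult f s)
    then have "(s has_vector_derivative dx s x) (at x)" for x
      using S_diff by (simp add: dx_def vector_derivative_works)
    then have "((\<lambda>x. f x * s x) has_vector_derivative f x * dx s x + dx f x * s x) (at x)" for x
      using mult by (intro has_vector_derivative_mult) auto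
    moreover from this have "dx (\<lambda>x. f x * s x) = (\<lambda>x. f x * dx s x + dx f x * s x)"
      by (intro ext dx_eqI)
    ultimately show ?case
      using mult S_dx S_bounded
      by (auto intro!: module_hull.add rapid_mult_bounded intro: module_hull.mult)
  qed
  show "f \<in> schwartz"
    by (rule schwartz_coinduct[of f "module_hull F S"])
      (use * \<open>f \<in> module_hull F S\<close> in \<open>auto intro: differentiableI_vector\<close>)
qed

lemma module_hull_schwartz_self: "module_hull schwartz schwartz \<subseteq> schwartz"
  by (rule module_hull_schwartz)
    (auto intro: schwartz_differentiable schwartz_rapid schwartz_bounded schwartz_dx
      module_hull.gen module_hull.mult)

lemma schwartz_add: "f \<in> schwartz \<Longrightarrow> g \<in> schwartz \<Longrightarrow> (\<lambda>x. f x + g x) \<in> schwartz"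
  using module_hull_schwartz_self module_hull.add module_hull.gen by blast

lemma schwartz_scale: "f \<in> schwartz \<Longrightarrow> (\<lambda>x. k * f x) \<in> schwartz"
  using module_hull_schwartz_self module_hull.scale module_hull.gen by blast

lemma schwartz_mult: "f \<in> schwartz \<Longrightarrow> g \<in> schwartz \<Longrightarrow> (\<lambda>x. f x * g x) \<in> schwartz"
  using module_hull_schwartz_self module_hull.mult module_hull.gen by blast

lemma schwartz_diff: "f \<in> schwartz \<Longrightarrow> g \<in> schwartz \<Longrightarrow> (\<lambda>x. f x - g x) \<in> schwartz"
  using schwartz_add[of f "\<lambda>x. -1 * g x"] schwartz_scale[of g "-1"] by simp

lemma schwartz_zero: "(\<lambda>x. 0) \<in> schwartz"
  by (rule schwartz_coinduct[of _ "{\<lambda>x. 0}"]) (auto simp: rapid_def dx_def)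

lemma schwartz_cnj:
  assumes "f \<in> schwartz"
  shows "(\<lambda>x. cnj (f x)) \<in> schwartz" "dx (\<lambda>x. cnj (f x)) = (\<lambda>x. cnj (dx f x))"
proof -
  have D: "((\<lambda>x. cnj (f x)) has_vector_derivative cnj (dx f x)) (at x)" if "f \<in> schwartz" for f x
    using has_vector_derivative_cnj[OF schwartz_has_dx[OF that]] .
  show E: "dx (\<lambda>x. cnj (f x)) = (\<lambda>x. cnj (dx f x))"
    by (intro ext dx_eqI D assms)
  show "(\<lambda>x. cnj (f x)) \<in> schwartz"
  proof (rule schwartz_coinduct[of _ "(\<lambda>f x. cnj (f x)) ` schwartz"])
    fix g x assume "g \<in> (\<lambda>f x. cnj (f x)) ` schwartz"
    then show "g differentiable at x"
      using D by (auto intro: differentiableI_vector)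
  next
    fix g assume "g \<in> (\<lambda>f x. cnj (f x)) ` schwartz"
    then show "rapid g" using schwartz_rapid by (auto simp: rapid_def)
  next
    fix g assume "g \<in> (\<lambda>f x. cnj (f x)) ` schwartz"
    then obtain f where f: "f \<in> schwartz" "g = (\<lambda>x. cnj (f x))" by blast
    then have "dx g = (\<lambda>x. cnj (dx f x))" by (auto intro!: dx_eqI D)
    then show "dx g \<in> (\<lambda>f x. cnj (f x)) ` schwartz" using f schwartz_dx by blast
  qed (use assms in blast)
qed

lemma schwartz_conj_pot:
  assumes "q \<in> schwartz"
  shows "conj_pot q \<in> schwartz" "dx (conj_pot q) = conj_pot (dx q)"
proof -
  have *: "conj_pot q = (\<lambda>x. -1 * cnj (q x))" by (auto simp: conj_pot_def)
  show "conj_pot q \<in> schwartz"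
    unfolding * by (intro schwartz_scale schwartz_cnj assms)
  have "(conj_pot q has_vector_derivative conj_pot (dx q) x) (at x)" for x
    using has_vector_derivative_cnj[OF schwartz_has_dx[OF assms, of x]]
    unfolding conj_pot_def by (auto intro: derivative_intros)
  then show "dx (conj_pot q) = conj_pot (dx q)" by (intro ext dx_eqI)
qed

lemma schwartz_continuous: "f \<in> schwartz \<Longrightarrow> continuous_on A f"
  by (meson schwartz_has_dx has_vector_derivative_continuous continuous_at_imp_continuous_on)

lemma schwartz_measurable [measurable_dest]: "f \<in> schwartz \<Longrightarrow> f \<in> borel_measurable borel"
  by (intro borel_measurable_continuous_onI schwartz_continuous)

lemma integrable_inverse_1_plus_square_lborel:
  "integrable lborel (\<lambda>x::real. inverse (1 + x\<^sup>2))"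
  using integrable_inverse_1_plus_square by (simp add: set_integrable_def)

lemma integrable_dominated:
  fixes f :: "'a \<Rightarrow> 'b::{banach, second_countable_topology}" and g :: "'a \<Rightarrow> real"
  assumes "integrable M g" "f \<in> borel_measurable M" "\<And>x. norm (f x) \<le> g x"
  shows "integrable M f"
  by (rule Bochner_Integration.integrable_bound[OF assms(1,2)])
    (auto intro!: AE_I2 order_trans[OF assms(3) abs_ge_self])

lemma integrable_decay:
  fixes f :: "real \<Rightarrow> 'a::{banach, second_countable_topology}"
  assumes "f \<in> borel_measurable borel" "\<And>x. norm (f x) \<le> C * inverse (1 + x\<^sup>2)"
  shows "integrable lborel f"
  by (rule integrable_dominated[OF integrable_mult_right[OF integrable_inverse_1_plus_square_lborel]])
    (use assms in auto)

lemma rapid_decay: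
  assumes "rapid f"
  obtains C where "C > 0" "\<And>x. norm (f x) \<le> C * inverse (1 + x\<^sup>2)"
proof -
  obtain C0 where C0: "\<And>x. norm (f x) \<le> C0"
    using assms unfolding rapid_def by (metis mult_1 power_0)
  obtain C2 where C2: "\<And>x. \<bar>x\<bar>\<^sup>2 * norm (f x) \<le> C2"
    using assms unfolding rapid_def by blast
  have "norm (f x) \<le> (\<bar>C0\<bar> + \<bar>C2\<bar> + 1) * inverse (1 + x\<^sup>2)" for x
  proof -
    have "(1 + x\<^sup>2) * norm (f x) \<le> \<bar>C0\<bar> + \<bar>C2\<bar> + 1"
      using C0[of x] C2[of x] by (simp add: algebra_simps)
    then show ?thesis
      by (simp add: divide_inverse[symmetric] pos_le_divide_eq add_pos_nonneg mult.commute)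
  qed
  then show thesis by (intro that[of "\<bar>C0\<bar> + \<bar>C2\<bar> + 1"]) auto
qed

lemma schwartz_integrable:
  assumes "f \<in> schwartz" shows "integrable lborel f"
proof -
  obtain C where "\<And>x. norm (f x) \<le> C * inverse (1 + x\<^sup>2)"
    using rapid_decay[OF schwartz_rapid[OF assms]] by metis
  then show ?thesis using integrable_decay[OF schwartz_measurable[OF assms]] by blast
qed

lemma schwartz_L2: 
  assumes "f \<in> schwartz" shows "f \<in> L2"
proof -
  note [measurable] = schwartz_measurable[OF assms]
  have "(\<lambda>x. f x * cnj (f x)) \<in> schwartz"
    by (intro schwartz_mult schwartz_cnj assms)
  then have "integrable lborel (\<lambda>x. norm (f x * cnj (f x)))"
    by (intro integrable_norm schwartz_integrable)
  then show ?thesis by (simp add: L2_def norm_mult power2_eq_square)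
qed

section \<open>Separation of square-integrable functions by Schwartz functions\<close>

lemma L2_measurable [measurable_dest]: "f \<in> L2 \<Longrightarrow> f \<in> borel_measurable borel"
  by (simp add: L2_def)

lemma L2_mult_integrable:
  fixes f g :: "real \<Rightarrow> complex"
  assumes "f \<in> L2" "g \<in> L2"
  shows "integrable lborel (\<lambda>x. f x * g x)"
proof (rule integrable_dominated)
  show "integrable lborel (\<lambda>x. (norm (f x))\<^sup>2 + (norm (g x))\<^sup>2)"
    using assms by (auto simp: L2_def)
  show "(\<lambda>x. f x * g x) \<in> borel_measurable lborel"
    using assms by (auto simp: L2_def)
  show "norm (f x * g x) \<le> (norm (f x))\<^sup>2 + (norm (g x))\<^sup>2" for x
    unfolding norm_mult using sum_squares_bound[of "norm (f x)" "norm (g x)"]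
      mult_nonneg_nonneg[OF norm_ge_zero norm_ge_zero, of "f x" "g x"] by linarith
qed

text \<open>These functions approximate indicators of half-lines as \<open>n\<close> grows, and their derivatives are
  polynomials in the functions themselves.  The second property makes \<open>module_hull_schwartz\<close>
  applicable.\<close>

definition logistic :: "real \<Rightarrow> real \<Rightarrow> real \<Rightarrow> complex" where
  "logistic n b x = of_real (1 / (1 + exp (n * (x - b))))"

lemma logistic_deriv:
  "(logistic n b has_vector_derivative
      - of_real n * (logistic n b x - (logistic n b x)\<^sup>2)) (at x)"
proof -
  define E where "E = exp (n * (x - b))"
  have pos: "1 + E > 0" by (simp add: E_def add_pos_pos)
  have "((\<lambda>x. 1 / (1 + exp (n * (x - b)))) has_field_derivative - (n * E) / (1 + E)\<^sup>2) (at x)"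
    using pos unfolding E_def
    by (auto intro!: derivative_eq_intros simp: power2_eq_square divide_simps)
  moreover have "- (n * E) / (1 + E)\<^sup>2 = - n * (1 / (1 + E) - (1 / (1 + E))\<^sup>2)"
    using pos by (simp add: power2_eq_square divide_simps)
  ultimately have "((\<lambda>x. 1 / (1 + exp (n * (x - b)))) has_field_derivative
      - n * (1 / (1 + E) - (1 / (1 + E))\<^sup>2)) (at x)" by simp
  then have "((\<lambda>x. complex_of_real (1 / (1 + exp (n * (x - b))))) has_vector_derivative
      of_real (- n * (1 / (1 + E) - (1 / (1 + E))\<^sup>2))) (at x)"
    by (rule has_vector_derivative_of_real)
  then show ?thesis
    by (simp add: logistic_def[abs_def] E_def)
qed

lemma norm_logistic_le: "norm (logistic n b x) \<le> 1"
  unfolding logistic_def norm_of_real by (simp add: divide_le_eq add_pos_pos)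

lemma abs_power_le_exp:
  fixes x :: real
  shows "\<bar>x\<bar> ^ m \<le> fact m * exp \<bar>x\<bar>"
proof -
  have "(\<Sum>i\<in>{m}. \<bar>x\<bar> ^ i /\<^sub>R fact i) \<le> (\<Sum>i. \<bar>x\<bar> ^ i /\<^sub>R fact i)"
    by (rule sum_le_suminf) (use exp_converges[of "\<bar>x\<bar>"] in \<open>auto simp: sums_iff\<close>)
  then show ?thesis
    using exp_converges[of "\<bar>x\<bar>"] by (simp add: sums_iff field_simps)
qed

text \<open>Minus the derivative of \<open>logistic 1 0\<close>: a Schwartz function without zeros.\<close>

definition bump :: "real \<Rightarrow> complex" where
  "bump x = logistic 1 0 x - (logistic 1 0 x)\<^sup>2"

lemma norm_bump_le: "norm (bump x) \<le> exp (- \<bar>x\<bar>)"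
proof -
  have pos: "1 + exp x > 0" by (simp add: add_pos_pos)
  have eq: "bump x = of_real (exp x / (1 + exp x)\<^sup>2)"
    using pos unfolding bump_def logistic_def of_real_power[symmetric] of_real_diff[symmetric]
      of_real_eq_iff
    by (simp add: power2_eq_square divide_simps)
  have "norm (bump x) = exp x / (1 + exp x)\<^sup>2"
    unfolding eq norm_of_real by simp
  also have "\<dots> \<le> exp (- \<bar>x\<bar>)"
  proof (cases "x \<ge> 0")
    case True
    have "exp x * exp x \<le> (1 + exp x)\<^sup>2"
      by (simp add: power2_eq_square algebra_simps add_nonneg_nonneg)
    then show ?thesis using True pos by (simp add: exp_minus field_simps)
  next
    case False
    have "1 \<le> (1 + exp x)\<^sup>2" by (intro one_le_power) auto
    then have "exp x * 1 \<le> exp x * (1 + exp x)\<^sup>2" by (intro mult_left_mono) auto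
    then show ?thesis using False pos by (simp add: divide_le_eq)
  qed
  finally show ?thesis .
qed

lemma bump_nonzero: "bump x \<noteq> 0"
proof
  assume "bump x = 0"
  moreover have "bump x = of_real (1 / (1 + exp x) - (1 / (1 + exp x))\<^sup>2)"
    unfolding bump_def logistic_def by simp
  ultimately have "1 / (1 + exp x) - (1 / (1 + exp x))\<^sup>2 = 0"
    by (simp only: of_real_eq_0_iff)
  moreover have "1 + exp x > 1" by simp
  ultimately show False
    by (simp add: power2_eq_square divide_simps split: if_splits)
qed

lemma bump_rapid: "rapid bump"
  unfolding rapid_def
proof
  fix m
  have "\<bar>x\<bar> ^ m * norm (bump x) \<le> fact m" for x
  proof -
    have "\<bar>x\<bar> ^ m * norm (bump x) \<le> (fact m * exp \<bar>x\<bar>) * exp (- \<bar>x\<bar>)"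
      by (intro mult_mono abs_power_le_exp norm_bump_le) auto
    also have "\<dots> = fact m" by (simp add: mult.assoc exp_minus)
    finally show ?thesis .
  qed
  then show "\<exists>C. \<forall>x. \<bar>x\<bar> ^ m * norm (bump x) \<le> C" by blast
qed

lemma bump_logistic_schwartz: "(\<lambda>x. bump x * logistic n b x) \<in> schwartz"
proof -
  let ?S = "{logistic 1 0, logistic n b}" and ?F = "{bump}"
  let ?H = "module_hull ?F ?S"
  have diff: "(\<lambda>x. f x - g x) \<in> ?H" if "f \<in> ?H" "g \<in> ?H" for f g
    using module_hull.add[OF that(1) module_hull.scale[OF that(2), of "-1"]] by simp
  have mult2: "(\<lambda>x. k * (f x * (s x - (s x)\<^sup>2))) \<in> ?H" if "f \<in> ?H" "s \<in> ?S" for f s k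
    using module_hull.scale[OF diff[OF module_hull.mult[OF that]
      module_hull.mult[OF module_hull.mult[OF that] that(2)]], of k]
    by (simp add: power2_eq_square algebra_simps)
  have dlog: "dx (logistic m c) = (\<lambda>x. - of_real m * (logistic m c x - (logistic m c x)\<^sup>2))" for m c
    by (intro ext dx_eqI logistic_deriv)
  have dbump: "(bump has_vector_derivative - 1 * (bump x - 2 * (bump x * logistic 1 0 x))) (at x)" for x
    unfolding bump_def[abs_def]
    by (auto intro!: derivative_eq_intros logistic_deriv simp: power2_eq_square algebra_simps)
  have "?H \<subseteq> schwartz"
  proof (rule module_hull_schwartz)
    fix f x assume "f \<in> ?F"
    then show "f differentiable at x" using dbump by (auto intro: differentiableI_vector)
  next
    fix f assume "f \<in> ?F" then show "rapid f" using bump_rapid by simp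
  next
    fix f assume f: "f \<in> ?F"
    then have "dx f = (\<lambda>x. - 1 * (bump x - 2 * (bump x * logistic 1 0 x)))"
      by (intro ext dx_eqI) (use dbump in simp)
    moreover have "\<dots> \<in> ?H"
      by (intro module_hull.scale diff module_hull.mult module_hull.gen) auto
    ultimately show "dx f \<in> ?H" by simp
  next
    fix s x assume "s \<in> ?S"
    then show "s differentiable at x" using logistic_deriv by (auto intro: differentiableI_vector)
  next
    fix s assume "s \<in> ?S"
    then show "bounded (range s)" using norm_logistic_le by (auto simp: bounded_iff)
  next
    fix f s assume fs: "f \<in> ?H" "s \<in> ?S"
    then obtain m c where s: "s = logistic m c" by blast
    have "(\<lambda>x. f x * dx s x) = (\<lambda>x. - of_real m * (f x * (s x - (s x)\<^sup>2)))"
      by (auto simp: s dlog)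
    then show "(\<lambda>x. f x * dx s x) \<in> ?H" using mult2[OF fs, of "- of_real m"] by simp
  qed
  then show ?thesis
    using module_hull.mult[OF module_hull.gen[of bump ?F ?S], of "logistic n b"] by blast
qed

lemma bump_schwartz: "bump \<in> schwartz"
proof -
  have "(\<lambda>x. 2 * (bump x * logistic 0 0 x)) \<in> schwartz"
    by (intro schwartz_scale bump_logistic_schwartz)
  then show ?thesis by (simp add: logistic_def)
qed

lemma logistic_tendsto:
  assumes "x \<noteq> b"
  shows "(\<lambda>n. logistic (real n) b x) \<longlonglongrightarrow> indicator {..b} x"
proof -
  have "(\<lambda>n. 1 / (1 + exp (real n * (x - b)))) \<longlonglongrightarrow> indicator {..b} x"
  proof (cases "x < b")
    case True
    have "filterlim (\<lambda>n. (x - b) * real n) at_bot sequentially"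
      by (rule filterlim_tendsto_neg_mult_at_bot[OF tendsto_const _ filterlim_real_sequentially])
        (use True in auto)
    then have "filterlim (\<lambda>n. real n * (x - b)) at_bot sequentially"
      by (simp add: mult.commute)
    then have "(\<lambda>n. exp (real n * (x - b))) \<longlonglongrightarrow> 0"
      by (rule filterlim_compose[OF exp_at_bot])
    then have "(\<lambda>n. 1 / (1 + exp (real n * (x - b)))) \<longlonglongrightarrow> 1 / (1 + 0)"
      by (intro tendsto_intros) auto
    then show ?thesis using True by simp
  next
    case False
    have "filterlim (\<lambda>n. (x - b) * real n) at_top sequentially"
      by (rule filterlim_tendsto_pos_mult_at_top[OF tendsto_const _ filterlim_real_sequentially])
        (use False assms in auto)
    then have "filterlim (\<lambda>n. real n * (x - b)) at_top sequentially"
      by (simp add: mult.commute)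
    then have "filterlim (\<lambda>n. exp (real n * (x - b))) at_top sequentially"
      by (rule filterlim_compose[OF exp_at_top])
    then have "filterlim (\<lambda>n. 1 + exp (real n * (x - b))) at_top sequentially"
      by (rule filterlim_tendsto_add_at_top[OF tendsto_const])
    then have "(\<lambda>n. inverse (1 + exp (real n * (x - b)))) \<longlonglongrightarrow> 0"
      by (rule tendsto_inverse_0_at_top)
    then show ?thesis using False assms by (simp add: field_simps)
  qed
  then have "(\<lambda>n. logistic (real n) b x) \<longlonglongrightarrow> of_real (indicator {..b} x)"
    unfolding logistic_def by (rule tendsto_of_real)
  then show ?thesis by (cases "x \<le> b") simp_all
qed

text \<open>The half-lines \<open>{..b}\<close> form an intersection-stable generator of the Borel sets.\<close>

lemma AE_zero_if_initial_integrals_zero: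
  fixes W :: "real \<Rightarrow> complex"
  assumes W: "integrable lborel W"
    and zero: "\<And>b. (LBINT x. indicator {..b} x *\<^sub>R W x) = 0"
  shows "AE x in lborel. W x = 0"
proof (rule sigma_finite_measure.density_zero[OF sigma_finite_lborel W])
  fix A assume "A \<in> sets (lborel :: real measure)"
  then have A: "A \<in> sigma_sets UNIV (range (\<lambda>b::real. {..b}))"
    by (simp add: borel_eq_atMost)
  have sub: "range (\<lambda>b::real. {..b}) \<subseteq> Pow UNIV" by auto
  have int: "set_integrable lborel B W" if "B \<in> sets borel" for B
    using that W unfolding set_integrable_def by (intro integrable_mult_indicator) auto
  have sets: "B \<in> sets borel" if "B \<in> sigma_sets UNIV (range (\<lambda>b::real. {..b}))" for B
    using that by (simp add: borel_eq_atMost)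
  have total: "(LBINT x. W x) = 0"
    using tendsto_integral_at_top[OF _ W] LIMSEQ_unique zero by (simp add: tendsto_const_iff)
  have "Int_stable (range (\<lambda>b::real. {..b}))" by (auto simp: Int_stable_def)
  from this sub A show "set_lebesgue_integral lborel A W = 0"
  proof (induction rule: sigma_sets_induct_disjoint)
    case (basic B)
    then show ?case using zero by (auto simp: set_lebesgue_integral_def)
  next
    case empty show ?case by (simp add: set_lebesgue_integral_def)
  next
    case (compl B)
    have B: "B \<in> sets borel" by (rule sets[OF compl(1)])
    have "set_lebesgue_integral lborel UNIV W
        = set_lebesgue_integral lborel B W + set_lebesgue_integral lborel (UNIV - B) W"
      using set_integral_Un[of B "UNIV - B" lborel W] int B by auto
    then show ?case using total compl by (simp add: set_lebesgue_integral_def)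
  next
    case (union B)
    have B: "B i \<in> sets borel" for i using union(2) sets by blast
    have "set_lebesgue_integral lborel (\<Union>i. B i) W = (\<Sum>i. set_lebesgue_integral lborel (B i) W)"
      by (rule lebesgue_integral_countable_add)
        (use B union(1) int in \<open>auto simp: disjoint_family_on_def intro!: sets.countable_UN\<close>)
    then show ?case using union by simp
  qed
qed

text \<open>Multiplying \<open>w\<close> by \<open>bump\<close> makes it integrable; logistic functions, which are multipliers
  of Schwartz space, then approximate indicators of half-lines.\<close>

lemma schwartz_separates_L2:
  assumes w: "w \<in> L2" and orth: "\<And>g. g \<in> schwartz \<Longrightarrow> (LBINT x. w x * g x) = 0"
  shows "AE x in lborel. w x = 0"
proof -
  let ?W = "\<lambda>x. w x * bump x"
  note [measurable] = L2_measurable[OF w] schwartz_measurable[OF bump_schwartz]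
  have W: "integrable lborel ?W"
    by (intro L2_mult_integrable w schwartz_L2 bump_schwartz)
  have "AE x in lborel. ?W x = 0"
  proof (rule AE_zero_if_initial_integrals_zero[OF W])
    fix b
    have meas: "logistic n b \<in> borel_measurable borel" for n
      unfolding logistic_def[abs_def] by measurable
    have "(\<lambda>n. LBINT x. ?W x * logistic (real n) b x)
        \<longlonglongrightarrow> (LBINT x. indicator {..b} x *\<^sub>R ?W x)"
    proof (rule integral_dominated_convergence[where w = "\<lambda>x. norm (?W x)"])
      show "AE x in lborel. (\<lambda>n. ?W x * logistic (real n) b x) \<longlonglongrightarrow> indicator {..b} x *\<^sub>R ?W x"
      proof (rule AE_mp[OF AE_lborel_singleton[of b]], intro AE_I2 impI)
        fix x assume "x \<noteq> b"
        have "(\<lambda>n. ?W x * logistic (real n) b x) \<longlonglongrightarrow> ?W x * indicator {..b} x"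
          by (intro tendsto_intros logistic_tendsto \<open>x \<noteq> b\<close>)
        then show "(\<lambda>n. ?W x * logistic (real n) b x) \<longlonglongrightarrow> indicator {..b} x *\<^sub>R ?W x"
          by (cases "x \<le> b") simp_all
      qed
      show "AE x in lborel. norm (?W x * logistic (real n) b x) \<le> norm (?W x)" for n
        using norm_logistic_le by (auto simp: norm_mult intro!: mult_left_le)
    qed (use W meas in auto)
    moreover have "(LBINT x. ?W x * logistic (real n) b x) = 0" for n
      using orth[OF bump_logistic_schwartz, of "real n" b] by (simp add: mult.assoc)
    ultimately show "(LBINT x. indicator {..b} x *\<^sub>R ?W x) = 0"
      by (simp add: LIMSEQ_const_iff)
  qed
  then show ?thesis using bump_nonzero by simp
qed

section \<open>Integrals over half-lines\<close>

lemma tail_integral_deriv: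
  fixes h :: "real \<Rightarrow> complex"
  assumes cont: "continuous_on UNIV h" and int: "\<And>a. set_integrable lborel {a..} h"
  shows "((\<lambda>x. LBINT y:{x..}. h y) has_vector_derivative - h x) (at x)"
proof -
  let ?T = "\<lambda>x. LBINT y:{x..}. h y"
  \<comment> \<open>near \<open>x\<close>, the tail integral differs by a constant from an integral over a compact interval\<close>
  have split: "?T y = ?T (x - 1) - integral {x - 1..y} h" if "y \<in> {x - 1<..<x + 1}" for y
  proof -
    have iv: "set_integrable lborel {x - 1..y} h"
      by (rule set_integrable_subset[OF int[of "x - 1"]]) auto
    have "?T (x - 1) = (LBINT z:{x - 1..y} \<union> {y..}. h z)"
      using that by (intro arg_cong2[where f = "\<lambda>A f. set_lebesgue_integral lborel A f"]) auto
    also have "\<dots> = (LBINT z:{x - 1..y}. h z) + ?T y"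
    proof (rule set_integral_Un_AE)
      show "AE z in lborel. \<not> (z \<in> {x - 1..y} \<and> z \<in> {y..})"
        by (rule AE_mp[OF AE_lborel_singleton[of y]]) auto
    qed (use iv int in auto)
    also have "(LBINT z:{x - 1..y}. h z) = integral {x - 1..y} h"
      by (rule set_borel_integral_eq_integral(2)[OF iv])
    finally show ?thesis by simp
  qed
  have "((\<lambda>y. integral {x - 1..y} h) has_vector_derivative h x) (at x within {x - 1..x + 1})"
    by (rule integral_has_vector_derivative) (auto intro: continuous_on_subset[OF cont])
  then have "((\<lambda>y. integral {x - 1..y} h) has_vector_derivative h x) (at x)"
    by (simp add: at_within_Icc_at)
  then have "((\<lambda>y. ?T (x - 1) - integral {x - 1..y} h) has_vector_derivative 0 - h x) (at x)"
    by (intro derivative_intros)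
  then have "((\<lambda>y. ?T (x - 1) - integral {x - 1..y} h) has_vector_derivative - h x) (at x)"
    by simp
  then show ?thesis
    by (rule has_vector_derivative_transform_within_open[of _ _ _ "{x - 1<..<x + 1}"])
      (auto simp: split)
qed

lemma head_integral_reflect:
  fixes h :: "real \<Rightarrow> complex"
  shows "(LBINT y:{..x}. h y) = (LBINT y:{-x..}. h (- y))"
    and "set_integrable lborel {..x} h \<Longrightarrow> set_integrable lborel {-x..} (\<lambda>y. h (- y))"
proof -
  show "(LBINT y:{..x}. h y) = (LBINT y:{-x..}. h (- y))"
    by (subst set_integral_reflect) (auto intro!: arg_cong2[where f = "\<lambda>A f. set_lebesgue_integral lborel A f"])
  assume "set_integrable lborel {..x} h"
  then show "set_integrable lborel {-x..} (\<lambda>y. h (- y))"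
    using lborel_integrable_real_affine[of "\<lambda>y. indicator {..x} y *\<^sub>R h y" "-1" 0]
    unfolding set_integrable_def
    by (simp, elim Bochner_Integration.integrable_cong[THEN iffD1, rotated 2]) (auto simp: indicator_def)
qed

lemma has_vector_derivative_reflect:
  fixes F :: "real \<Rightarrow> 'a::real_normed_vector"
  assumes "(F has_vector_derivative D) (at (- y))"
  shows "((\<lambda>y. F (- y)) has_vector_derivative - D) (at y)"
proof -
  have "(uminus has_vector_derivative (- 1)) (at y)"
    by (auto intro!: derivative_eq_intros)
  then show ?thesis
    using vector_diff_chain_at[of uminus "-1" y F D] assms by (simp add: o_def)
qed

lemma head_integral_deriv:
  fixes h :: "real \<Rightarrow> complex"
  assumes cont: "continuous_on UNIV h" and int: "\<And>a. set_integrable lborel {..a} h"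
  shows "((\<lambda>x. LBINT y:{..x}. h y) has_vector_derivative h x) (at x)"
proof -
  have int': "set_integrable lborel {a..} (\<lambda>y. h (- y))" for a
    using head_integral_reflect(2)[OF int[of "-a"]] by simp
  have "((\<lambda>x. LBINT y:{x..}. h (- y)) has_vector_derivative - h (- (- x))) (at (- x))"
    by (intro tail_integral_deriv int' continuous_on_compose2[OF cont] continuous_intros) auto
  from has_vector_derivative_reflect[OF this] show ?thesis
    by (simp add: head_integral_reflect(1))
qed

lemma tail_integral_FTC:
  fixes h F :: "real \<Rightarrow> complex"
  assumes cont: "continuous_on UNIV h" and int: "set_integrable lborel {x..} h"
    and F: "\<And>y. (F has_vector_derivative h y) (at y)" and lim: "(F \<longlongrightarrow> 0) at_top"
  shows "(LBINT y:{x..}. h y) = - F x"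
proof -
  let ?f = "\<lambda>y. indicator {x..} y *\<^sub>R h y"
  have "((\<lambda>T. LBINT y. indicator {..T} y *\<^sub>R ?f y) \<longlongrightarrow> (LBINT y. ?f y)) at_top"
    by (rule tendsto_integral_at_top) (use int in \<open>auto simp: set_integrable_def\<close>)
  moreover have "\<forall>\<^sub>F T in at_top. (LBINT y. indicator {..T} y *\<^sub>R ?f y) = F T - F x"
  proof (rule eventually_mono[OF eventually_ge_at_top[of x]])
    fix T assume "x \<le> T"
    have "(LBINT y. indicator {..T} y *\<^sub>R ?f y) = (LBINT y. indicator {x..T} y *\<^sub>R h y)"
      by (intro Bochner_Integration.integral_cong) (auto simp: indicator_def)
    also have "\<dots> = F T - F x"
      by (rule integral_FTC_atLeastAtMost[OF \<open>x \<le> T\<close>])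
        (auto intro: has_vector_derivative_at_within F continuous_on_subset[OF cont])
    finally show "(LBINT y. indicator {..T} y *\<^sub>R ?f y) = F T - F x" .
  qed
  ultimately have "((\<lambda>T. F T - F x) \<longlongrightarrow> (LBINT y. ?f y)) at_top"
    by (rule Lim_transform_eventually)
  moreover have "((\<lambda>T. F T - F x) \<longlongrightarrow> 0 - F x) at_top"
    by (intro tendsto_intros lim)
  ultimately show ?thesis
    using tendsto_unique[OF trivial_limit_at_top_linorder] by (fastforce simp: set_lebesgue_integral_def)
qed

lemma head_integral_FTC:
  fixes h F :: "real \<Rightarrow> complex"
  assumes cont: "continuous_on UNIV h" and int: "set_integrable lborel {..x} h"
    and F: "\<And>y. (F has_vector_derivative h y) (at y)" and lim: "(F \<longlongrightarrow> 0) at_bot"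
  shows "(LBINT y:{..x}. h y) = F x"
proof -
  have "(LBINT y:{-x..}. - h (- y)) = - F (- (- x))"
  proof (rule tail_integral_FTC[where F = "\<lambda>y. F (- y)"])
    show "continuous_on UNIV (\<lambda>y. - h (- y))"
      by (intro continuous_intros continuous_on_compose2[OF cont]) auto
    show "set_integrable lborel {-x..} (\<lambda>y. - h (- y))"
      using head_integral_reflect(2)[OF int] by (simp add: set_integrable_def)
    show "((\<lambda>y. F (- y)) has_vector_derivative - h (- y)) (at y)" for y
      by (intro has_vector_derivative_reflect F)
    show "((\<lambda>y. F (- y)) \<longlongrightarrow> 0) at_top"
      using lim by (simp add: at_bot_mirror filterlim_filtermap)
  qed
  then show ?thesis
    unfolding head_integral_reflect(1)[of x h] by (simp add: set_lebesgue_integral_def)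
qed

lemma exp_tail:
  fixes k :: real
  assumes "k > 0"
  shows "set_integrable lborel {x..} (\<lambda>y. exp (- k * (y - x)))"
    and "(LBINT y:{x..}. exp (- k * (y - x))) = 1 / k"
proof -
  have "(\<integral>\<^sup>+y. ennreal (exp (- k * (y - x))) * indicator {x..} y \<partial>lborel)
      = ennreal (0 - (- exp (- k * (x - x)) / k))"
  proof (rule nn_integral_FTC_atLeast[where F = "\<lambda>y. - exp (- k * (y - x)) / k"])
    show "((\<lambda>y. - exp (- k * (y - x)) / k) has_real_derivative exp (- k * (y - x))) (at y)" for y
      using assms by (auto intro!: derivative_eq_intros)
    have "filterlim (\<lambda>y. - k * (y - x)) at_bot at_top"
      using assms by real_asymp
    then have "((\<lambda>y. exp (- k * (y - x))) \<longlongrightarrow> 0) at_top"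
      by (rule filterlim_compose[OF exp_at_bot])
    then have "((\<lambda>y. - exp (- k * (y - x)) / k) \<longlongrightarrow> - 0 / k) at_top"
      by (intro tendsto_intros) (use assms in auto)
    then show "((\<lambda>y. - exp (- k * (y - x)) / k) \<longlongrightarrow> 0) at_top" by simp
  qed auto
  then have nn: "(\<integral>\<^sup>+y. ennreal (indicator {x..} y *\<^sub>R exp (- k * (y - x))) \<partial>lborel) = ennreal (1 / k)"
    by (simp add: indicator_mult_ennreal mult.commute)
  have "has_bochner_integral lborel (\<lambda>y. indicator {x..} y *\<^sub>R exp (- k * (y - x))) (1 / k)"
    by (rule has_bochner_integral_nn_integral) (use nn assms in auto)
  then show "set_integrable lborel {x..} (\<lambda>y. exp (- k * (y - x)))"
    and "(LBINT y:{x..}. exp (- k * (y - x))) = 1 / k"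
    by (auto simp: has_bochner_integral_iff set_integrable_def set_lebesgue_integral_def)
qed

section \<open>Exponentially decaying kernels\<close>

text \<open>Polynomial weights cost only a fraction of an exponential rate.\<close>

lemma power_exp_bounded:
  fixes k :: real
  assumes "k > 0"
  obtains C where "C > 0" "\<And>z. \<bar>z\<bar> ^ m * exp (- k * \<bar>z\<bar>) \<le> C"
proof -
  have "\<bar>z\<bar> ^ m * exp (- k * \<bar>z\<bar>) \<le> fact m / k ^ m" for z
  proof -
    have "\<bar>k * z\<bar> ^ m * exp (- \<bar>k * z\<bar>) \<le> fact m * exp \<bar>k * z\<bar> * exp (- \<bar>k * z\<bar>)"
      by (intro mult_right_mono abs_power_le_exp) auto
    then show ?thesis
      using assms by (simp add: mult.assoc exp_minus abs_mult power_mult_distrib field_simps)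
  qed
  then show thesis using assms by (intro that[of "fact m / k ^ m"]) auto
qed

lemma integrable_exp_abs:
  fixes k :: real
  assumes "k > 0"
  shows "integrable lborel (\<lambda>y. exp (- k * \<bar>y\<bar>))"
proof -
  obtain C where C: "\<And>z. \<bar>z\<bar> ^ 2 * exp (- k * \<bar>z\<bar>) \<le> C"
    using power_exp_bounded[OF assms, of 2] by metis
  show ?thesis
  proof (rule integrable_decay[where C = "1 + C"])
    fix x
    have "exp (- k * \<bar>x\<bar>) \<le> 1" using assms by simp
    then have "(1 + x\<^sup>2) * exp (- k * \<bar>x\<bar>) \<le> 1 + C"
      using C[of x] unfolding distrib_right power2_abs by linarith
    then show "norm (exp (- k * \<bar>x\<bar>)) \<le> (1 + C) * inverse (1 + x\<^sup>2)"
      by (simp add: divide_inverse[symmetric] pos_le_divide_eq add_pos_nonneg mult.commute)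
  qed measurable
qed

lemma integrable_power_exp_abs:
  fixes k :: real
  assumes "k > 0"
  shows "integrable lborel (\<lambda>y. \<bar>y\<bar> ^ m * exp (- k * \<bar>y\<bar>))"
proof -
  obtain C where C: "\<And>z. \<bar>z\<bar> ^ m * exp (- (k/2) * \<bar>z\<bar>) \<le> C"
    using power_exp_bounded[of "k/2" m] assms by (metis half_gt_zero)
  show ?thesis
  proof (rule integrable_dominated)
    show "integrable lborel (\<lambda>y. C * exp (- (k/2) * \<bar>y\<bar>))"
      by (intro integrable_mult_right integrable_exp_abs) (use assms in auto)
    fix y
    have "exp (- k * \<bar>y\<bar>) = exp (- (k/2) * \<bar>y\<bar>) * exp (- (k/2) * \<bar>y\<bar>)"
      by (simp add: mult_exp_exp)
    then show "norm (\<bar>y\<bar> ^ m * exp (- k * \<bar>y\<bar>)) \<le> C * exp (- (k/2) * \<bar>y\<bar>)"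
      using mult_right_mono[OF C[of y], of "exp (- (k/2) * \<bar>y\<bar>)"]
      by (simp add: mult.assoc abs_mult)
  qed measurable
qed

lemma exp_abs_shift:
  fixes k :: real
  assumes "k > 0"
  shows "integrable lborel (\<lambda>y. exp (- k * \<bar>x - y\<bar>))"
    and "integrable lborel (\<lambda>y. exp (- k * \<bar>y - x\<bar>))"
    and "(LBINT y. exp (- k * \<bar>x - y\<bar>)) = (LBINT y. exp (- k * \<bar>y\<bar>))"
proof -
  show *: "integrable lborel (\<lambda>y. exp (- k * \<bar>x - y\<bar>))"
    using lborel_integrable_real_affine[OF integrable_exp_abs[OF assms], of "-1" x] by simp
  show "integrable lborel (\<lambda>y. exp (- k * \<bar>y - x\<bar>))"
    using * by (simp add: abs_minus_commute)
  show "(LBINT y. exp (- k * \<bar>x - y\<bar>)) = (LBINT y. exp (- k * \<bar>y\<bar>))"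
    using lborel_integral_real_affine[of "-1" "\<lambda>y. exp (- k * \<bar>y\<bar>)" x] by simp
qed

lemma exp_kernel_integrable_fst:
  fixes k :: real and h :: "real \<Rightarrow> real"
  assumes k: "k > 0" and h: "integrable lborel h"
  shows "integrable (lborel \<Otimes>\<^sub>M lborel) (\<lambda>(x, y). exp (- k * \<bar>x - y\<bar>) * h x)"
proof (rule lborel_pair.Fubini_integrable)
  note [measurable] = borel_measurable_integrable[OF h]
  show "(\<lambda>(x, y). exp (- k * \<bar>x - y\<bar>) * h x) \<in> borel_measurable (lborel \<Otimes>\<^sub>M lborel)"
    by measurable
  have "(LBINT y. norm (exp (- k * \<bar>x - y\<bar>) * h x)) = (LBINT y. exp (- k * \<bar>y\<bar>)) * norm (h x)" for x
    using exp_abs_shift(3)[OF k, of x] by (simp add: abs_mult)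
  then show "integrable lborel (\<lambda>x. LBINT y. norm (case (x, y) of (x, y) \<Rightarrow> exp (- k * \<bar>x - y\<bar>) * h x))"
    using h by simp
  show "AE x in lborel. integrable lborel (\<lambda>y. case (x, y) of (x, y) \<Rightarrow> exp (- k * \<bar>x - y\<bar>) * h x)"
    using exp_abs_shift(1)[OF k] by auto
qed

lemma exp_kernel_integrable_snd:
  fixes k :: real and h :: "real \<Rightarrow> real"
  assumes k: "k > 0" and h: "integrable lborel h"
  shows "integrable (lborel \<Otimes>\<^sub>M lborel) (\<lambda>(x, y). exp (- k * \<bar>x - y\<bar>) * h y)"
  using lborel_pair.integrable_product_swap[OF exp_kernel_integrable_fst[OF assms]]
  by (simp add: abs_minus_commute case_prod_beta')

text \<open>The entries of all Green's functions below are kernels of this kind.  Such a kernel acts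
  boundedly on \<open>L2\<close> by Schur's test, preserves rapid decrease, and may be moved across the
  pairing by Fubini's theorem.\<close>

locale exp_kernel =
  fixes K :: "real \<Rightarrow> real \<Rightarrow> complex" and C k :: real
  assumes k: "k > 0"
    and meas: "(\<lambda>(x, y). K x y) \<in> borel_measurable (lborel \<Otimes>\<^sub>M lborel)"
    and bound: "\<And>x y. norm (K x y) \<le> C * exp (- k * \<bar>x - y\<bar>)"
begin

lemma C_nonneg: "C \<ge> 0"
  using order_trans[OF norm_ge_zero bound[of 0 0]] by simp

lemma meas_section [measurable]: "K x \<in> borel_measurable borel"
  using measurable_compose[OF measurable_Pair1' meas, of x] by simp

abbreviation "mass \<equiv> (LBINT y. exp (- k * \<bar>y\<bar>))"

lemma mass_pos: "mass > 0"
proof -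
  have "1 / k = (LBINT y:{0..}. exp (- k * (y - 0)))"
    by (rule exp_tail(2)[OF k, symmetric])
  also have "\<dots> \<le> mass"
    unfolding set_lebesgue_integral_def
    by (rule integral_mono)
      (use exp_tail(1)[OF k, of 0] integrable_exp_abs[OF k] in
        \<open>auto simp: set_integrable_def indicator_def\<close>)
  finally show ?thesis using k by (meson divide_pos_pos less_le_trans zero_less_one)
qed

lemma section_integrable:
  assumes f: "f \<in> L2"
  shows "integrable lborel (\<lambda>y. exp (- k * \<bar>x - y\<bar>) * norm (f y))"
    and "integrable lborel (\<lambda>y. exp (- k * \<bar>x - y\<bar>) * (norm (f y))\<^sup>2)"
    and "f \<in> L2 \<Longrightarrow> integrable lborel (\<lambda>y. K x y * (f y :: complex))"
proof -
  note [measurable] = L2_measurable[OF f]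
  show 2: "integrable lborel (\<lambda>y. exp (- k * \<bar>x - y\<bar>) * (norm (f y))\<^sup>2)"
    by (rule integrable_dominated[of _ "\<lambda>y. (norm (f y))\<^sup>2"])
      (use f k in \<open>auto simp: L2_def abs_mult intro!: mult_left_le_one_le\<close>)
  show 1: "integrable lborel (\<lambda>y. exp (- k * \<bar>x - y\<bar>) * norm (f y))"
  proof (rule integrable_dominated[OF Bochner_Integration.integrable_add[OF exp_abs_shift(1)[OF k, of x] 2]])
    fix y
    have "norm (f y) \<le> 1 + (norm (f y))\<^sup>2"
      using sum_squares_bound[of 1 "norm (f y)"] norm_ge_zero[of "f y"]
      by (simp only: power_one mult_1_right)
    then show "norm (exp (- k * \<bar>x - y\<bar>) * norm (f y))
        \<le> exp (- k * \<bar>x - y\<bar>) + exp (- k * \<bar>x - y\<bar>) * (norm (f y))\<^sup>2"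
      using mult_left_mono[of "norm (f y)" "1 + (norm (f y))\<^sup>2" "exp (- k * \<bar>x - y\<bar>)"]
      by (simp add: distrib_left abs_mult)
  qed simp
  show "integrable lborel (\<lambda>y. K x y * f y)"
  proof (rule integrable_dominated[OF integrable_mult_right[OF 1, of C]])
    show "norm (K x y * f y) \<le> C * (exp (- k * \<bar>x - y\<bar>) * norm (f y))" for y
      using mult_right_mono[OF bound[of x y] norm_ge_zero[of "f y"]] by (simp add: norm_mult mult.assoc)
  qed measurable
qed

text \<open>Jensen's inequality for the weight \<open>exp (- k * \<bar>x - y\<bar>)\<close>.\<close>

lemma weighted_mean_square:
  fixes f :: "real \<Rightarrow> complex"
  assumes f: "f \<in> L2"
  shows "(LBINT y. exp (- k * \<bar>x - y\<bar>) * norm (f y))\<^sup>2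
    \<le> mass * (LBINT y. exp (- k * \<bar>x - y\<bar>) * (norm (f y))\<^sup>2)"
proof -
  let ?e = "\<lambda>y. exp (- k * \<bar>x - y\<bar>)"
  let ?M = "LBINT y. ?e y * norm (f y)" and ?F = "LBINT y. ?e y * (norm (f y))\<^sup>2"
  \<comment> \<open>the weighted mean of \<open>norm (f y)\<close>, for which the integral of the square below is smallest\<close>
  define t where "t = ?M / mass"
  note int = section_integrable(1,2)[OF f, of x] exp_abs_shift(1)[OF k, of x]
  have "0 \<le> (LBINT y. ?e y * (norm (f y) - t)\<^sup>2)" by (rule Bochner_Integration.integral_nonneg) auto
  also have "\<dots> = (LBINT y. ?e y * (norm (f y))\<^sup>2 - 2 * t * (?e y * norm (f y)) + t\<^sup>2 * ?e y)"
    by (intro Bochner_Integration.integral_cong) (auto simp: power2_eq_square algebra_simps)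
  also have "\<dots> = ?F - 2 * t * ?M + t\<^sup>2 * mass"
    using int exp_abs_shift(3)[OF k, of x] by simp
  finally have "2 * t * ?M - t\<^sup>2 * mass \<le> ?F" by simp
  moreover have "2 * t * ?M - t\<^sup>2 * mass = ?M\<^sup>2 / mass"
    using mass_pos by (simp add: t_def power2_eq_square field_simps)
  ultimately show ?thesis using mass_pos by (simp add: pos_divide_le_eq mult.commute)
qed

lemma operator_L2:
  fixes f :: "real \<Rightarrow> complex"
  assumes f: "f \<in> L2"
  shows "(\<lambda>x. LBINT y. K x y * f y) \<in> L2"
    and "L2_norm (\<lambda>x. LBINT y. K x y * f y) \<le> C * mass * L2_norm f"
proof -
  let ?u = "\<lambda>x. LBINT y. K x y * f y"
  let ?F = "\<lambda>x. LBINT y. exp (- k * \<bar>x - y\<bar>) * (norm (f y))\<^sup>2"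
  note [measurable] = L2_measurable[OF f] meas
  have "(\<lambda>(x, y). K x y * f y) \<in> borel_measurable (lborel \<Otimes>\<^sub>M lborel)"
    unfolding case_prod_beta' by measurable
  then have u_meas: "?u \<in> borel_measurable lborel"
    by (rule lborel.borel_measurable_lebesgue_integral)
  have sq: "integrable lborel (\<lambda>y. (norm (f y))\<^sup>2)" using f by (simp add: L2_def)
  note prod = exp_kernel_integrable_snd[OF k sq]
  have F_int: "integrable lborel ?F" by (rule lborel_pair.integrable_fst[OF prod])
  have le: "(norm (?u x))\<^sup>2 \<le> C\<^sup>2 * mass * ?F x" for x
  proof -
    have "norm (?u x) \<le> (LBINT y. C * (exp (- k * \<bar>x - y\<bar>) * norm (f y)))"
    proof (rule Bochner_Integration.integral_norm_bound_integral)
      show "norm (K x y * f y) \<le> C * (exp (- k * \<bar>x - y\<bar>) * norm (f y))" for y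
        using mult_right_mono[OF bound[of x y] norm_ge_zero[of "f y"]] by (simp add: norm_mult mult.assoc)
    qed (use section_integrable[OF f, of x] f in auto)
    then have "(norm (?u x))\<^sup>2 \<le> (C * (LBINT y. exp (- k * \<bar>x - y\<bar>) * norm (f y)))\<^sup>2"
      by (intro power_mono) auto
    also have "\<dots> \<le> C\<^sup>2 * (mass * ?F x)"
      unfolding power_mult_distrib by (intro mult_left_mono weighted_mean_square f) auto
    finally show ?thesis by (simp add: mult.assoc)
  qed
  have u_int: "integrable lborel (\<lambda>x. (norm (?u x))\<^sup>2)"
    by (rule integrable_dominated[OF integrable_mult_right[OF F_int, of "C\<^sup>2 * mass"]])
      (use u_meas le in auto)
  then show "?u \<in> L2" using u_meas by (simp add: L2_def)
  have "(LBINT x. ?F x)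
      = (LBINT y. (LBINT x. exp (- k * \<bar>x - y\<bar>) * (norm (f y))\<^sup>2))"
    by (rule lborel_pair.Fubini_integral[OF prod, symmetric])
  also have "\<dots> = (LBINT y. mass * (norm (f y))\<^sup>2)"
    using exp_abs_shift(3)[OF k] by (simp add: abs_minus_commute)
  finally have F: "(LBINT x. ?F x) = mass * (LBINT y. (norm (f y))\<^sup>2)" by simp
  have "(LBINT x. (norm (?u x))\<^sup>2) \<le> (LBINT x. C\<^sup>2 * mass * ?F x)"
    by (intro integral_mono u_int le integrable_mult_right F_int)
  also have "\<dots> = (C * mass)\<^sup>2 * (LBINT y. (norm (f y))\<^sup>2)"
    using F by (simp add: power2_eq_square)
  finally have "L2_norm ?u \<le> sqrt ((C * mass)\<^sup>2 * (LBINT y. (norm (f y))\<^sup>2))"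
    unfolding L2_norm_def by (rule real_sqrt_le_mono)
  then show "L2_norm ?u \<le> C * mass * L2_norm f"
    using C_nonneg mass_pos by (simp add: L2_norm_def real_sqrt_mult abs_mult)
qed

lemma operator_dual:
  fixes f g :: "real \<Rightarrow> complex"
  assumes f: "f \<in> L2" and g: "g \<in> L2"
  shows "(LBINT x. (LBINT y. K x y * f y) * g x)
    = (LBINT y. f y * (LBINT x. K x y * g x))"
proof -
  note [measurable] = L2_measurable[OF f] L2_measurable[OF g] meas
  have sq: "integrable lborel (\<lambda>y. (norm (f y))\<^sup>2)" "integrable lborel (\<lambda>y. (norm (g y))\<^sup>2)"
    using f g by (simp_all add: L2_def)
  have int: "integrable (lborel \<Otimes>\<^sub>M lborel) (\<lambda>(x, y). K x y * f y * g x)"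
  proof (rule integrable_dominated)
    show "integrable (lborel \<Otimes>\<^sub>M lborel) (\<lambda>z. C * ((\<lambda>(x, y). exp (- k * \<bar>x - y\<bar>) * (norm (f y))\<^sup>2) z
        + (\<lambda>(x, y). exp (- k * \<bar>x - y\<bar>) * (norm (g x))\<^sup>2) z))"
      by (intro integrable_mult_right Bochner_Integration.integrable_add
          exp_kernel_integrable_snd exp_kernel_integrable_fst k sq)
    show "(\<lambda>(x, y). K x y * f y * g x) \<in> borel_measurable (lborel \<Otimes>\<^sub>M lborel)"
      unfolding case_prod_beta' by measurable
    fix z :: "real \<times> real"
    obtain x y where z: "z = (x, y)" by (cases z)
    have "norm (f y) * norm (g x) \<le> (norm (f y))\<^sup>2 + (norm (g x))\<^sup>2"
      using sum_squares_bound[of "norm (f y)" "norm (g x)"]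
        mult_nonneg_nonneg[OF norm_ge_zero norm_ge_zero, of "f y" "g x"] by linarith
    then have "norm (K x y) * (norm (f y) * norm (g x))
        \<le> (C * exp (- k * \<bar>x - y\<bar>)) * ((norm (f y))\<^sup>2 + (norm (g x))\<^sup>2)"
      using C_nonneg by (intro mult_mono bound) auto
    then show "norm ((\<lambda>(x, y). K x y * f y * g x) z)
        \<le> C * ((\<lambda>(x, y). exp (- k * \<bar>x - y\<bar>) * (norm (f y))\<^sup>2) z
        + (\<lambda>(x, y). exp (- k * \<bar>x - y\<bar>) * (norm (g x))\<^sup>2) z)"
      by (simp add: z norm_mult algebra_simps)
  qed
  have "(LBINT x. (LBINT y. K x y * f y) * g x)
      = (LBINT x. (LBINT y. K x y * f y * g x))" by simp
  also have "\<dots> = (LBINT y. (LBINT x. K x y * f y * g x))"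
    by (rule lborel_pair.Fubini_integral[OF int, symmetric])
  also have "\<dots> = (LBINT y. (LBINT x. f y * (K x y * g x)))"
    by (simp add: mult_ac)
  also have "\<dots> = (LBINT y. f y * (LBINT x. K x y * g x))" by simp
  finally show ?thesis .
qed

lemma flip: "exp_kernel (\<lambda>x y. K y x) C k"
proof
  have "(\<lambda>z. K (snd z) (fst z)) \<in> borel_measurable (lborel \<Otimes>\<^sub>M lborel)"
    using measurable_compose[OF measurable_pair_swap' meas] by (simp add: case_prod_beta')
  then show "(\<lambda>(x, y). K y x) \<in> borel_measurable (lborel \<Otimes>\<^sub>M lborel)"
    by (simp add: case_prod_beta')
  show "norm (K y x) \<le> C * exp (- k * \<bar>x - y\<bar>)" for x y
    using bound[of y x] by (simp add: abs_minus_commute)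
qed (rule k)

text \<open>Since \<open>\<bar>x\<bar>\<^sup>m \<le> 2\<^sup>m (\<bar>y\<bar>\<^sup>m + \<bar>x - y\<bar>\<^sup>m)\<close>, a polynomial weight in \<open>x\<close> is absorbed either
  by \<open>f\<close> or by the kernel.\<close>

lemma operator_rapid:
  fixes f :: "real \<Rightarrow> complex"
  assumes f: "rapid f" "f \<in> borel_measurable borel"
  shows "rapid (\<lambda>x. LBINT y. K x y * f y)"
  unfolding rapid_def
proof
  fix m
  note [measurable] = f(2)
  obtain B where B: "\<And>y. norm (f y) \<le> B"
    using f(1) unfolding rapid_def by (metis mult_1 power_0)
  obtain B' where B': "\<And>y. \<bar>y\<bar> ^ m * norm (f y) \<le> B'"
    using f(1) unfolding rapid_def by metis
  have nonneg: "0 \<le> B" using order_trans[OF norm_ge_zero B] .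
  let ?mm = "LBINT y. \<bar>y\<bar> ^ m * exp (- k * \<bar>y\<bar>)"
  have "\<bar>x\<bar> ^ m * norm (LBINT y. K x y * f y) \<le> C * 2 ^ m * (B' * mass + B * ?mm)" for x
  proof -
    have shift: "integrable lborel (\<lambda>y. \<bar>x - y\<bar> ^ m * exp (- k * \<bar>x - y\<bar>))"
      "(LBINT y. \<bar>x - y\<bar> ^ m * exp (- k * \<bar>x - y\<bar>)) = ?mm"
      using lborel_integrable_real_affine[OF integrable_power_exp_abs[OF k, of m], of "-1" x]
        lborel_integral_real_affine[of "-1" "\<lambda>y. \<bar>y\<bar> ^ m * exp (- k * \<bar>y\<bar>)" x] by simp_all
    let ?w = "\<lambda>y. C * 2 ^ m * (B' * exp (- k * \<bar>x - y\<bar>) + B * (\<bar>x - y\<bar> ^ m * exp (- k * \<bar>x - y\<bar>)))"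
    have le: "norm (of_real (\<bar>x\<bar> ^ m) * (K x y * f y)) \<le> ?w y" for y
    proof -
      have "\<bar>x\<bar> \<le> 2 * max \<bar>y\<bar> \<bar>x - y\<bar>" 
        using abs_triangle_ineq[of y "x - y"] by (auto simp: max_def)
      then have "\<bar>x\<bar> ^ m \<le> 2 ^ m * (max \<bar>y\<bar> \<bar>x - y\<bar>) ^ m"
        using power_mono[of "\<bar>x\<bar>" "2 * max \<bar>y\<bar> \<bar>x - y\<bar>" m] by (simp add: power_mult_distrib)
      also have "(max \<bar>y\<bar> \<bar>x - y\<bar>) ^ m \<le> \<bar>y\<bar> ^ m + \<bar>x - y\<bar> ^ m"
        by (simp add: max_def)
      finally have "\<bar>x\<bar> ^ m \<le> 2 ^ m * (\<bar>y\<bar> ^ m + \<bar>x - y\<bar> ^ m)" by simp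
      then have "\<bar>x\<bar> ^ m * norm (f y) \<le> 2 ^ m * (\<bar>y\<bar> ^ m + \<bar>x - y\<bar> ^ m) * norm (f y)"
        by (intro mult_right_mono) auto
      also have "\<dots> = 2 ^ m * (\<bar>y\<bar> ^ m * norm (f y) + \<bar>x - y\<bar> ^ m * norm (f y))"
        by (simp add: algebra_simps)
      also have "\<dots> \<le> 2 ^ m * (B' + \<bar>x - y\<bar> ^ m * B)"
        by (intro mult_left_mono add_mono B' B) auto
      finally have le: "\<bar>x\<bar> ^ m * norm (f y) \<le> 2 ^ m * (B' + \<bar>x - y\<bar> ^ m * B)" .
      have "norm (K x y) * (\<bar>x\<bar> ^ m * norm (f y))
          \<le> (C * exp (- k * \<bar>x - y\<bar>)) * (2 ^ m * (B' + \<bar>x - y\<bar> ^ m * B))"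
        by (rule mult_mono[OF bound le]) (use C_nonneg in auto)
      then show ?thesis by (simp add: norm_mult norm_power algebra_simps)
    qed
    have w_int: "integrable lborel ?w"
      by (intro integrable_mult_right Bochner_Integration.integrable_add shift(1) exp_abs_shift(1) k)
    have "\<bar>x\<bar> ^ m * norm (LBINT y. K x y * f y)
        = norm (LBINT y. of_real (\<bar>x\<bar> ^ m) * (K x y * f y))"
      by (simp add: norm_mult norm_power)
    also have "\<dots> \<le> (LBINT y. ?w y)"
    proof (rule Bochner_Integration.integral_norm_bound_integral[OF _ w_int le])
      show "integrable lborel (\<lambda>y. of_real (\<bar>x\<bar> ^ m) * (K x y * f y))"
        by (rule integrable_dominated[OF w_int _ le]) measurable
    qed
    also have "\<dots> = C * 2 ^ m * (B' * mass + B * ?mm)"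
      using shift exp_abs_shift[OF k, of x] by simp
    finally show ?thesis .
  qed
  then show "\<exists>C. \<forall>x. \<bar>x\<bar> ^ m * norm (LBINT y. K x y * f y) \<le> C" by blast
qed

end

section \<open>Vector-valued integrals\<close>

lemma bounded_linear_axis: "bounded_linear (\<lambda>c::complex. axis i c :: complex^2)"
proof (rule bounded_linear_intro[where K = 1])
  show "norm (axis i c :: complex^2) \<le> norm c * 1" for c
    using exhaust_2[of i] by (auto simp: axis_def norm_vec_def L2_set_def sum_2)
qed (auto simp: vec_eq_iff axis_def)

lemma vec_eq_sum_axis: "(v :: complex^2) = (\<Sum>i\<in>UNIV. axis i (v $ i))"
  by (simp add: vec_eq_iff axis_def sum_2)  (metis exhaust_2)

lemma integrable_vec:
  fixes f :: "'a \<Rightarrow> complex^2"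
  assumes "\<And>i. integrable M (\<lambda>x. f x $ i)"
  shows "integrable M f"
proof -
  have "integrable M (\<lambda>x. \<Sum>i\<in>UNIV. axis i (f x $ i))"
    by (intro Bochner_Integration.integrable_sum integrable_bounded_linear[OF bounded_linear_axis] assms)
  then show ?thesis by (simp add: vec_eq_sum_axis[symmetric])
qed

lemma integral_vec_nth:
  fixes f :: "'a \<Rightarrow> complex^2"
  assumes "integrable M f"
  shows "(\<integral>x. f x \<partial>M) $ i = (\<integral>x. f x $ i \<partial>M)"
  by (rule integral_bounded_linear[OF bounded_linear_vec_nth assms, symmetric])

lemma borel_measurable_vec:
  fixes f :: "'a \<Rightarrow> 'b::euclidean_space^'n"
  assumes "\<And>i. (\<lambda>x. f x $ i) \<in> borel_measurable M"
  shows "f \<in> borel_measurable M"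
  using assms
  by (subst borel_measurable_euclidean_space)
    (auto simp: Basis_vec_def inner_axis intro!: borel_measurable_inner)

lemma norm_vec_sq: "(norm (v :: complex^2))\<^sup>2 = (\<Sum>i\<in>UNIV. (norm (v $ i))\<^sup>2)"
  by (simp add: norm_vec_def L2_set_def sum_nonneg)

lemma L2_nth:
  fixes f :: "real \<Rightarrow> complex^2"
  assumes "f \<in> L2"
  shows "(\<lambda>x. f x $ i) \<in> L2"
proof -
  note [measurable] = L2_measurable[OF assms]
  have meas: "(\<lambda>x. f x $ i) \<in> borel_measurable borel"
    by (rule measurable_compose[OF L2_measurable[OF assms]])
      (intro borel_measurable_continuous_onI continuous_intros)
  have "integrable lborel (\<lambda>x. (norm (f x $ i))\<^sup>2)"
  proof (rule integrable_dominated)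
    show "integrable lborel (\<lambda>x. (norm (f x))\<^sup>2)" using assms by (simp add: L2_def)
  qed (use meas in \<open>auto intro!: power_mono Finite_Cartesian_Product.norm_nth_le\<close>)
  then show ?thesis using meas by (simp add: L2_def)
qed

lemma L2_vec:
  fixes f :: "real \<Rightarrow> complex^2"
  assumes "\<And>i. (\<lambda>x. f x $ i) \<in> L2"
  shows "f \<in> L2"
  using assms unfolding L2_def mem_Collect_eq norm_vec_sq
  by (auto intro: borel_measurable_vec)

lemma L2_add:
  fixes f g :: "real \<Rightarrow> complex"
  assumes "f \<in> L2" "g \<in> L2"
  shows "(\<lambda>x. f x + g x) \<in> L2"
proof -
  note [measurable] = L2_measurable[OF assms(1)] L2_measurable[OF assms(2)]
  have "integrable lborel (\<lambda>x. (norm (f x + g x))\<^sup>2)"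
  proof (rule integrable_dominated)
    show "integrable lborel (\<lambda>x. 2 * (norm (f x))\<^sup>2 + 2 * (norm (g x))\<^sup>2)"
      using assms by (auto simp: L2_def)
    have "(norm (f x + g x))\<^sup>2 \<le> 2 * (norm (f x))\<^sup>2 + 2 * (norm (g x))\<^sup>2" for x
    proof -
      have "(norm (f x + g x))\<^sup>2 \<le> (norm (f x) + norm (g x))\<^sup>2"
        by (intro power_mono norm_triangle_ineq) auto
      then show ?thesis
        using sum_squares_bound[of "norm (f x)" "norm (g x)"] by (simp add: power2_sum)
    qed
    then show "norm ((norm (f x + g x))\<^sup>2) \<le> 2 * (norm (f x))\<^sup>2 + 2 * (norm (g x))\<^sup>2" for x
      by simp
  qed auto
  then show ?thesis by (simp add: L2_def)
qed

lemma L2_mult_bounded: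
  fixes f s :: "real \<Rightarrow> complex"
  assumes "f \<in> L2" "s \<in> borel_measurable borel" "bounded (range s)"
  shows "(\<lambda>x. s x * f x) \<in> L2"
proof -
  note [measurable] = L2_measurable[OF assms(1)] assms(2)
  obtain B where B: "\<And>x. norm (s x) \<le> B" using assms(3) by (auto simp: bounded_iff)
  have "integrable lborel (\<lambda>x. (norm (s x * f x))\<^sup>2)"
  proof (rule integrable_dominated)
    show "integrable lborel (\<lambda>x. B\<^sup>2 * (norm (f x))\<^sup>2)"
      using assms by (auto simp: L2_def)
    show "norm ((norm (s x * f x))\<^sup>2) \<le> B\<^sup>2 * (norm (f x))\<^sup>2" for x
      using B by (auto simp: norm_mult power_mult_distrib intro!: mult_right_mono power_mono)
  qed auto
  then show ?thesis by (simp add: L2_def)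
qed

lemma L2_diff:
  fixes f g :: "real \<Rightarrow> complex"
  assumes "f \<in> L2" "g \<in> L2"
  shows "(\<lambda>x. f x - g x) \<in> L2"
  using L2_add[OF assms(1) L2_mult_bounded[OF assms(2), of "\<lambda>_. -1"]] by simp

lemma L2_sum:
  fixes f :: "'i \<Rightarrow> real \<Rightarrow> complex"
  assumes "\<And>i. i \<in> I \<Longrightarrow> f i \<in> L2"
  shows "(\<lambda>x. \<Sum>i\<in>I. f i x) \<in> L2"
proof (cases "finite I")
  case True
  then show ?thesis
    using assms by (induction I) (auto intro: L2_add schwartz_L2[OF schwartz_zero])
qed (auto intro: schwartz_L2[OF schwartz_zero])

section \<open>The resolvent of the Lax operator\<close>

text \<open>The columns \<open>P\<close> and \<open>Q\<close> solve the homogeneous Lax system and decay at \<open>+\<infinity>\<close> and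
  \<open>-\<infinity>\<close> respectively; \<open>\<alpha>\<close> and \<open>\<beta>\<close> are the rows of the inverse of the fundamental matrix
  \<open>(P, Q)\<close>, so that they solve the adjoint system and have the inverse rates of growth.\<close>

locale weyl_pair =
  fixes \<kappa> :: complex and q :: "real \<Rightarrow> complex" and k B :: real
    and P Q \<alpha> \<beta> :: "2 \<Rightarrow> real \<Rightarrow> complex"
  assumes q: "q \<in> schwartz" and k: "k > 0"
    and P_ode: "\<And>i x. (P i has_vector_derivative - (\<Sum>l\<in>UNIV. lax_matrix \<kappa> q x $ i $ l * P l x)) (at x)"
    and Q_ode: "\<And>i x. (Q i has_vector_derivative - (\<Sum>l\<in>UNIV. lax_matrix \<kappa> q x $ i $ l * Q l x)) (at x)"
    and \<alpha>_ode: "\<And>j x. (\<alpha> j has_vector_derivative (\<Sum>i\<in>UNIV. \<alpha> i x * lax_matrix \<kappa> q x $ i $ j)) (at x)"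
    and \<beta>_ode: "\<And>j x. (\<beta> j has_vector_derivative (\<Sum>i\<in>UNIV. \<beta> i x * lax_matrix \<kappa> q x $ i $ j)) (at x)"
    and unit: "\<And>i j x. P i x * \<alpha> j x + Q i x * \<beta> j x = (if i = j then 1 else 0)"
    and P_bound: "\<And>i x. norm (P i x) \<le> B * exp (- k * x)"
    and \<alpha>_bound: "\<And>i x. norm (\<alpha> i x) \<le> B * exp (k * x)"
    and Q_bound: "\<And>i x. norm (Q i x) \<le> B * exp (k * x)"
    and \<beta>_bound: "\<And>i x. norm (\<beta> i x) \<le> B * exp (- k * x)"
begin

abbreviation A :: "2 \<Rightarrow> 2 \<Rightarrow> real \<Rightarrow> complex" where
  "A i j x \<equiv> lax_matrix \<kappa> q x $ i $ j"

text \<open>Variation of constants: as a function of \<open>x\<close>, the kernel solves the homogeneous system off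
  the diagonal, decays at both ends, and jumps by the identity matrix at \<open>x = y\<close>.\<close>

definition green :: "real \<Rightarrow> real \<Rightarrow> complex^2^2" where
  "green x y = (\<chi> i j. if y < x then P i x * \<alpha> j y else - (Q i x * \<beta> j y))"

lemma A_cases: "(\<exists>c. \<forall>x. A i j x = c) \<or> A i j \<in> schwartz"
proof -
  have "(\<lambda>x. - \<kappa> * q x) \<in> schwartz" "(\<lambda>x. - \<kappa> * conj_pot q x) \<in> schwartz"
    by (intro schwartz_scale q schwartz_conj_pot)+
  then show ?thesis
    using exhaust_2[of i] exhaust_2[of j] by (auto simp: lax_matrix_def)
qed

lemma A_mult_schwartz: "\<phi> \<in> schwartz \<Longrightarrow> (\<lambda>x. A i j x * \<phi> x) \<in> schwartz"
  using A_cases[of i j] schwartz_mult schwartz_scale by auto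

lemma A_measurable: "A i j \<in> borel_measurable borel"
  using A_cases[of i j] schwartz_measurable by auto

lemma A_bounded: "bounded (range (A i j))"
  using A_cases[of i j] schwartz_bounded by auto

lemma continuous_solutions:
  "continuous_on S (P i)" "continuous_on S (Q i)" "continuous_on S (\<alpha> i)" "continuous_on S (\<beta> i)"
  using P_ode Q_ode \<alpha>_ode \<beta>_ode
  by (blast intro: continuous_at_imp_continuous_on has_vector_derivative_continuous)+

lemma measurable_solutions [measurable]:
  "P i \<in> borel_measurable borel" "Q i \<in> borel_measurable borel"
  "\<alpha> i \<in> borel_measurable borel" "\<beta> i \<in> borel_measurable borel"
  by (auto intro: borel_measurable_continuous_onI continuous_solutions)

lemma B_nonneg: "B \<ge> 0"
  using order_trans[OF norm_ge_zero P_bound[of 1 0]] by simp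

sublocale entry: exp_kernel "\<lambda>x y. green x y $ i $ j" "B\<^sup>2" k for i j
proof
  show "k > 0" by (rule k)
  have "(\<lambda>(x, y). if y < x then P i x * \<alpha> j y else - (Q i x * \<beta> j y))
      \<in> borel_measurable (lborel \<Otimes>\<^sub>M lborel)"
    unfolding case_prod_beta' by measurable
  then show "(\<lambda>(x, y). green x y $ i $ j) \<in> borel_measurable (lborel \<Otimes>\<^sub>M lborel)"
    by (simp add: green_def)
  fix x y
  have 1: "norm (P i x * \<alpha> j y) \<le> (B * exp (- k * x)) * (B * exp (k * y))"
    unfolding norm_mult using B_nonneg by (intro mult_mono P_bound \<alpha>_bound) auto
  have 2: "norm (Q i x * \<beta> j y) \<le> (B * exp (k * x)) * (B * exp (- k * y))"
    unfolding norm_mult using B_nonneg by (intro mult_mono Q_bound \<beta>_bound) auto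
  have e1: "(B * exp (- k * x)) * (B * exp (k * y)) = B\<^sup>2 * exp (- k * (x - y))"
    by (simp add: power2_eq_square mult_exp_exp algebra_simps)
  have e2: "(B * exp (k * x)) * (B * exp (- k * y)) = B\<^sup>2 * exp (- k * (y - x))"
    by (simp add: power2_eq_square mult_exp_exp algebra_simps)
  show "norm (green x y $ i $ j) \<le> B\<^sup>2 * exp (- k * \<bar>x - y\<bar>)"
    using 1 2 unfolding e1 e2 by (auto simp: green_def)
qed

lemma tail_integrable:
  assumes "g \<in> schwartz"
  shows "set_integrable lborel {a..} (\<lambda>x. P i x * g x)"
  unfolding set_integrable_def
proof (rule integrable_dominated)
  note [measurable] = schwartz_measurable[OF assms]
  show "integrable lborel (\<lambda>x. B * exp (- k * a) * norm (g x))"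
    by (intro integrable_mult_right integrable_norm schwartz_integrable assms)
  show "(\<lambda>x. indicat_real {a..} x *\<^sub>R (P i x * g x)) \<in> borel_measurable lborel" by measurable
  have "norm (P i x) \<le> B * exp (- k * a)" if "a \<le> x" for x
  proof -
    have "B * exp (- k * x) \<le> B * exp (- k * a)"
      using B_nonneg k that by (intro mult_left_mono) auto
    then show ?thesis using P_bound[of i x] by simp
  qed
  then show "norm (indicat_real {a..} x *\<^sub>R (P i x * g x)) \<le> B * exp (- k * a) * norm (g x)" for x
    using B_nonneg by (auto simp: norm_mult indicator_def intro!: mult_right_mono)
qed

lemma head_integrable:
  assumes "g \<in> schwartz"
  shows "set_integrable lborel {..a} (\<lambda>x. Q i x * g x)"
  unfolding set_integrable_def
proof (rule integrable_dominated)
  note [measurable] = schwartz_measurable[OF assms]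
  show "integrable lborel (\<lambda>x. B * exp (k * a) * norm (g x))"
    by (intro integrable_mult_right integrable_norm schwartz_integrable assms)
  show "(\<lambda>x. indicat_real {..a} x *\<^sub>R (Q i x * g x)) \<in> borel_measurable lborel" by measurable
  have "norm (Q i x) \<le> B * exp (k * a)" if "x \<le> a" for x
  proof -
    have "B * exp (k * x) \<le> B * exp (k * a)"
      using B_nonneg k that by (intro mult_left_mono) auto
    then show ?thesis using Q_bound[of i x] by simp
  qed
  then show "norm (indicat_real {..a} x *\<^sub>R (Q i x * g x)) \<le> B * exp (k * a) * norm (g x)" for x
    using B_nonneg by (auto simp: norm_mult indicator_def intro!: mult_right_mono)
qed

lemma adjoint_formula:
  assumes "g \<in> schwartz"
  shows "(LBINT x. green x y $ i $ j * g x)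
    = (LBINT x:{y..}. P i x * g x) * \<alpha> j y - (LBINT x:{..y}. Q i x * g x) * \<beta> j y"
proof -
  have "(LBINT x. green x y $ i $ j * g x)
      = (LBINT x. indicator {y..} x *\<^sub>R (P i x * g x) * \<alpha> j y
          - indicator {..y} x *\<^sub>R (Q i x * g x) * \<beta> j y)"
  proof (rule integral_cong_AE)
    note [measurable] = schwartz_measurable[OF assms]
    show "(\<lambda>x. green x y $ i $ j * g x) \<in> borel_measurable lborel"
      unfolding green_def by simp
    show "(\<lambda>x. indicator {y..} x *\<^sub>R (P i x * g x) * \<alpha> j y
          - indicator {..y} x *\<^sub>R (Q i x * g x) * \<beta> j y) \<in> borel_measurable lborel" by measurable
    show "AE x in lborel. green x y $ i $ j * g x = indicator {y..} x *\<^sub>R (P i x * g x) * \<alpha> j y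
          - indicator {..y} x *\<^sub>R (Q i x * g x) * \<beta> j y"
      by (rule AE_mp[OF AE_lborel_singleton[of y]]) (auto simp: green_def indicator_def)
  qed
  also have "\<dots> = (LBINT x:{y..}. P i x * g x) * \<alpha> j y - (LBINT x:{..y}. Q i x * g x) * \<beta> j y"
  proof -
    have *: "(LBINT x. u x * a - v x * b) = (LBINT x. u x) * a - (LBINT x. v x) * b"
      if "integrable lborel u" "integrable lborel v" for u v :: "real \<Rightarrow> complex" and a b
      using that by simp
    show ?thesis
      unfolding set_lebesgue_integral_def
      by (rule *) (use tail_integrable[OF assms, of y i] head_integrable[OF assms, of y i] in
          \<open>simp_all only: set_integrable_def\<close>)
  qed
  finally show ?thesis .
qed

text \<open>The decaying solution, indexed by its components \<open>j\<close>, of the adjoint equation with source \<open>- g\<close>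
  in component \<open>l\<close>; these are the test functions for the weak formulation of the Lax system.\<close>

definition adj :: "2 \<Rightarrow> 2 \<Rightarrow> (real \<Rightarrow> complex) \<Rightarrow> real \<Rightarrow> complex" where
  "adj l j g y = (LBINT x. green x y $ l $ j * g x)"

lemma adj_deriv:
  assumes g: "g \<in> schwartz"
  shows "(adj l j g has_vector_derivative
    (\<Sum>i\<in>UNIV. A i j y * adj l i g y) - (if l = j then 1 else 0) * g y) (at y)"
proof -
  let ?T = "\<lambda>y. LBINT x:{y..}. P l x * g x" and ?H = "\<lambda>y. LBINT x:{..y}. Q l x * g x"
  have T: "(?T has_vector_derivative - (P l y * g y)) (at y)"
    by (intro tail_integral_deriv tail_integrable g continuous_intros continuous_solutions
        schwartz_continuous)
  have H: "(?H has_vector_derivative Q l y * g y) (at y)"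
    by (intro head_integral_deriv head_integrable g continuous_intros continuous_solutions
        schwartz_continuous)
  have D: "((\<lambda>y. ?T y * \<alpha> j y - ?H y * \<beta> j y) has_vector_derivative
     (?T y * (\<Sum>i\<in>UNIV. \<alpha> i y * A i j y) + - (P l y * g y) * \<alpha> j y)
     - (?H y * (\<Sum>i\<in>UNIV. \<beta> i y * A i j y) + Q l y * g y * \<beta> j y)) (at y)"
    by (intro has_vector_derivative_diff has_vector_derivative_mult T H \<alpha>_ode \<beta>_ode)
  have E: "adj l i g = (\<lambda>y. ?T y * \<alpha> i y - ?H y * \<beta> i y)" for i
    unfolding adj_def by (intro ext adjoint_formula g)
  have "(?T y * (\<Sum>i\<in>UNIV. \<alpha> i y * A i j y) + - (P l y * g y) * \<alpha> j y)
     - (?H y * (\<Sum>i\<in>UNIV. \<beta> i y * A i j y) + Q l y * g y * \<beta> j y)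
     = (\<Sum>i\<in>UNIV. A i j y * adj l i g y) - (P l y * \<alpha> j y + Q l y * \<beta> j y) * g y"
    unfolding E by (simp add: sum_2 algebra_simps)
  then show ?thesis using D unfolding E unit by simp
qed

lemma adj_rapid:
  assumes "g \<in> schwartz"
  shows "rapid (adj l j g)"
  using exp_kernel.operator_rapid[OF entry.flip schwartz_rapid[OF assms] schwartz_measurable[OF assms]]
  unfolding adj_def[abs_def] .

text \<open>The adjoint equation expresses derivatives of \<open>adj l j g\<close> through \<open>adj l 1 g\<close>,
  \<open>adj l 2 g\<close>, Schwartz functions and products of these, so the functions generate a module as
  in \<open>module_hull_schwartz\<close>.\<close>

lemma adj_schwartz:
  assumes g: "g \<in> schwartz"
  shows "adj l j g \<in> schwartz"
proof -
  let ?F = "range (\<lambda>j. adj l j g) \<union> schwartz"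
  let ?H = "module_hull ?F schwartz"
  have "?H \<subseteq> schwartz"
  proof (rule module_hull_schwartz)
    show "f differentiable at x" if "f \<in> ?F" for f x
      using that adj_deriv[OF g] schwartz_differentiable by (auto intro: differentiableI_vector)
    show "rapid f" if "f \<in> ?F" for f using that schwartz_rapid adj_rapid[OF g] by auto
    show "dx f \<in> ?H" if "f \<in> ?F" for f
    proof (cases "f \<in> schwartz")
      case True then show ?thesis by (auto intro: module_hull.gen schwartz_dx)
    next
      case False
      then obtain j where f: "f = adj l j g" using \<open>f \<in> ?F\<close> by blast
      have *: "(\<lambda>y. A i j y * adj l i g y) \<in> ?H" for i
        using A_cases[of i j]
      proof
        assume "A i j \<in> schwartz"
        then show ?thesis
          using module_hull.mult[OF module_hull.gen[of "adj l i g" ?F], of "A i j" schwartz]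
          by (simp add: mult.commute)
      next
        assume "\<exists>c. \<forall>x. A i j x = c"
        then obtain c where c: "\<And>x. A i j x = c" by blast
        have "(\<lambda>y. c * adj l i g y) \<in> ?H"
          by (rule module_hull.scale[OF module_hull.gen]) auto
        then show ?thesis by (simp add: c)
      qed
      have "(\<lambda>y. (A 1 j y * adj l 1 g y + A 2 j y * adj l 2 g y) + (- (if l = j then 1 else 0)) * g y) \<in> ?H"
        by (intro module_hull.add * module_hull.scale module_hull.gen) (use g in auto)
      moreover have "dx f = (\<lambda>y. (A 1 j y * adj l 1 g y + A 2 j y * adj l 2 g y)
          + (- (if l = j then 1 else 0)) * g y)"
        unfolding f by (intro ext dx_eqI, use adj_deriv[OF g, of l j] in \<open>simp add: sum_2\<close>)
      ultimately show ?thesis by simp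
    qed
    show "(\<lambda>x. f x * dx s x) \<in> ?H" if "f \<in> ?H" "s \<in> schwartz" for f s
      using that by (intro module_hull.mult schwartz_dx)
  qed (auto intro: schwartz_differentiable schwartz_bounded)
  then show ?thesis using module_hull.gen[of "adj l j g" ?F schwartz] by blast
qed

text \<open>Here \<open>h\<close> is the adjoint Lax operator applied, up to sign, to \<open>\<phi>\<close> in component \<open>i\<close>; solving
  the adjoint equation gives back \<open>- \<phi>\<close>.  The reason is that \<open>\<Sum>l. P l * h l\<close> is the derivative of
  \<open>P i * \<phi>\<close>, whose boundary term at \<open>+\<infinity>\<close> vanishes, and likewise for \<open>Q\<close> at \<open>-\<infinity>\<close>.\<close>

lemma adj_of_adjoint_operator:
  fixes i :: 2
  assumes \<phi>: "\<phi> \<in> schwartz"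
  defines "h \<equiv> \<lambda>l x. (if l = i then 1 else 0) * dx \<phi> x - A i l x * \<phi> x"
  shows "h l \<in> schwartz"
    and "(\<Sum>l\<in>UNIV. adj l j (h l) y) = - ((if i = j then 1 else 0) * \<phi> y)"
proof -
  show h: "h l \<in> schwartz" for l
    unfolding h_def by (intro schwartz_diff schwartz_scale schwartz_dx A_mult_schwartz \<phi>)
  obtain M where M: "\<And>x. norm (\<phi> x) \<le> M"
    using schwartz_bounded[OF \<phi>] by (auto simp: bounded_iff)
  have M0: "M \<ge> 0" using order_trans[OF norm_ge_zero M] .
  have D: "((\<lambda>x. R i x * \<phi> x) has_vector_derivative (\<Sum>l\<in>UNIV. R l x * h l x)) (at x)"
    if "\<And>i x. (R i has_vector_derivative - (\<Sum>l\<in>UNIV. A i l x * R l x)) (at x)"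
    for R :: "2 \<Rightarrow> real \<Rightarrow> complex" and x
  proof -
    have "((\<lambda>x. R i x * \<phi> x) has_vector_derivative
        R i x * dx \<phi> x + - (\<Sum>l\<in>UNIV. A i l x * R l x) * \<phi> x) (at x)"
      by (intro has_vector_derivative_mult that schwartz_has_dx \<phi>)
    moreover have "R i x * dx \<phi> x + - (\<Sum>l\<in>UNIV. A i l x * R l x) * \<phi> x = (\<Sum>l\<in>UNIV. R l x * h l x)"
      using exhaust_2[of i] by (auto simp: h_def sum_2 algebra_simps)
    ultimately show ?thesis by simp
  qed
  have T: "(\<Sum>l\<in>UNIV. LBINT x:{y..}. P l x * h l x) = - (P i y * \<phi> y)"
  proof -
    have "(\<Sum>l\<in>UNIV. LBINT x:{y..}. P l x * h l x) = (LBINT x:{y..}. \<Sum>l\<in>UNIV. P l x * h l x)"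
      using tail_integrable[OF h] by (simp add: sum_2 set_integral_add)
    also have "\<dots> = - (P i y * \<phi> y)"
    proof (rule tail_integral_FTC[OF _ _ D[OF P_ode]])
      show "continuous_on UNIV (\<lambda>x. \<Sum>l\<in>UNIV. P l x * h l x)"
        by (intro continuous_intros continuous_solutions schwartz_continuous h)
      show "set_integrable lborel {y..} (\<lambda>x. \<Sum>l\<in>UNIV. P l x * h l x)"
        using tail_integrable[OF h] by (simp add: sum_2 set_integral_add)
      have lim: "((\<lambda>x. B * exp (- k * x) * M) \<longlongrightarrow> 0) at_top" using k by real_asymp
      show "((\<lambda>x. P i x * \<phi> x) \<longlongrightarrow> 0) at_top"
        by (rule Lim_null_comparison[OF always_eventually lim])
          (use B_nonneg M0 in \<open>auto simp: norm_mult intro!: mult_mono P_bound[simplified] M\<close>)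
    qed
    finally show ?thesis .
  qed
  have H: "(\<Sum>l\<in>UNIV. LBINT x:{..y}. Q l x * h l x) = Q i y * \<phi> y"
  proof -
    have "(\<Sum>l\<in>UNIV. LBINT x:{..y}. Q l x * h l x) = (LBINT x:{..y}. \<Sum>l\<in>UNIV. Q l x * h l x)"
      using head_integrable[OF h] by (simp add: sum_2 set_integral_add)
    also have "\<dots> = Q i y * \<phi> y"
    proof (rule head_integral_FTC[OF _ _ D[OF Q_ode]])
      show "continuous_on UNIV (\<lambda>x. \<Sum>l\<in>UNIV. Q l x * h l x)"
        by (intro continuous_intros continuous_solutions schwartz_continuous h)
      show "set_integrable lborel {..y} (\<lambda>x. \<Sum>l\<in>UNIV. Q l x * h l x)"
        using head_integrable[OF h] by (simp add: sum_2 set_integral_add)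
      have lim: "((\<lambda>x. B * exp (k * x) * M) \<longlongrightarrow> 0) at_bot" using k by real_asymp
      show "((\<lambda>x. Q i x * \<phi> x) \<longlongrightarrow> 0) at_bot"
        by (rule Lim_null_comparison[OF always_eventually lim])
          (use B_nonneg M0 in \<open>auto simp: norm_mult intro!: mult_mono Q_bound[simplified] M\<close>)
    qed
    finally show ?thesis .
  qed
  have "(\<Sum>l\<in>UNIV. adj l j (h l) y)
      = (\<Sum>l\<in>UNIV. LBINT x:{y..}. P l x * h l x) * \<alpha> j y
      - (\<Sum>l\<in>UNIV. LBINT x:{..y}. Q l x * h l x) * \<beta> j y"
    unfolding adj_def adjoint_formula[OF h] by (simp add: sum_2 algebra_simps)
  also have "\<dots> = - ((P i y * \<alpha> j y + Q i y * \<beta> j y) * \<phi> y)"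
    unfolding T H by (simp add: algebra_simps)
  finally show "(\<Sum>l\<in>UNIV. adj l j (h l) y) = - ((if i = j then 1 else 0) * \<phi> y)"
    unfolding unit .
qed

definition resolvent :: "(real \<Rightarrow> complex^2) \<Rightarrow> real \<Rightarrow> complex^2" where
  "resolvent f x = (LBINT y. green x y *v f y)"

lemma green_integrable:
  assumes "f \<in> L2"
  shows "integrable lborel (\<lambda>y. green x y *v f y)"
proof (rule integrable_vec)
  fix i
  show "integrable lborel (\<lambda>y. (green x y *v f y) $ i)"
    unfolding matrix_vector_mult_def vec_lambda_beta
    by (intro Bochner_Integration.integrable_sum entry.section_integrable(3) L2_nth assms)
qed

lemma resolvent_nth:
  assumes "f \<in> L2"
  shows "resolvent f x $ i = (\<Sum>j\<in>UNIV. LBINT y. green x y $ i $ j * f y $ j)"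
proof -
  have "resolvent f x $ i = (LBINT y. (green x y *v f y) $ i)"
    unfolding resolvent_def by (rule integral_vec_nth[OF green_integrable[OF assms]])
  then show ?thesis
    unfolding matrix_vector_mult_def vec_lambda_beta
    by (simp add: Bochner_Integration.integral_sum entry.section_integrable(3) L2_nth assms)
qed

lemma resolvent_L2:
  assumes "f \<in> L2"
  shows "resolvent f \<in> L2"
proof (rule L2_vec)
  fix i
  show "(\<lambda>x. resolvent f x $ i) \<in> L2"
    unfolding resolvent_nth[OF assms] by (intro L2_sum entry.operator_L2(1) L2_nth assms)
qed

lemma resolvent_dual:
  assumes f: "f \<in> L2" and g: "g \<in> schwartz"
  shows "(LBINT x. resolvent f x $ l * g x) = (\<Sum>j\<in>UNIV. LBINT y. f y $ j * adj l j g y)"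
proof -
  have int: "integrable lborel (\<lambda>x. (LBINT y. green x y $ l $ j * f y $ j) * g x)" for j
    by (intro L2_mult_integrable entry.operator_L2(1) L2_nth f schwartz_L2 g)
  have "(LBINT x. resolvent f x $ l * g x)
      = (\<Sum>j\<in>UNIV. LBINT x. (LBINT y. green x y $ l $ j * f y $ j) * g x)"
    unfolding resolvent_nth[OF f] sum_distrib_right
    by (rule Bochner_Integration.integral_sum[OF int])
  also have "\<dots> = (\<Sum>j\<in>UNIV. LBINT y. f y $ j * adj l j g y)"
    unfolding adj_def by (intro sum.cong refl entry.operator_dual L2_nth f schwartz_L2 g)
  finally show ?thesis .
qed

text \<open>Pair with a test function, move the kernel across by \<open>resolvent_dual\<close>, and use
  \<open>adj_of_adjoint_operator\<close>: only the test function is differentiated.\<close>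

lemma lax_op_resolvent:
  assumes f: "f \<in> L2"
  shows "lax_op \<kappa> q (resolvent f) f"
proof -
  let ?u = "resolvent f"
  define v where "v x = f x - lax_matrix \<kappa> q x *v ?u x" for x
  have v_nth: "v x $ i = f x $ i - (\<Sum>l\<in>UNIV. A i l x * ?u x $ l)" for x i
    by (simp add: v_def matrix_vector_mult_def)
  have u_L2: "(\<lambda>x. ?u x $ l) \<in> L2" for l by (intro L2_nth resolvent_L2 f)
  have "v \<in> L2"
    by (intro L2_vec, unfold v_nth)
      (intro L2_diff L2_sum L2_mult_bounded A_measurable A_bounded u_L2 L2_nth f)
  moreover have "weak_deriv (\<lambda>x. ?u x $ i) (\<lambda>x. v x $ i)" for i
    unfolding weak_deriv_def
  proof
    fix \<phi> assume \<phi>: "\<phi> \<in> schwartz"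
    let ?h = "\<lambda>l x. (if l = i then 1 else 0) * dx \<phi> x - A i l x * \<phi> x"
    note h = adj_of_adjoint_operator[OF \<phi>, where i = i]
    have int1: "integrable lborel (\<lambda>x. ?u x $ i * dx \<phi> x)"
      by (intro L2_mult_integrable u_L2 schwartz_L2 schwartz_dx \<phi>)
    have int2: "integrable lborel (\<lambda>x. ?u x $ l * (A i l x * \<phi> x))" for l
      by (intro L2_mult_integrable u_L2 schwartz_L2 A_mult_schwartz \<phi>)
    have int3: "integrable lborel (\<lambda>x. f x $ j * \<phi> x)" for j
      by (intro L2_mult_integrable L2_nth f schwartz_L2 \<phi>)
    have int4: "integrable lborel (\<lambda>x. f x $ j * adj l j (?h l) x)" for j l
      by (intro L2_mult_integrable L2_nth f schwartz_L2 adj_schwartz h(1))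
    have "(LBINT x. ?u x $ i * dx \<phi> x) - (\<Sum>l\<in>UNIV. LBINT x. ?u x $ l * (A i l x * \<phi> x))
        = (LBINT x. ?u x $ i * dx \<phi> x - (\<Sum>l\<in>UNIV. ?u x $ l * (A i l x * \<phi> x)))"
      using int1 int2 by (simp add: Bochner_Integration.integral_sum)
    also have "\<dots> = (LBINT x. (\<Sum>l\<in>UNIV. ?u x $ l * ?h l x))"
      using exhaust_2[of i]
      by (intro Bochner_Integration.integral_cong) (auto simp: sum_2 algebra_simps)
    also have "\<dots> = (\<Sum>l\<in>UNIV. LBINT x. ?u x $ l * ?h l x)"
      by (intro Bochner_Integration.integral_sum L2_mult_integrable u_L2 schwartz_L2 h(1))
    also have "\<dots> = (\<Sum>l\<in>UNIV. \<Sum>j\<in>UNIV. LBINT x. f x $ j * adj l j (?h l) x)"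
      by (intro sum.cong refl resolvent_dual f h(1))
    also have "\<dots> = (\<Sum>j\<in>UNIV. \<Sum>l\<in>UNIV. LBINT x. f x $ j * adj l j (?h l) x)"
      by (rule sum.swap)
    also have "\<dots> = (\<Sum>j\<in>UNIV. LBINT x. f x $ j * (\<Sum>l\<in>UNIV. adj l j (?h l) x))"
      unfolding sum_distrib_left
      by (intro sum.cong refl Bochner_Integration.integral_sum[symmetric] int4)
    also have "\<dots> = (\<Sum>j\<in>UNIV. LBINT x. f x $ j * (- ((if i = j then 1 else 0) * \<phi> x)))"
      unfolding h(2) ..
    also have "\<dots> = - (LBINT x. f x $ i * \<phi> x)"
      using exhaust_2[of i] by (auto simp: sum_2)
    finally have "(LBINT x. ?u x $ i * dx \<phi> x)
        = - ((LBINT x. f x $ i * \<phi> x) - (\<Sum>l\<in>UNIV. LBINT x. ?u x $ l * (A i l x * \<phi> x)))"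
      by (simp add: algebra_simps)
    also have "\<dots> = - (LBINT x. f x $ i * \<phi> x - (\<Sum>l\<in>UNIV. ?u x $ l * (A i l x * \<phi> x)))"
      using int2 int3 by (simp add: Bochner_Integration.integral_sum)
    also have "\<dots> = - (LBINT x. v x $ i * \<phi> x)"
      by (simp add: v_nth sum_2 algebra_simps)
    finally show "(LBINT x. ?u x $ i * dx \<phi> x) = - (LBINT x. v x $ i * \<phi> x)" .
  qed
  ultimately show ?thesis
    unfolding lax_op_def using f resolvent_L2[OF f] by (auto simp: v_def intro!: bexI[of _ v])
qed

text \<open>Testing the equation with \<open>adj l j g\<close> determines the pairing of component \<open>l\<close> of \<open>u\<close> with
  every Schwartz function \<open>g\<close>, hence \<open>u\<close> itself.  This one computation gives injectivity, the
  resolvent bound and the kernel representation.\<close>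

lemma lax_op_unique:
  assumes op: "lax_op \<kappa> q u f"
  shows "AE x in lborel. u x = resolvent f x"
proof -
  from op obtain v where u: "u \<in> L2" and f: "f \<in> L2" and v: "v \<in> L2"
    and weak: "\<And>i. weak_deriv (\<lambda>x. u x $ i) (\<lambda>x. v x $ i)"
    and eq: "AE x in lborel. f x = v x + lax_matrix \<kappa> q x *v u x"
    by (auto simp: lax_op_def)
  have "AE x in lborel. u x $ l - resolvent f x $ l = 0" for l
  proof (rule schwartz_separates_L2)
    show "(\<lambda>x. u x $ l - resolvent f x $ l) \<in> L2"
      by (intro L2_diff L2_nth u resolvent_L2 f)
    fix g :: "real \<Rightarrow> complex" assume g: "g \<in> schwartz"
    let ?\<phi> = "\<lambda>j. adj l j g"
    note \<phi> = adj_schwartz[OF g, of l]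
    have dx\<phi>: "dx (?\<phi> j) x = (\<Sum>i\<in>UNIV. A i j x * ?\<phi> i x) - (if l = j then 1 else 0) * g x" for j x
      by (rule dx_eqI[OF adj_deriv[OF g]])
    have i1: "integrable lborel (\<lambda>x. u x $ j * (A i j x * ?\<phi> i x))" for i j
      by (intro L2_mult_integrable L2_nth u schwartz_L2 A_mult_schwartz \<phi>)
    have i2: "integrable lborel (\<lambda>x. v x $ j * ?\<phi> j x)" for j
      by (intro L2_mult_integrable L2_nth v schwartz_L2 \<phi>)
    have i3: "integrable lborel (\<lambda>x. u x $ j * g x)" for j
      by (intro L2_mult_integrable L2_nth u schwartz_L2 g)
    have i4: "integrable lborel (\<lambda>x. resolvent f x $ l * g x)"
      by (intro L2_mult_integrable L2_nth resolvent_L2 f schwartz_L2 g)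
    have i5: "integrable lborel (\<lambda>x. f x $ j * ?\<phi> j x)" for j
      by (intro L2_mult_integrable L2_nth f schwartz_L2 \<phi>)
    have w: "(LBINT x. u x $ j * dx (?\<phi> j) x) = - (LBINT x. v x $ j * ?\<phi> j x)" for j
      using weak[of j] \<phi>[of j] by (simp add: weak_deriv_def)
    have by_parts: "(LBINT x. u x $ j * dx (?\<phi> j) x)
        = (\<Sum>i\<in>UNIV. LBINT x. u x $ j * (A i j x * ?\<phi> i x))
          - (if l = j then 1 else 0) * (LBINT x. u x $ j * g x)" for j
    proof -
      have "(LBINT x. u x $ j * dx (?\<phi> j) x)
          = (LBINT x. (\<Sum>i\<in>UNIV. u x $ j * (A i j x * ?\<phi> i x)) - (if l = j then 1 else 0) * (u x $ j * g x))"
        unfolding dx\<phi> by (intro Bochner_Integration.integral_cong) (auto simp: sum_2 algebra_simps)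
      also have "\<dots> = (LBINT x. (\<Sum>i\<in>UNIV. u x $ j * (A i j x * ?\<phi> i x)))
          - (LBINT x. (if l = j then 1 else 0) * (u x $ j * g x))"
        by (intro Bochner_Integration.integral_diff Bochner_Integration.integrable_sum i1
            integrable_mult_right i3)
      finally show ?thesis by (simp add: Bochner_Integration.integral_sum[OF i1])
    qed
    have "(LBINT x. u x $ l * g x)
        = (\<Sum>j\<in>UNIV. (\<Sum>i\<in>UNIV. LBINT x. u x $ j * (A i j x * ?\<phi> i x)) + (LBINT x. v x $ j * ?\<phi> j x))"
    proof -
      have *: "b = a + c" if "a - b = - c" for a b c :: complex
        using that by (simp add: diff_eq_eq)
      have "(if l = j then 1 else 0) * (LBINT x. u x $ j * g x)
          = (\<Sum>i\<in>UNIV. LBINT x. u x $ j * (A i j x * ?\<phi> i x)) + (LBINT x. v x $ j * ?\<phi> j x)" for j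
        by (rule *) (simp only: w by_parts[symmetric])
      from this[symmetric] show ?thesis
        by (simp only:) (use exhaust_2[of l] in \<open>auto simp: sum_2\<close>)
    qed
    also have "\<dots> = (LBINT x. (\<Sum>j\<in>UNIV. (\<Sum>i\<in>UNIV. u x $ j * (A i j x * ?\<phi> i x)) + v x $ j * ?\<phi> j x))"
      by (simp add: Bochner_Integration.integral_sum i1 i2)
    also have "\<dots> = (LBINT x. (\<Sum>j\<in>UNIV. f x $ j * ?\<phi> j x))"
    proof (rule integral_cong_AE)
      show "AE x in lborel. (\<Sum>j\<in>UNIV. (\<Sum>i\<in>UNIV. u x $ j * (A i j x * ?\<phi> i x)) + v x $ j * ?\<phi> j x)
          = (\<Sum>j\<in>UNIV. f x $ j * ?\<phi> j x)"
        using eq by eventually_elim (simp add: matrix_vector_mult_def sum_2 algebra_simps)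
    qed (use i1 i2 i5 in \<open>auto intro!: borel_measurable_integrable\<close>)
    also have "\<dots> = (LBINT x. resolvent f x $ l * g x)"
      by (simp add: Bochner_Integration.integral_sum i5 resolvent_dual f g)
    finally show "(LBINT x. (u x $ l - resolvent f x $ l) * g x) = 0"
      using i3[of l] i4 by (simp add: left_diff_distrib)
  qed
  from this[of 1] this[of 2] show ?thesis
    by eventually_elim (simp add: vec_eq_iff forall_2)
qed

lemma resolvent_bound:
  assumes f: "f \<in> L2"
  shows "L2_norm (resolvent f) \<le> 2 * (B\<^sup>2 * entry.mass) * L2_norm f"
proof -
  let ?T = "\<lambda>i j x. LBINT y. green x y $ i $ j * f y $ j"
  let ?c = "B\<^sup>2 * entry.mass"
  have T: "?T i j \<in> L2" for i j by (intro entry.operator_L2(1) L2_nth f)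
  have sq: "integrable lborel (\<lambda>x. (norm (?T i j x))\<^sup>2)" for i j using T by (simp add: L2_def)
  have fsq: "integrable lborel (\<lambda>x. (norm (f x $ j))\<^sup>2)" for j using L2_nth[OF f] by (simp add: L2_def)
  have c0: "?c \<ge> 0" using entry.mass_pos by simp
  have Tb: "(LBINT x. (norm (?T i j x))\<^sup>2) \<le> ?c\<^sup>2 * (LBINT x. (norm (f x $ j))\<^sup>2)" for i j
  proof -
    have "L2_norm (?T i j) \<le> ?c * L2_norm (\<lambda>x. f x $ j)"
      by (intro entry.operator_L2(2) L2_nth f)
    then have "(L2_norm (?T i j))\<^sup>2 \<le> (?c * L2_norm (\<lambda>x. f x $ j))\<^sup>2"
      by (intro power_mono) (auto simp: L2_norm_def)
    then show ?thesis by (simp add: L2_norm_def power_mult_distrib)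
  qed
  have pt: "(norm (resolvent f x))\<^sup>2 \<le> (\<Sum>i\<in>UNIV. \<Sum>j\<in>UNIV. 2 * (norm (?T i j x))\<^sup>2)" for x
    unfolding norm_vec_sq resolvent_nth[OF f]
  proof (intro sum_mono)
    fix i
    have "(norm (?T i 1 x + ?T i 2 x))\<^sup>2 \<le> (norm (?T i 1 x) + norm (?T i 2 x))\<^sup>2"
      by (intro power_mono norm_triangle_ineq) auto
    then show "(norm (\<Sum>j\<in>UNIV. ?T i j x))\<^sup>2 \<le> (\<Sum>j\<in>UNIV. 2 * (norm (?T i j x))\<^sup>2)"
      using sum_squares_bound[of "norm (?T i 1 x)" "norm (?T i 2 x)"]
      by (simp add: sum_2 power2_sum)
  qed
  have "(LBINT x. (norm (resolvent f x))\<^sup>2)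
      \<le> (LBINT x. (\<Sum>i\<in>UNIV. \<Sum>j\<in>UNIV. 2 * (norm (?T i j x))\<^sup>2))"
    using resolvent_L2[OF f]
    by (intro integral_mono pt Bochner_Integration.integrable_sum integrable_mult_right sq)
      (simp add: L2_def)
  also have "\<dots> = (\<Sum>i\<in>UNIV. \<Sum>j\<in>UNIV. 2 * (LBINT x. (norm (?T i j x))\<^sup>2))"
    by (simp add: Bochner_Integration.integral_sum sq)
  also have "\<dots> \<le> (\<Sum>i\<in>(UNIV :: 2 set). \<Sum>j\<in>UNIV. 2 * (?c\<^sup>2 * (LBINT x. (norm (f x $ j))\<^sup>2)))"
    by (intro sum_mono mult_left_mono Tb) auto
  also have "\<dots> = (2 * ?c)\<^sup>2 * (LBINT x. (norm (f x))\<^sup>2)"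
    unfolding norm_vec_sq using fsq
    by (simp add: sum_2 power2_eq_square algebra_simps)
  finally have "L2_norm (resolvent f) \<le> sqrt ((2 * ?c)\<^sup>2 * (LBINT x. (norm (f x))\<^sup>2))"
    unfolding L2_norm_def by (rule real_sqrt_le_mono)
  then show ?thesis using c0 by (simp add: L2_norm_def real_sqrt_mult abs_mult)
qed

theorem inverse_kernel_green: "inverse_kernel \<kappa> q green"
  unfolding inverse_kernel_def lax_invertible_def
proof (intro conjI ballI allI impI)
  show "\<exists>u. lax_op \<kappa> q u f" if "f \<in> L2" for f using lax_op_resolvent[OF that] by blast
  show "AE x in lborel. u x = u' x" if "lax_op \<kappa> q u f \<and> lax_op \<kappa> q u' f" for f u u'
    using lax_op_unique[OF that[THEN conjunct1]] lax_op_unique[OF that[THEN conjunct2]]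
    by eventually_elim simp
  show "\<exists>C. \<forall>f u. lax_op \<kappa> q u f \<longrightarrow> L2_norm u \<le> C * L2_norm f"
  proof (intro exI allI impI)
    fix f u assume op: "lax_op \<kappa> q u f"
    then have f: "f \<in> L2" and u: "u \<in> L2" by (auto simp: lax_op_def)
    have "L2_norm u = L2_norm (resolvent f)"
      unfolding L2_norm_def
      using lax_op_unique[OF op] L2_measurable[OF u] L2_measurable[OF resolvent_L2[OF f]]
      by (intro arg_cong[where f = sqrt] integral_cong_AE) auto
    then show "L2_norm u \<le> 2 * (B\<^sup>2 * entry.mass) * L2_norm f"
      using resolvent_bound[OF f] by simp
  qed
  have "(\<lambda>(x, y). green x y $ i $ j) \<in> borel_measurable borel" for i j
    using entry.meas[of i j] by (simp add: lborel_prod)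
  then show "(\<lambda>(x, y). green x y) \<in> borel_measurable borel"
    by (intro borel_measurable_vec) (simp add: case_prod_beta')
  show "AE x in lborel. integrable lborel (\<lambda>y. green x y *v f y) \<and> u x = (LBINT y. green x y *v f y)"
    if "lax_op \<kappa> q u f" for f u
    using lax_op_unique[OF that] that green_integrable
    by (auto simp: lax_op_def resolvent_def)
qed

end

section \<open>Bounded solutions of Riccati equations\<close>

text \<open>For \<open>p = \<kappa> q\<close> with \<open>\<i> \<kappa>\<^sup>2 = c\<close> one has \<open>\<bar>\<kappa>\<bar>\<^sup>2 = \<bar>c\<bar>\<close>, so the bound says that \<open>q\<close> has \<open>L2\<close> norm at
  most \<open>1/2\<close>, whatever \<open>\<kappa>\<close> is.\<close>

definition small_potential :: "real \<Rightarrow> (real \<Rightarrow> complex) \<Rightarrow> bool" where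
  "small_potential c p \<longleftrightarrow> continuous_on UNIV p \<and> integrable lborel (\<lambda>x. (norm (p x))\<^sup>2) \<and>
     (LBINT x. (norm (p x))\<^sup>2) \<le> \<bar>c\<bar> / 4"

lemma small_potential_reflect:
  assumes "small_potential c p"
  shows "small_potential (- c) (\<lambda>x. - p (- x))"
proof -
  have "continuous_on UNIV (\<lambda>x. - p (- x))"
    using assms by (auto simp: small_potential_def intro!: continuous_intros continuous_on_compose2[of UNIV p])
  then show ?thesis
    using assms lborel_integrable_real_affine[of "\<lambda>x. (norm (p x))\<^sup>2" "-1" 0]
      lborel_integral_real_affine[of "-1" "\<lambda>x. (norm (p x))\<^sup>2" 0]
    by (simp add: small_potential_def)
qed

text \<open>For \<open>c > 0\<close>, the bounded solution of \<open>e' = 2 c e - F\<close>.\<close>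

definition tail_avg :: "real \<Rightarrow> (real \<Rightarrow> complex) \<Rightarrow> real \<Rightarrow> complex" where
  "tail_avg c F x = of_real (exp (2 * c * x)) * (LBINT y:{x..}. of_real (exp (- 2 * c * y)) * F y)"

text \<open>The inequality \<open>t \<bar>p\<bar> \<le> (c/2) t\<^sup>2 + \<bar>p\<bar>\<^sup>2 / (2 c)\<close> with \<open>t = exp (- 2 c (y - x))\<close> takes the
  place of the Cauchy-Schwarz inequality; the weights make both terms contribute \<open>1/8\<close>.\<close>

lemma weighted_L2_bound:
  assumes c: "c > 0" and p: "small_potential c p"
  shows "set_integrable lborel {x..} (\<lambda>y. exp (- 2 * c * (y - x)) * norm (p y))"
    and "(LBINT y:{x..}. exp (- 2 * c * (y - x)) * norm (p y)) \<le> 1 / 4"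
proof -
  have [measurable]: "p \<in> borel_measurable borel"
    using p by (auto simp: small_potential_def intro: borel_measurable_continuous_onI)
  let ?f = "\<lambda>y. indicator {x..} y *\<^sub>R (exp (- 2 * c * (y - x)) * norm (p y))"
  let ?g = "\<lambda>y. (c / 2) * (indicator {x..} y *\<^sub>R exp (- (4 * c) * (y - x))) + (1 / (2 * c)) * (norm (p y))\<^sup>2"
  have e: "integrable lborel (\<lambda>y. indicator {x..} y *\<^sub>R exp (- (4 * c) * (y - x)))"
      "(LBINT y. indicator {x..} y *\<^sub>R exp (- (4 * c) * (y - x))) = 1 / (4 * c)"
    using exp_tail[of "4 * c" x] c by (simp_all only: set_integrable_def set_lebesgue_integral_def)
  have sq: "integrable lborel (\<lambda>x. (norm (p x))\<^sup>2)" "(LBINT x. (norm (p x))\<^sup>2) \<le> c / 4"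
    using p c by (auto simp: small_potential_def)
  have g: "integrable lborel ?g"
    using e(1) sq(1) by (intro Bochner_Integration.integrable_add integrable_mult_right)
  have le: "?f y \<le> ?g y" for y
  proof (cases "y \<ge> x")
    case True
    define t where "t = exp (- 2 * c * (y - x))"
    have t2: "exp (- (4 * c) * (y - x)) = t\<^sup>2"
      by (simp add: t_def power2_eq_square mult_exp_exp algebra_simps)
    have "0 \<le> (c * t - norm (p y))\<^sup>2 / (2 * c)" using c by simp
    also have "\<dots> = (c / 2) * t\<^sup>2 + (1 / (2 * c)) * (norm (p y))\<^sup>2 - t * norm (p y)"
      using c by (simp add: power2_eq_square field_simps)
    finally show ?thesis using True unfolding t2 t_def[symmetric] by simp
  qed (use c in simp)
  have f: "integrable lborel ?f"
  proof (rule integrable_dominated[OF g])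
    show "norm (?f y) \<le> ?g y" for y
      using le[of y] by (simp only: real_norm_def abs_of_nonneg indicator_pos_le scaleR_nonneg_nonneg
          mult_nonneg_nonneg exp_ge_zero norm_ge_zero)
  qed measurable
  then show "set_integrable lborel {x..} (\<lambda>y. exp (- 2 * c * (y - x)) * norm (p y))"
    by (simp only: set_integrable_def)
  have "(LBINT y. ?f y) \<le> (LBINT y. ?g y)"
    by (intro integral_mono f g le)
  also have "\<dots> = (c / 2) * (1 / (4 * c)) + (1 / (2 * c)) * (LBINT x. (norm (p x))\<^sup>2)"
    using e sq(1) by (subst Bochner_Integration.integral_add) (simp_all only: integrable_mult_right integral_mult_right_zero)
  also have "\<dots> \<le> (c / 2) * (1 / (4 * c)) + (1 / (2 * c)) * (c / 4)"
    using c sq(2) by (intro add_left_mono mult_left_mono) auto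
  also have "\<dots> = 1 / 4" using c by (simp add: field_simps)
  finally show "(LBINT y:{x..}. exp (- 2 * c * (y - x)) * norm (p y)) \<le> 1 / 4"
    by (simp only: set_lebesgue_integral_def)
qed

lemma tail_avg_bound:
  assumes c: "c > 0" and p: "small_potential c p" and s: "small_potential c s"
    and F: "continuous_on UNIV F"
    and le: "\<And>y. norm (F y) \<le> E1 * norm (p y) + E2 * norm (s y) + \<epsilon>"
    and nonneg: "E1 \<ge> 0" "E2 \<ge> 0" "\<epsilon> \<ge> 0"
  shows "set_integrable lborel {x..} (\<lambda>y. of_real (exp (- 2 * c * y)) * F y)"
    and "norm (tail_avg c F x) \<le> E1 / 4 + E2 / 4 + \<epsilon> / (2 * c)"
proof -
  have [measurable]: "F \<in> borel_measurable borel"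
    using F by (auto intro: borel_measurable_continuous_onI)
  let ?e = "\<lambda>y. exp (- 2 * c * (y - x))"
  let ?f = "\<lambda>y. indicator {x..} y *\<^sub>R (of_real (?e y) * F y)"
  define P where "P y = indicator {x..} y *\<^sub>R (?e y * norm (p y))" for y
  define S where "S y = indicator {x..} y *\<^sub>R (?e y * norm (s y))" for y
  define I where "I y = indicator {x..} y *\<^sub>R ?e y" for y
  have P: "integrable lborel P" "integral\<^sup>L lborel P \<le> 1 / 4"
    using weighted_L2_bound[OF c p, of x]
    unfolding set_integrable_def set_lebesgue_integral_def P_def[abs_def] by simp_all
  have S: "integrable lborel S" "integral\<^sup>L lborel S \<le> 1 / 4"
    using weighted_L2_bound[OF c s, of x]
    unfolding set_integrable_def set_lebesgue_integral_def S_def[abs_def] by simp_all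
  have "2 * c > 0" using c by simp
  from exp_tail[OF this, of x] have I: "integrable lborel I" "integral\<^sup>L lborel I = 1 / (2 * c)"
    unfolding set_integrable_def set_lebesgue_integral_def I_def[abs_def] by simp_all
  have g: "integrable lborel (\<lambda>y. E1 * P y + E2 * S y + \<epsilon> * I y)"
    by (intro Bochner_Integration.integrable_add integrable_mult_right P S I)
  have fg: "norm (?f y) \<le> E1 * P y + E2 * S y + \<epsilon> * I y" for y
  proof (cases "y \<ge> x")
    case True
    have "?e y * norm (F y) \<le> ?e y * (E1 * norm (p y) + E2 * norm (s y) + \<epsilon>)"
      by (intro mult_left_mono le) auto
    also have "\<dots> = E1 * P y + E2 * S y + \<epsilon> * I y"
      using True by (simp add: P_def S_def I_def distrib_left)
    finally show ?thesis using True by (simp add: norm_mult)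
  qed (simp add: P_def S_def I_def)
  have f: "integrable lborel ?f"
    by (rule integrable_dominated[OF g _ fg]) measurable
  have eq: "(\<lambda>y. indicator {x..} y *\<^sub>R (of_real (exp (- 2 * c * y)) * F y))
      = (\<lambda>y. of_real (exp (- 2 * c * x)) * ?f y)"
  proof
    fix y
    have "of_real (exp (- 2 * c * y)) = (of_real (exp (- 2 * c * x)) * of_real (?e y) :: complex)"
      unfolding of_real_mult[symmetric] by (simp add: mult_exp_exp algebra_simps)
    then show "indicator {x..} y *\<^sub>R (of_real (exp (- 2 * c * y)) * F y) = of_real (exp (- 2 * c * x)) * ?f y"
      by simp
  qed
  show "set_integrable lborel {x..} (\<lambda>y. of_real (exp (- 2 * c * y)) * F y)"
    unfolding set_integrable_def eq by (intro integrable_mult_right f)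
  have "tail_avg c F x = (LBINT y. ?f y)"
  proof -
    have "of_real (exp (2 * c * x)) * of_real (exp (- 2 * c * x)) = (1 :: complex)"
      unfolding of_real_mult[symmetric] by (simp add: mult_exp_exp)
    then show ?thesis
      unfolding tail_avg_def set_lebesgue_integral_def eq integral_mult_right_zero
      by (simp add: mult.assoc[symmetric])
  qed
  also have "norm \<dots> \<le> (LBINT y. E1 * P y + E2 * S y + \<epsilon> * I y)"
    by (rule Bochner_Integration.integral_norm_bound_integral[OF f g fg])
  also have "\<dots> = E1 * integral\<^sup>L lborel P + E2 * integral\<^sup>L lborel S + \<epsilon> * integral\<^sup>L lborel I"
    using P(1) S(1) I(1) by simp
  also have "\<dots> \<le> E1 * (1 / 4) + E2 * (1 / 4) + \<epsilon> * (1 / (2 * c))"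
    by (rule add_mono[OF add_mono]; rule mult_left_mono) (use P S I nonneg in auto)
  finally show "norm (tail_avg c F x) \<le> E1 / 4 + E2 / 4 + \<epsilon> / (2 * c)" by simp
qed

lemma tail_avg_deriv:
  assumes F: "continuous_on UNIV F"
    and int: "\<And>a. set_integrable lborel {a..} (\<lambda>y. of_real (exp (- 2 * c * y)) * F y)"
  shows "(tail_avg c F has_vector_derivative 2 * of_real c * tail_avg c F x - F x) (at x)"
proof -
  let ?h = "\<lambda>y. of_real (exp (- 2 * c * y)) * F y"
  have 1: "((\<lambda>x. LBINT y:{x..}. ?h y) has_vector_derivative - ?h x) (at x)"
    by (intro tail_integral_deriv int continuous_intros F)
  have 2: "((\<lambda>x. complex_of_real (exp (2 * c * x))) has_vector_derivative of_real (2 * c * exp (2 * c * x))) (at x)"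
    by (intro has_vector_derivative_of_real) (auto intro!: derivative_eq_intros)
  have 3: "of_real (exp (2 * c * x)) * (of_real (exp (- 2 * c * x)) * F x) = F x"
  proof -
    have "of_real (exp (2 * c * x)) * of_real (exp (- 2 * c * x)) = (1 :: complex)"
      unfolding of_real_mult[symmetric] by (simp add: mult_exp_exp)
    then show ?thesis by (simp add: mult.assoc[symmetric])
  qed
  have "(tail_avg c F has_vector_derivative
      of_real (exp (2 * c * x)) * - ?h x + of_real (2 * c * exp (2 * c * x)) * (LBINT y:{x..}. ?h y)) (at x)"
    unfolding tail_avg_def[abs_def] by (intro has_vector_derivative_mult 1 2)
  moreover have "of_real (exp (2 * c * x)) * - ?h x + of_real (2 * c * exp (2 * c * x)) * (LBINT y:{x..}. ?h y)
      = 2 * of_real c * tail_avg c F x - F x"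
    using 3 by (simp add: tail_avg_def)
  ultimately show ?thesis by simp
qed

lemma bounded_solution_eq_tail_avg:
  assumes c: "c > 0" and F: "continuous_on UNIV F"
    and int: "set_integrable lborel {x..} (\<lambda>y. of_real (exp (- 2 * c * y)) * F y)"
    and e: "\<And>y. (e has_vector_derivative 2 * of_real c * e y + F y) (at y)"
    and bounded: "\<And>y. norm (e y) \<le> E"
  shows "e x = - tail_avg c F x"
proof -
  let ?w = "\<lambda>y. complex_of_real (exp (- 2 * c * y))"
  have D: "((\<lambda>y. ?w y * e y) has_vector_derivative ?w y * F y) (at y)" for y
  proof -
    have "(?w has_vector_derivative of_real (- 2 * c * exp (- 2 * c * y))) (at y)"
      by (intro has_vector_derivative_of_real) (auto intro!: derivative_eq_intros)
    then have "((\<lambda>y. ?w y * e y) has_vector_derivative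
        ?w y * (2 * of_real c * e y + F y) + of_real (- 2 * c * exp (- 2 * c * y)) * e y) (at y)"
      by (intro has_vector_derivative_mult e)
    then show ?thesis by (simp add: algebra_simps)
  qed
  have E: "E \<ge> 0" using order_trans[OF norm_ge_zero bounded] .
  have "(LBINT y:{x..}. ?w y * F y) = - (?w x * e x)"
  proof (rule tail_integral_FTC[OF _ int D])
    show "continuous_on UNIV (\<lambda>y. ?w y * F y)" by (intro continuous_intros F)
    have lim: "((\<lambda>y. exp (- 2 * c * y) * E) \<longlongrightarrow> 0) at_top" using c by real_asymp
    show "((\<lambda>y. ?w y * e y) \<longlongrightarrow> 0) at_top"
      by (rule Lim_null_comparison[OF always_eventually lim])
        (use E in \<open>auto simp: norm_mult intro!: mult_left_mono bounded\<close>)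
  qed
  moreover have "of_real (exp (2 * c * x)) * ?w x = (1 :: complex)"
    unfolding of_real_mult[symmetric] by (simp add: mult_exp_exp)
  ultimately show ?thesis
    by (simp add: tail_avg_def mult.assoc[symmetric])
qed

text \<open>The map \<open>a \<mapsto> - tail_avg c (s - p a\<^sup>2)\<close> sends the ball of radius \<open>1/2\<close> into the ball of radius
  \<open>1/4 + 1/16 = 5/16\<close>, and it contracts by the factor \<open>1/4\<close> because \<open>a + b\<close> has norm at most
  \<open>1\<close>.\<close>

lemma riccati_solution_pos:
  assumes c: "c > 0" and p: "small_potential c p" and s: "small_potential c s"
  obtains a where "\<And>x. norm (a x) \<le> 1 / 2"
    "\<And>x. (a has_vector_derivative 2 * of_real c * a x + s x - p x * (a x)\<^sup>2) (at x)"
proof -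
  have pc: "continuous_on UNIV p" "continuous_on UNIV s"
    using p s by (auto simp: small_potential_def)
  define F where "F a x = s x - p x * (apply_bcontfun a x)\<^sup>2" for a :: "real \<Rightarrow>\<^sub>C complex" and x
  define T where "T a = Bcontfun (\<lambda>x. - tail_avg c (F a) x)" for a
  have F_cont: "continuous_on UNIV (F a)" for a
    unfolding F_def[abs_def] by (intro continuous_intros pc) auto
  have pt: "norm (apply_bcontfun a x) \<le> 1 / 2" if "a \<in> cball 0 (1/2)" for a :: "real \<Rightarrow>\<^sub>C complex" and x
    using norm_bounded[of a x] that by simp
  have F_bound: "norm (F a y) \<le> (1/4) * norm (p y) + 1 * norm (s y) + 0" if "a \<in> cball 0 (1/2)" for a y
  proof -
    have "(norm (apply_bcontfun a y))\<^sup>2 \<le> (1/2)\<^sup>2" by (intro power_mono pt that) auto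
    then have "norm (p y) * (norm (apply_bcontfun a y))\<^sup>2 \<le> norm (p y) * (1/4)"
      by (intro mult_left_mono) (auto simp: power2_eq_square)
    moreover have "norm (F a y) \<le> norm (s y) + norm (p y) * (norm (apply_bcontfun a y))\<^sup>2"
      unfolding F_def norm_mult[symmetric] norm_power[symmetric] by (rule norm_triangle_ineq4)
    ultimately show ?thesis by simp
  qed
  have int: "set_integrable lborel {x..} (\<lambda>y. of_real (exp (- 2 * c * y)) * F a y)"
    and T_bound: "norm (tail_avg c (F a) x) \<le> 5 / 16" if "a \<in> cball 0 (1/2)" for a x
    using tail_avg_bound[OF c p s F_cont F_bound[OF that]] by auto
  have D: "(tail_avg c (F a) has_vector_derivative 2 * of_real c * tail_avg c (F a) x - F a x) (at x)"
    if "a \<in> cball 0 (1/2)" for a x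
    by (intro tail_avg_deriv F_cont int that)
  have T_apply: "apply_bcontfun (T a) = (\<lambda>x. - tail_avg c (F a) x)" if "a \<in> cball 0 (1/2)" for a
  proof -
    have "continuous_on UNIV (tail_avg c (F a))"
      using D[OF that] by (blast intro: continuous_at_imp_continuous_on has_vector_derivative_continuous)
    then have "(\<lambda>x. - tail_avg c (F a) x) \<in> bcontfun"
      using T_bound[OF that] by (intro bcontfun_normI[where b = "5/16"] continuous_intros) auto
    then show ?thesis unfolding T_def by (rule Bcontfun_inverse)
  qed
  have "\<exists>!a. a \<in> cball 0 (1/2) \<and> T a = a"
  proof (rule Banach_fix[where c = "1/4"])
    show "complete (cball (0 :: real \<Rightarrow>\<^sub>C complex) (1/2))" by (simp add: complete_eq_closed)
    show "T ` cball 0 (1/2) \<subseteq> cball 0 (1/2)"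
    proof clarify
      fix a :: "real \<Rightarrow>\<^sub>C complex" assume a: "a \<in> cball 0 (1/2)"
      have "norm (T a) \<le> 5 / 16"
        using T_bound[OF a] by (intro norm_bound) (auto simp: T_apply[OF a])
      then show "T a \<in> cball 0 (1/2)" by simp
    qed
    fix a b :: "real \<Rightarrow>\<^sub>C complex" assume ab: "a \<in> cball 0 (1/2)" "b \<in> cball 0 (1/2)"
    let ?d = "\<lambda>y. F a y - F b y"
    have d: "norm (?d y) \<le> dist a b * norm (p y) + 0 * norm (s y) + 0" for y
    proof -
      have "?d y = - (p y * ((apply_bcontfun a y + apply_bcontfun b y) * (apply_bcontfun a y - apply_bcontfun b y)))"
        by (simp add: F_def power2_eq_square algebra_simps)
      moreover have "norm (apply_bcontfun a y + apply_bcontfun b y) \<le> 1"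
        using norm_triangle_ineq[of "apply_bcontfun a y" "apply_bcontfun b y"] pt[of a y] pt[of b y] ab by simp
      moreover have "norm (apply_bcontfun a y - apply_bcontfun b y) \<le> dist a b"
        using dist_bounded[of a y b] by (simp add: dist_norm)
      ultimately have "norm (?d y) \<le> norm (p y) * (1 * dist a b)"
        by (simp only: norm_minus_cancel norm_mult) (intro mult_left_mono mult_mono, auto)
      then show ?thesis by (simp add: mult.commute)
    qed
    show "dist (T a) (T b) \<le> (1/4) * dist a b"
    proof (rule dist_bound)
      fix x
      have "norm (tail_avg c ?d x) \<le> dist a b / 4 + 0 / 4 + 0 / (2 * c)"
        by (rule tail_avg_bound(2)[OF c p s _ d]) (auto intro!: continuous_intros F_cont)
      moreover have "tail_avg c ?d x = tail_avg c (F a) x - tail_avg c (F b) x"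
        using int[of a x] int[of b x] ab
        by (simp add: tail_avg_def right_diff_distrib set_integral_diff)
      ultimately show "dist (apply_bcontfun (T a) x) (apply_bcontfun (T b) x) \<le> (1/4) * dist a b"
        using ab by (simp add: T_apply dist_norm norm_minus_commute)
    qed
  qed auto
  then obtain a where a: "a \<in> cball 0 (1/2)" "T a = a" by blast
  have eq: "apply_bcontfun a = (\<lambda>x. - tail_avg c (F a) x)" using T_apply[OF a(1)] a(2) by simp
  show thesis
  proof (rule that[of "apply_bcontfun a"])
    show "norm (apply_bcontfun a x) \<le> 1 / 2" for x by (rule pt[OF a(1)])
    fix x
    have "((\<lambda>x. - tail_avg c (F a) x) has_vector_derivative
        - (2 * of_real c * tail_avg c (F a) x - F a x)) (at x)"
      by (intro derivative_intros D a)
    then have "(apply_bcontfun a has_vector_derivative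
        - (2 * of_real c * tail_avg c (F a) x - F a x)) (at x)"
      by (simp only: eq[symmetric])
    moreover have "tail_avg c (F a) x = - apply_bcontfun a x" by (simp add: eq)
    ultimately show "(apply_bcontfun a has_vector_derivative
        2 * of_real c * apply_bcontfun a x + s x - p x * (apply_bcontfun a x)\<^sup>2) (at x)"
      by (simp add: F_def algebra_simps)
  qed
qed

text \<open>The reflection \<open>x \<mapsto> - x\<close> exchanges the two signs of \<open>c\<close>.\<close>

lemma riccati_solution:
  assumes c: "c \<noteq> 0" and p: "small_potential c p" and s: "small_potential c s"
  obtains a where "\<And>x. norm (a x) \<le> 1 / 2"
    "\<And>x. (a has_vector_derivative 2 * of_real c * a x + s x - p x * (a x)\<^sup>2) (at x)"
proof (cases "c > 0")
  case True then show ?thesis using riccati_solution_pos[OF _ p s] that by blast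
next
  case False
  then have "- c > 0" using c by simp
  from riccati_solution_pos[OF this small_potential_reflect[OF p] small_potential_reflect[OF s]]
  obtain a where a: "\<And>x. norm (a x) \<le> 1 / 2"
    "\<And>x. (a has_vector_derivative 2 * of_real (- c) * a x + - s (- x) - - p (- x) * (a x)\<^sup>2) (at x)"
    by blast
  show ?thesis
  proof (rule that[of "\<lambda>x. a (- x)"])
    fix x
    show "norm (a (- x)) \<le> 1 / 2" by (rule a)
    show "((\<lambda>x. a (- x)) has_vector_derivative 2 * of_real c * a (- x) + s x - p x * (a (- x))\<^sup>2) (at x)"
      using has_vector_derivative_reflect[OF a(2)[of "- x"]] by (simp add: algebra_simps)
  qed
qed

text \<open>The term \<open>m e\<close> contributes at most a quarter of the supremum \<open>E\<close> of \<open>e\<close>, which is absorbed.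
  That \<open>e\<close> is known to be bounded beforehand makes \<open>E\<close> finite.\<close>

lemma linear_estimate_pos:
  fixes e m f p :: "real \<Rightarrow> complex"
  assumes c: "c > 0" and p: "small_potential c p"
    and e: "\<And>x. (e has_vector_derivative (2 * of_real c - m x) * e x + f x) (at x)"
    and bounded: "bounded (range e)"
    and m: "continuous_on UNIV m" "\<And>x. norm (m x) \<le> norm (p x)"
    and f: "continuous_on UNIV f" "\<And>x. norm (f x) \<le> \<epsilon>"
  shows "norm (e x) \<le> \<epsilon> / c"
proof -
  have \<epsilon>: "\<epsilon> \<ge> 0" using order_trans[OF norm_ge_zero f(2)] .
  have e_cont: "continuous_on UNIV e"
    using e by (blast intro: continuous_at_imp_continuous_on has_vector_derivative_continuous)
  define E where "E = (SUP x. norm (e x))"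
  have bdd: "bdd_above (range (\<lambda>x. norm (e x)))"
    using bounded by (auto simp: bounded_iff bdd_above_def)
  have le: "norm (e x) \<le> E" for x unfolding E_def by (rule cSUP_upper[OF _ bdd]) simp
  have E0: "E \<ge> 0" using order_trans[OF norm_ge_zero le] .
  let ?F = "\<lambda>x. - m x * e x + f x"
  have F_cont: "continuous_on UNIV ?F" by (rule continuous_on_add[OF continuous_on_mult[OF continuous_on_minus[OF m(1)] e_cont] f(1)])
  have F: "norm (?F y) \<le> E * norm (p y) + 0 * norm (p y) + \<epsilon>" for y
  proof -
    have "norm (?F y) \<le> norm (m y) * norm (e y) + norm (f y)"
      using norm_triangle_ineq[of "- m y * e y" "f y"] by (simp add: norm_mult)
    also have "\<dots> \<le> norm (p y) * E + \<epsilon>"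
      by (intro add_mono mult_mono m le f) auto
    finally show ?thesis by (simp add: mult.commute)
  qed
  note bound = tail_avg_bound[OF c p p F_cont F E0 _ \<epsilon>]
  have "norm (e x) \<le> E / 4 + \<epsilon> / (2 * c)" for x
  proof -
    have "e x = - tail_avg c ?F x"
    proof (rule bounded_solution_eq_tail_avg[OF c F_cont bound(1) _ le])
      show "(e has_vector_derivative 2 * of_real c * e y + ?F y) (at y)" for y
        using e[of y] by (simp add: algebra_simps)
    qed simp
    then show ?thesis using bound(2)[of x] by simp
  qed
  then have "E \<le> E / 4 + \<epsilon> / (2 * c)" unfolding E_def by (intro cSUP_least) auto
  moreover have "\<epsilon> / (2 * c) = (\<epsilon> / c) / 2" by simp
  ultimately have "E \<le> (2 / 3) * (\<epsilon> / c)" by linarith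
  also have "\<dots> \<le> 1 * (\<epsilon> / c)" using \<epsilon> c by (intro mult_right_mono) auto
  finally show ?thesis using le[of x] by simp
qed

lemma linear_estimate:
  fixes e m f p :: "real \<Rightarrow> complex"
  assumes c: "c \<noteq> 0" and p: "small_potential c p"
    and e: "\<And>x. (e has_vector_derivative (2 * of_real c - m x) * e x + f x) (at x)"
    and bounded: "bounded (range e)"
    and m: "continuous_on UNIV m" "\<And>x. norm (m x) \<le> norm (p x)"
    and f: "continuous_on UNIV f" "\<And>x. norm (f x) \<le> \<epsilon>"
  shows "norm (e x) \<le> \<epsilon> / \<bar>c\<bar>"
proof (cases "c > 0")
  case True then show ?thesis using linear_estimate_pos[OF _ p e bounded m f] by simp
next
  case False
  then have c': "- c > 0" using c by simp
  have "norm (e (- (- x))) \<le> \<epsilon> / (- c)"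
  proof (rule linear_estimate_pos[OF c' small_potential_reflect[OF p], where e = "\<lambda>x. e (- x)" and m = "\<lambda>x. - m (- x)" and f = "\<lambda>x. - f (- x)"])
    show "((\<lambda>x. e (- x)) has_vector_derivative (2 * of_real (- c) - - m (- x)) * e (- x) + - f (- x)) (at x)" for x
      using has_vector_derivative_reflect[OF e[of "- x"]] by (simp add: algebra_simps)
    show "bounded (range (\<lambda>x. e (- x)))" using bounded by (rule bounded_subset) auto
    show "continuous_on UNIV (\<lambda>x. - m (- x))" "continuous_on UNIV (\<lambda>x. - f (- x))"
      by (auto intro!: continuous_intros continuous_on_compose2[OF m(1)] continuous_on_compose2[OF f(1)])
  qed (use m f in auto)
  then show ?thesis using c' by simp
qed

section \<open>The diagonal Green's function in terms of the Riccati solutions\<close>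

lemma bounded_antiderivative:
  assumes g: "g \<in> schwartz" and a: "continuous_on UNIV a" "\<And>x. norm (a x) \<le> M"
  obtains J C where "\<And>x. (J has_vector_derivative g x * a x) (at x)" "\<And>x. norm (J x :: complex) \<le> C"
proof -
  have [measurable]: "g \<in> borel_measurable borel" "a \<in> borel_measurable borel"
    using g a by (auto intro: schwartz_measurable borel_measurable_continuous_onI)
  have int: "integrable lborel (\<lambda>x. g x * a x)"
  proof (rule integrable_dominated)
    show "integrable lborel (\<lambda>x. norm (g x) * M)"
      by (intro integrable_mult_left integrable_norm schwartz_integrable g)
    show "norm (g x * a x) \<le> norm (g x) * M" for x
      unfolding norm_mult by (intro mult_left_mono a) auto
  qed measurable
  have si: "set_integrable lborel {..x} (\<lambda>x. g x * a x)" for x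
    using int unfolding set_integrable_def by (intro integrable_mult_indicator) auto
  show thesis
  proof (rule that[of "\<lambda>x. LBINT y:{..x}. g y * a y" "LBINT y. norm (g y * a y)"])
    show "((\<lambda>x. LBINT y:{..x}. g y * a y) has_vector_derivative g x * a x) (at x)" for x
      by (intro head_integral_deriv continuous_intros schwartz_continuous g a si)
    show "norm (LBINT y:{..x}. g y * a y) \<le> (LBINT y. norm (g y * a y))" for x
      unfolding set_lebesgue_integral_def
      by (rule Bochner_Integration.integral_norm_bound_integral[OF si[unfolded set_integrable_def] integrable_norm[OF int]])
        (auto simp: indicator_def)
  qed
qed

text \<open>These are the equations for the ratios of the components of two solutions \<open>(u, a u)\<close> and
  \<open>(b v, v)\<close> of the Lax system with off-diagonal entries \<open>- p\<close> and \<open>- s\<close>.\<close>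

definition riccati_pair ::
  "real \<Rightarrow> (real \<Rightarrow> complex) \<Rightarrow> (real \<Rightarrow> complex) \<Rightarrow> (real \<Rightarrow> complex) \<Rightarrow> (real \<Rightarrow> complex) \<Rightarrow> bool" where
  "riccati_pair c p s a b \<longleftrightarrow> (\<forall>x. norm (a x) \<le> 1/2) \<and> (\<forall>x. norm (b x) \<le> 1/2) \<and>
    (\<forall>x. (a has_vector_derivative 2 * of_real c * a x + s x - p x * (a x)\<^sup>2) (at x)) \<and>
    (\<forall>x. (b has_vector_derivative - 2 * of_real c * b x + p x - s x * (b x)\<^sup>2) (at x))"

lemma one_minus_product:
  fixes a b :: complex
  assumes "norm a \<le> 1/2" "norm b \<le> 1/2"
  shows "norm (1 - a * b) \<ge> 3/4" "1 - a * b \<noteq> 0"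
proof -
  have "norm (a * b) \<le> (1/2) * (1/2)" unfolding norm_mult by (intro mult_mono assms) auto
  then show "norm (1 - a * b) \<ge> 3/4" using norm_triangle_ineq2[of 1 "a * b"] by simp
  then show "1 - a * b \<noteq> 0" by auto
qed

text \<open>Given the ratios, \<open>u\<close> is found by integrating \<open>u' = (- c + \<kappa> q a) u\<close>, and \<open>v\<close> is then defined
  by \<open>u v (1 - a b) = 1\<close>, which says that the Wronskian is one.  The sign of \<open>c\<close> decides which of
  the two solutions decays at \<open>+\<infinity>\<close>; for \<open>c < 0\<close> they exchange roles.\<close>

lemma weyl_pair_exists:
  assumes q: "q \<in> schwartz" and c: "\<i> * \<kappa>\<^sup>2 = of_real c" "c \<noteq> 0"
    and ab: "riccati_pair c (\<lambda>x. \<kappa> * q x) (\<lambda>x. \<kappa> * conj_pot q x) a b"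
  obtains B and P Q \<alpha> \<beta> :: "2 \<Rightarrow> real \<Rightarrow> complex" where
    "c > 0 \<Longrightarrow> weyl_pair \<kappa> q c B P Q \<alpha> \<beta>"
    "c < 0 \<Longrightarrow> weyl_pair \<kappa> q (- c) B Q P \<beta> \<alpha>"
    "\<And>i j x. P i x * \<alpha> j x + Q i x * \<beta> j x = (if i = j then 1 else 0)"
    "\<And>x. P 1 x * \<alpha> 1 x = 1 / (1 - a x * b x)" "\<And>x. P 1 x * \<alpha> 2 x = - b x / (1 - a x * b x)"
    "\<And>x. P 2 x * \<alpha> 1 x = a x / (1 - a x * b x)" "\<And>x. P 2 x * \<alpha> 2 x = - (a x * b x) / (1 - a x * b x)"
proof -
  define p where "p x = \<kappa> * q x" for x
  define s where "s x = \<kappa> * conj_pot q x" for x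
  have ab: "norm (a x) \<le> 1/2" "norm (b x) \<le> 1/2"
    "(a has_vector_derivative 2 * of_real c * a x + s x - p x * (a x)\<^sup>2) (at x)"
    "(b has_vector_derivative - 2 * of_real c * b x + p x - s x * (b x)\<^sup>2) (at x)" for x
    using ab by (auto simp: riccati_pair_def p_def s_def)
  have a_cont: "continuous_on UNIV a"
    using ab(3) by (blast intro: continuous_at_imp_continuous_on has_vector_derivative_continuous)
  have p: "p \<in> schwartz" unfolding p_def by (intro schwartz_scale q)
  obtain J C where J: "\<And>x. (J has_vector_derivative p x * a x) (at x)" "\<And>x. norm (J x) \<le> C"
    using bounded_antiderivative[OF p a_cont ab(1)] by blast
  have nz: "norm (1 - a x * b x) \<ge> 3/4" "1 - a x * b x \<noteq> 0" for x
    by (intro one_minus_product ab)+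
  define u where "u x = exp (- of_real c * of_real x + J x)" for x :: real
  define v where "v x = exp (of_real c * of_real x - J x) / (1 - a x * b x)" for x :: real
  have u_deriv: "(u has_vector_derivative (- of_real c + p x * a x) * u x) (at x)" for x
  proof -
    have "((\<lambda>x. - of_real c * of_real x + J x) has_vector_derivative - of_real c + p x * a x) (at x)"
      by (auto intro!: derivative_eq_intros J)
    from field_vector_diff_chain_at[OF this, of exp "exp (- of_real c * of_real x + J x)"]
    show ?thesis by (auto simp: u_def[abs_def] o_def)
  qed
  have e_deriv: "((\<lambda>x. exp (of_real c * of_real x - J x)) has_vector_derivative
      (of_real c - p x * a x) * exp (of_real c * of_real x - J x)) (at x)" for x
  proof -
    have "((\<lambda>x. of_real c * of_real x - J x) has_vector_derivative of_real c - p x * a x) (at x)"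
      by (auto intro!: derivative_eq_intros J)
    from field_vector_diff_chain_at[OF this, of exp "exp (of_real c * of_real x - J x)"]
    show ?thesis by (auto simp: o_def)
  qed
  have w_deriv: "((\<lambda>x. 1 - a x * b x) has_vector_derivative - ((1 - a x * b x) * (a x * p x + b x * s x))) (at x)" for x
  proof -
    have "((\<lambda>x. 1 - a x * b x) has_vector_derivative
        0 - (a x * (- 2 * of_real c * b x + p x - s x * (b x)\<^sup>2) + (2 * of_real c * a x + s x - p x * (a x)\<^sup>2) * b x)) (at x)"
      by (intro has_vector_derivative_diff has_vector_derivative_mult has_vector_derivative_const ab)
    then show ?thesis by (simp add: power2_eq_square algebra_simps)
  qed
  have v_deriv: "(v has_vector_derivative (of_real c + s x * b x) * v x) (at x)" for x
  proof -
    let ?E = "\<lambda>x. exp (of_real c * of_real x - J x)" and ?w = "\<lambda>x. 1 - a x * b x"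
    have inv: "((\<lambda>x. inverse (?w x)) has_vector_derivative - ((- (?w x * (a x * p x + b x * s x))) / (?w x)\<^sup>2)) (at x)"
    proof -
      have "(inverse has_field_derivative - (inverse (?w x) * inverse (?w x))) (at (?w x))"
        using nz(2)[of x] by (auto intro!: derivative_eq_intros)
      from field_vector_diff_chain_at[OF w_deriv this]
      show ?thesis by (simp add: o_def power2_eq_square divide_inverse mult_ac)
    qed
    have "(v has_vector_derivative ?E x * - ((- (?w x * (a x * p x + b x * s x))) / (?w x)\<^sup>2)
        + ((of_real c - p x * a x) * ?E x) * inverse (?w x)) (at x)"
      unfolding v_def[abs_def] divide_inverse[of "exp _"] by (intro has_vector_derivative_mult e_deriv inv)
    moreover have "?E x * - ((- (?w x * (a x * p x + b x * s x))) / (?w x)\<^sup>2)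
        + ((of_real c - p x * a x) * ?E x) * inverse (?w x) = (of_real c + s x * b x) * v x"
      using nz(2)[of x] by (simp add: v_def power2_eq_square divide_simps) (simp add: algebra_simps)
    ultimately show ?thesis by simp
  qed
  have uv: "u x * v x = 1 / (1 - a x * b x)" for x
    by (simp add: u_def v_def mult_exp_exp)
  define P where "P i x = (if i = (1::2) then u x else a x * u x)" for i x
  define Q where "Q i x = (if i = (1::2) then b x * v x else v x)" for i x
  define \<alpha> where "\<alpha> j x = (if j = (1::2) then v x else - (b x * v x))" for j x
  define \<beta> where "\<beta> j x = (if j = (1::2) then - (a x * u x) else u x)" for j x
  have au: "((\<lambda>x. a x * u x) has_vector_derivative (of_real c * a x + s x) * u x) (at x)" for x
  proof -
    have "((\<lambda>x. a x * u x) has_vector_derivative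
        a x * ((- of_real c + p x * a x) * u x) + (2 * of_real c * a x + s x - p x * (a x)\<^sup>2) * u x) (at x)"
      by (intro has_vector_derivative_mult u_deriv ab)
    then show ?thesis by (simp add: power2_eq_square algebra_simps)
  qed
  have bv: "((\<lambda>x. b x * v x) has_vector_derivative (- of_real c * b x + p x) * v x) (at x)" for x
  proof -
    have "((\<lambda>x. b x * v x) has_vector_derivative
        b x * ((of_real c + s x * b x) * v x) + (- 2 * of_real c * b x + p x - s x * (b x)\<^sup>2) * v x) (at x)"
      by (intro has_vector_derivative_mult v_deriv ab)
    then show ?thesis by (simp add: power2_eq_square algebra_simps)
  qed
  have A: "lax_matrix \<kappa> q x $ 1 $ 1 = of_real c" "lax_matrix \<kappa> q x $ 1 $ 2 = - p x"
    "lax_matrix \<kappa> q x $ 2 $ 1 = - s x" "lax_matrix \<kappa> q x $ 2 $ 2 = - of_real c" for x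
    using c by (simp_all add: lax_matrix_def p_def s_def)
  have P_ode: "(P i has_vector_derivative - (\<Sum>l\<in>UNIV. lax_matrix \<kappa> q x $ i $ l * P l x)) (at x)" for i x
    using exhaust_2[of i] u_deriv[of x] au[of x]
    by (auto simp: P_def[abs_def] sum_2 A algebra_simps)
  have Q_ode: "(Q i has_vector_derivative - (\<Sum>l\<in>UNIV. lax_matrix \<kappa> q x $ i $ l * Q l x)) (at x)" for i x
    using exhaust_2[of i] v_deriv[of x] bv[of x]
    by (auto simp: Q_def[abs_def] sum_2 A algebra_simps)
  have \<alpha>_ode: "(\<alpha> j has_vector_derivative (\<Sum>i\<in>UNIV. \<alpha> i x * lax_matrix \<kappa> q x $ i $ j)) (at x)" for j x
    using exhaust_2[of j] v_deriv[of x] has_vector_derivative_minus[OF bv[of x]]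
    by (auto simp: \<alpha>_def[abs_def] sum_2 A algebra_simps)
  have \<beta>_ode: "(\<beta> j has_vector_derivative (\<Sum>i\<in>UNIV. \<beta> i x * lax_matrix \<kappa> q x $ i $ j)) (at x)" for j x
    using exhaust_2[of j] u_deriv[of x] has_vector_derivative_minus[OF au[of x]]
    by (auto simp: \<beta>_def[abs_def] sum_2 A algebra_simps)
  have unit: "P i x * \<alpha> j x + Q i x * \<beta> j x = (if i = j then 1 else 0)" for i j x
  proof -
    have "u x * v x * (1 - a x * b x) = 1" using uv nz(2)[of x] by simp
    then show ?thesis
      using exhaust_2[of i] exhaust_2[of j]
      by (auto simp: P_def Q_def \<alpha>_def \<beta>_def algebra_simps)
  qed
  \<comment> \<open>the factor \<open>2\<close> accounts for the division by \<open>1 - a b\<close>, whose norm is at least \<open>3/4\<close>\<close>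
  define B where "B = 2 * exp C"
  have C0: "C \<ge> 0" using order_trans[OF norm_ge_zero J(2)] .
  have u_bound: "norm (u x) \<le> exp C * exp (- c * x)" for x
  proof -
    have "Re (J x) \<le> C" using complex_Re_le_cmod[of "J x"] J(2)[of x] by linarith
    then show ?thesis by (simp add: u_def norm_exp_eq_Re mult_exp_exp)
  qed
  have v_bound: "norm (v x) \<le> B * exp (c * x)" for x
  proof -
    have "- Re (J x) \<le> C" using abs_Re_le_cmod[of "J x"] J(2)[of x] by linarith
    then have 1: "norm (exp (of_real c * of_real x - J x)) \<le> exp C * exp (c * x)"
      by (simp add: norm_exp_eq_Re mult_exp_exp)
    have "norm (v x) \<le> (exp C * exp (c * x)) / (1/2)"
      unfolding v_def norm_divide by (rule frac_le) (use 1 nz(1)[of x] in auto)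
    then show ?thesis by (simp add: B_def)
  qed
  have u_bound': "norm (u x) \<le> B * exp (- c * x)" for x
  proof -
    have "exp C * exp (- c * x) \<le> B * exp (- c * x)"
      unfolding B_def by (intro mult_right_mono) auto
    then show ?thesis using u_bound[of x] by linarith
  qed
  have half: "norm (a' * w) \<le> K" if "norm w \<le> K" "norm a' \<le> 1/2" for a' w :: complex and K
  proof -
    have "norm a' * norm w \<le> 1 * norm w" using that by (intro mult_right_mono) auto
    then show ?thesis using that by (simp add: norm_mult)
  qed
  have bounds: "norm (P i x) \<le> B * exp (- c * x)" "norm (Q i x) \<le> B * exp (c * x)"
    "norm (\<alpha> i x) \<le> B * exp (c * x)" "norm (\<beta> i x) \<le> B * exp (- c * x)" for i x
    using half[OF u_bound' ab(1)] half[OF v_bound ab(2)] u_bound' v_bound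
    by (auto simp: P_def Q_def \<alpha>_def \<beta>_def)
  show thesis
  proof (rule that[of B P Q \<alpha> \<beta>])
    show "weyl_pair \<kappa> q c B P Q \<alpha> \<beta>" if "c > 0"
      by (unfold_locales) (use that q P_ode Q_ode \<alpha>_ode \<beta>_ode unit bounds in auto)
    show "weyl_pair \<kappa> q (- c) B Q P \<beta> \<alpha>" if "c < 0"
      by (unfold_locales) (use that q P_ode Q_ode \<alpha>_ode \<beta>_ode unit bounds in \<open>auto simp: add.commute\<close>)
    show "P i x * \<alpha> j x + Q i x * \<beta> j x = (if i = j then 1 else 0)" for i j x by (rule unit)
    show "P 1 x * \<alpha> 1 x = 1 / (1 - a x * b x)" "P 1 x * \<alpha> 2 x = - b x / (1 - a x * b x)"
      "P 2 x * \<alpha> 1 x = a x / (1 - a x * b x)" "P 2 x * \<alpha> 2 x = - (a x * b x) / (1 - a x * b x)" for x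
      using uv[of x] by (auto simp: P_def \<alpha>_def mult_ac)
  qed
qed

text \<open>The integral over \<open>{R..r}\<close> is continuous in \<open>r\<close> and vanishes on a dense set, hence it
  vanishes for all \<open>r > R\<close>, and so does its derivative.\<close>

lemma continuous_integrals_zero:
  fixes h :: "real \<Rightarrow> complex"
  assumes h: "continuous_on UNIV h"
    and zero: "\<And>r. r \<in> \<rat> \<Longrightarrow> r > R \<Longrightarrow> (LBINT y:{R..r}. h y) = 0"
    and x: "x > R"
  shows "h x = 0"
proof -
  define T where "T r = integral {R..r} h" for r
  have T_eq: "(LBINT y:{R..r}. h y) = T r" for r
    unfolding T_def
    by (intro set_borel_integral_eq_integral borel_integrable_atLeastAtMost' continuous_on_subset[OF h]) auto
  have D: "(T has_vector_derivative h y) (at y)" if "y > R" for y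
  proof -
    have "(T has_vector_derivative h y) (at y within {R..y + 1})"
      unfolding T_def[abs_def]
      by (rule integral_has_vector_derivative) (use that in \<open>auto intro: continuous_on_subset[OF h]\<close>)
    then show ?thesis using that by (simp add: at_within_Icc_at)
  qed
  have "T y = 0" if "y > R" for y
  proof (rule ccontr)
    assume "T y \<noteq> 0"
    have "isCont T y" using D[OF that] by (rule has_vector_derivative_continuous)
    then have "\<forall>\<^sub>F z in at y. T z \<noteq> 0"
      using \<open>T y \<noteq> 0\<close> by (auto simp: isCont_def intro: tendsto_imp_eventually_ne)
    then obtain d where d: "d > 0" "\<And>z. z \<noteq> y \<Longrightarrow> dist z y < d \<Longrightarrow> T z \<noteq> 0"
      by (auto simp: eventually_at)
    obtain r where r: "r \<in> \<rat>" "y < r" "r < y + d"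
      using Rats_dense_in_real[of y "y + d"] d(1) by auto
    then have "T r \<noteq> 0" by (intro d(2)) (auto simp: dist_real_def)
    then show False using zero[OF r(1)] r that T_eq by simp
  qed
  then have "(T has_vector_derivative 0) (at x)"
    by (intro has_vector_derivative_transform_within_open[OF has_vector_derivative_const, where S = "{R<..}"])
      (use x in auto)
  then show ?thesis using D[OF x] vector_derivative_unique_at by blast
qed

text \<open>Both kernels of the same operator agree when applied to \<open>indicator {R..r}\<close>, for almost every
  \<open>x\<close>.  As countably many such functions with rational endpoints suffice, the exceptional null
  set can be chosen independently of them; continuity removes it.  This makes the definite
  description in \<open>green_diff\<close> meaningful.\<close>

lemma inverse_kernel_continuous_difference:
  assumes G: "inverse_kernel \<kappa> q G" "inverse_kernel \<kappa> q G'"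
    and G0: "inverse_kernel \<kappa> (\<lambda>_. 0) G\<^sub>0" "inverse_kernel \<kappa> (\<lambda>_. 0) G\<^sub>0'"
    and cont: "continuous_on UNIV (\<lambda>(x, y). G x y - G\<^sub>0 x y)"
      "continuous_on UNIV (\<lambda>(x, y). G' x y - G\<^sub>0' x y)"
  shows "G x y - G\<^sub>0 x y = G' x y - G\<^sub>0' x y"
proof -
  define E where "E x y = (G x y - G\<^sub>0 x y) - (G' x y - G\<^sub>0' x y)" for x y
  have E_cont: "continuous_on UNIV (\<lambda>z. E (fst z) (snd z) $ i $ j)" for i j
    using continuous_on_diff[OF cont] unfolding E_def case_prod_beta'
    by (intro continuous_on_component)
  have same: "AE x in lborel. integrable lborel (\<lambda>y. K x y *v f y) \<and> integrable lborel (\<lambda>y. K' x y *v f y)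
      \<and> (LBINT y. K x y *v f y) = (LBINT y. K' x y *v f y)"
    if K: "inverse_kernel \<kappa> p K" "inverse_kernel \<kappa> p K'" and f: "f \<in> L2" for p K K' f
  proof -
    obtain u where "lax_op \<kappa> p u f" using K(1) f by (auto simp: inverse_kernel_def lax_invertible_def)
    then have "AE x in lborel. integrable lborel (\<lambda>y. K x y *v f y) \<and> u x = (LBINT y. K x y *v f y)"
      "AE x in lborel. integrable lborel (\<lambda>y. K' x y *v f y) \<and> u x = (LBINT y. K' x y *v f y)"
      using K by (auto simp: inverse_kernel_def)
    then show ?thesis by eventually_elim auto
  qed
  define tst where "tst R r j y = (indicator {R..r} y *\<^sub>R axis j 1 :: complex^2)" for R r :: real and j y
  have tst: "tst R r j \<in> L2" for R r j
  proof (rule L2_vec)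
    fix i
    have "(\<lambda>x. tst R r j x $ i) = (if i = j then (\<lambda>x. indicator {R..r} x) else (\<lambda>x. 0))"
      by (auto simp: tst_def axis_def indicator_def)
    moreover have "(\<lambda>x. indicator {R..r} x) \<in> (L2 :: (real \<Rightarrow> complex) set)"
    proof -
      have "(\<lambda>x. (norm (indicator {R..r} x :: complex))\<^sup>2) = indicat_real {R..r}"
        by (auto simp: indicator_def)
      moreover have "integrable lborel (indicat_real {R..r})"
        by (intro integrable_real_indicator) (auto simp: emeasure_lborel_Icc_eq)
      ultimately show ?thesis by (simp add: L2_def)
    qed
    ultimately show "(\<lambda>x. tst R r j x $ i) \<in> L2"
      using schwartz_L2[OF schwartz_zero] by simp
  qed
  have AE_zero: "AE x in lborel. (LBINT y:{R..r}. E x y $ i $ j) = 0" for R r i j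
    using same[OF G tst[of R r j]] same[OF G0 tst[of R r j]]
  proof eventually_elim
    case (elim x)
    have e: "(K x y *v tst R r j y) $ i = indicator {R..r} y *\<^sub>R (K x y $ i $ j)" for K and y
      using exhaust_2[of j] by (auto simp: matrix_vector_mult_def tst_def axis_def sum_2 indicator_def)
    have int: "integrable lborel (\<lambda>y. indicator {R..r} y *\<^sub>R (K x y $ i $ j))"
      and nth: "(LBINT y. K x y *v tst R r j y) $ i = (LBINT y. indicator {R..r} y *\<^sub>R (K x y $ i $ j))"
      if "integrable lborel (\<lambda>y. K x y *v tst R r j y)" for K
      using integrable_bounded_linear[OF bounded_linear_vec_nth that, of i] integral_vec_nth[OF that, of i]
      by (simp_all only: e)
    have "(LBINT y:{R..r}. E x y $ i $ j)
      = (LBINT y. (indicator {R..r} y *\<^sub>R (G x y $ i $ j) - indicator {R..r} y *\<^sub>R (G\<^sub>0 x y $ i $ j))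
          - (indicator {R..r} y *\<^sub>R (G' x y $ i $ j) - indicator {R..r} y *\<^sub>R (G\<^sub>0' x y $ i $ j)))"
      unfolding set_lebesgue_integral_def E_def
      by (intro Bochner_Integration.integral_cong) (auto simp: algebra_simps)
    also have "\<dots> = 0"
      using elim int nth[of G, symmetric] nth[of G', symmetric] nth[of G\<^sub>0, symmetric] nth[of G\<^sub>0', symmetric]
      by (simp del: scaleR_conv_of_real)
    finally show ?case .
  qed
  have "AE x in lborel. \<forall>i j. \<forall>R\<in>\<rat>. \<forall>r\<in>\<rat>. (LBINT y:{R..r}. E x y $ i $ j) = 0"
    using AE_zero by (auto simp: AE_all_countable AE_ball_countable countable_rat)
  then have AE_E: "AE x in lborel. \<forall>i j. E x y $ i $ j = 0"
  proof eventually_elim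
    case (elim x)
    show ?case
    proof (intro allI)
      fix i j
      obtain R where R: "R \<in> \<rat>" "R < y" using Rats_dense_in_real[of "y - 1" y] by auto
      show "E x y $ i $ j = 0"
      proof (rule continuous_integrals_zero[OF _ _ R(2)])
        show "continuous_on UNIV (\<lambda>y. E x y $ i $ j)"
          using continuous_on_compose2[OF E_cont, of UNIV "\<lambda>y. (x, y)"] by (simp add: continuous_on_Pair)
      qed (use elim R in auto)
    qed
  qed
  have "E x y $ i $ j = 0" for i j
  proof (rule ccontr)
    assume ne: "E x y $ i $ j \<noteq> 0"
    have "open {x'. E x' y $ i $ j \<noteq> 0}"
    proof -
      have "continuous_on UNIV (\<lambda>x'. E x' y $ i $ j)"
        using continuous_on_compose2[OF E_cont, of UNIV "\<lambda>x'. (x', y)"] by (simp add: continuous_on_Pair)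
      then show ?thesis
        using open_Collect_neq[OF _ continuous_on_const] by blast
    qed
    then obtain d where d: "d > 0" "ball x d \<subseteq> {x'. E x' y $ i $ j \<noteq> 0}"
      using ne by (auto simp: open_contains_ball)
    have "AE x' in lborel. x' \<notin> {x'. E x' y $ i $ j \<noteq> 0}"
      using AE_E by eventually_elim simp
    then have "AE x' in lborel. x' \<notin> ball x d"
      using d(2) by (auto elim!: eventually_mono)
    then have "emeasure lborel (ball x d) = 0"
      by (subst (asm) AE_iff_measurable[of "ball x d"]) auto
    moreover have "emeasure lborel (ball x d) = ennreal (2 * d)"
      using d(1) by (simp add: ball_eq_greaterThanLessThan)
    ultimately show False using d(1) by simp
  qed
  then show ?thesis by (simp add: E_def vec_eq_iff)
qed

lemma green_diff_eq:
  assumes "inverse_kernel \<kappa> q G" "inverse_kernel \<kappa> (\<lambda>_. 0) G\<^sub>0"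
    "continuous_on UNIV (\<lambda>(x, y). G x y - G\<^sub>0 x y)"
  shows "green_diff \<kappa> q = (\<lambda>x y. G x y - G\<^sub>0 x y)"
  unfolding green_diff_def
proof (rule the_equality)
  show "continuous_on UNIV (\<lambda>(x, y). G x y - G\<^sub>0 x y) \<and>
    (\<exists>G' G\<^sub>0'. inverse_kernel \<kappa> q G' \<and> inverse_kernel \<kappa> (\<lambda>_. 0) G\<^sub>0' \<and>
      (\<forall>x y. G x y - G\<^sub>0 x y = G' x y - G\<^sub>0' x y))"
    using assms by blast
next
  fix D assume "continuous_on UNIV (\<lambda>(x, y). D x y) \<and>
     (\<exists>G G\<^sub>0. inverse_kernel \<kappa> q G \<and> inverse_kernel \<kappa> (\<lambda>_. 0) G\<^sub>0 \<and> (\<forall>x y. D x y = G x y - G\<^sub>0 x y))"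
  then obtain G' G\<^sub>0' where *: "inverse_kernel \<kappa> q G'" "inverse_kernel \<kappa> (\<lambda>_. 0) G\<^sub>0'"
    "D = (\<lambda>x y. G' x y - G\<^sub>0' x y)" "continuous_on UNIV (\<lambda>(x, y). D x y)" by blast
  then show "D = (\<lambda>x y. G x y - G\<^sub>0 x y)"
    using inverse_kernel_continuous_difference[OF *(1) assms(1) *(2) assms(2)] assms(3) by auto
qed

text \<open>Both Green's functions jump by the identity matrix across the diagonal, so their difference is
  continuous.\<close>

lemma weyl_pairs_green_diff:
  assumes w: "weyl_pair \<kappa> q k B P Q \<alpha> \<beta>" and w0: "weyl_pair \<kappa> (\<lambda>_. 0) k0 B0 P0 Q0 \<alpha>0 \<beta>0"
  shows "green_diff \<kappa> q x x $ i $ j = P i x * \<alpha> j x - P0 i x * \<alpha>0 j x"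
proof -
  interpret W: weyl_pair \<kappa> q k B P Q \<alpha> \<beta> by (rule w)
  interpret W0: weyl_pair \<kappa> "\<lambda>_. 0" k0 B0 P0 Q0 \<alpha>0 \<beta>0 by (rule w0)
  have jump: "- (Q i x * \<beta> j x) - - (Q0 i x * \<beta>0 j x) = P i x * \<alpha> j x - P0 i x * \<alpha>0 j x" for i j x
    using W.unit[of i x j] W0.unit[of i x j] by (simp add: algebra_simps)
  have "continuous_on UNIV (\<lambda>z. (if snd z \<le> fst z
      then P i (fst z) * \<alpha> j (snd z) - P0 i (fst z) * \<alpha>0 j (snd z)
      else - (Q i (fst z) * \<beta> j (snd z)) - - (Q0 i (fst z) * \<beta>0 j (snd z))))" for i j
  proof -
    have "continuous_on UNIV (\<lambda>z. (if snd z - fst z \<le> (0 :: real)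
      then P i (fst z) * \<alpha> j (snd z) - P0 i (fst z) * \<alpha>0 j (snd z)
      else - (Q i (fst z) * \<beta> j (snd z)) - - (Q0 i (fst z) * \<beta>0 j (snd z))))"
    proof (rule continuous_on_cases_le)
      have c: "continuous_on S (\<lambda>z. f (fst z))" "continuous_on S (\<lambda>z. f (snd z))"
        if "continuous_on UNIV f" for f :: "real \<Rightarrow> complex" and S :: "(real \<times> real) set"
        by (auto intro!: continuous_on_compose2[OF that] continuous_intros)
      show "continuous_on {z \<in> UNIV. snd z - fst z \<le> (0 :: real)}
          (\<lambda>z. P i (fst z) * \<alpha> j (snd z) - P0 i (fst z) * \<alpha>0 j (snd z))"
        by (intro continuous_intros c W.continuous_solutions W0.continuous_solutions)
      show "continuous_on {z \<in> UNIV. 0 \<le> snd z - (fst z :: real)}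
          (\<lambda>z. - (Q i (fst z) * \<beta> j (snd z)) - - (Q0 i (fst z) * \<beta>0 j (snd z)))"
        by (intro continuous_intros c W.continuous_solutions W0.continuous_solutions)
    qed (use jump in \<open>auto intro!: continuous_intros\<close>)
    then show ?thesis by (simp only: diff_le_0_iff_le)
  qed
  moreover have "(W.green (fst z) (snd z) - W0.green (fst z) (snd z)) $ i $ j = (if snd z \<le> fst z
      then P i (fst z) * \<alpha> j (snd z) - P0 i (fst z) * \<alpha>0 j (snd z)
      else - (Q i (fst z) * \<beta> j (snd z)) - - (Q0 i (fst z) * \<beta>0 j (snd z)))" for z i j
    using jump by (auto simp: W.green_def W0.green_def)
  ultimately have "continuous_on UNIV (\<lambda>z. (W.green (fst z) (snd z) - W0.green (fst z) (snd z)) $ i $ j)" for i j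
    by simp
  then have "continuous_on UNIV (\<lambda>z. \<chi> i j. (W.green (fst z) (snd z) - W0.green (fst z) (snd z)) $ i $ j)"
    by (intro continuous_on_vec_lambda)
  then have cont: "continuous_on UNIV (\<lambda>(x, y). W.green x y - W0.green x y)"
    by (simp only: case_prod_beta' vec_lambda_eta)
  show ?thesis
    unfolding green_diff_eq[OF W.inverse_kernel_green W0.inverse_kernel_green cont]
    using jump by (simp add: W.green_def W0.green_def)
qed

text \<open>The scalar factors \<open>u\<close> and \<open>v\<close> enter the diagonal values only through \<open>u v = 1 / (1 - a b)\<close>.
  The free operator corresponds to \<open>a = b = 0\<close>, and the factor \<open>sgn (\<i> \<kappa>\<^sup>2)\<close> compensates the
  exchange of roles for \<open>c < 0\<close>.\<close>

theorem diagonal_green: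
  assumes q: "q \<in> schwartz" and c: "\<i> * \<kappa>\<^sup>2 = of_real c" "c \<noteq> 0"
    and ab: "riccati_pair c (\<lambda>x. \<kappa> * q x) (\<lambda>x. \<kappa> * conj_pot q x) a b"
  shows "gam \<kappa> q x = 2 * (a x * b x) / (1 - a x * b x)"
    and "g12 \<kappa> q x = - b x / (1 - a x * b x)"
    and "g21 \<kappa> q x = a x / (1 - a x * b x)"
proof -
  have nz: "1 - a x * b x \<noteq> 0"
    using ab one_minus_product(2) by (auto simp: riccati_pair_def)
  obtain B and P Q \<alpha> \<beta> :: "2 \<Rightarrow> real \<Rightarrow> complex" where w:
    "c > 0 \<Longrightarrow> weyl_pair \<kappa> q c B P Q \<alpha> \<beta>" "c < 0 \<Longrightarrow> weyl_pair \<kappa> q (- c) B Q P \<beta> \<alpha>"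
    and unit: "\<And>i j x. P i x * \<alpha> j x + Q i x * \<beta> j x = (if i = j then 1 else 0)"
    and P: "\<And>x. P 1 x * \<alpha> 1 x = 1 / (1 - a x * b x)" "\<And>x. P 1 x * \<alpha> 2 x = - b x / (1 - a x * b x)"
    "\<And>x. P 2 x * \<alpha> 1 x = a x / (1 - a x * b x)" "\<And>x. P 2 x * \<alpha> 2 x = - (a x * b x) / (1 - a x * b x)"
    using weyl_pair_exists[OF assms] by metis
  have "riccati_pair c (\<lambda>x. \<kappa> * 0) (\<lambda>x. \<kappa> * conj_pot (\<lambda>_. 0) x) (\<lambda>_. 0) (\<lambda>_. 0)"
    by (simp add: riccati_pair_def conj_pot_def)
  from weyl_pair_exists[OF schwartz_zero c this]
  obtain B0 and P0 Q0 \<alpha>0 \<beta>0 :: "2 \<Rightarrow> real \<Rightarrow> complex" where w0: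
    "c > 0 \<Longrightarrow> weyl_pair \<kappa> (\<lambda>_. 0) c B0 P0 Q0 \<alpha>0 \<beta>0"
    "c < 0 \<Longrightarrow> weyl_pair \<kappa> (\<lambda>_. 0) (- c) B0 Q0 P0 \<beta>0 \<alpha>0"
    and unit0: "\<And>i j x. P0 i x * \<alpha>0 j x + Q0 i x * \<beta>0 j x = (if i = j then 1 else 0)"
    and P0: "\<And>x. P0 1 x * \<alpha>0 1 x = 1" "\<And>x. P0 1 x * \<alpha>0 2 x = 0"
    "\<And>x. P0 2 x * \<alpha>0 1 x = 0" "\<And>x. P0 2 x * \<alpha>0 2 x = 0"
    by (metis (no_types, lifting) diff_zero div_by_1 minus_zero mult_zero_left)
  have D: "sgn (of_real c) * green_diff \<kappa> q x x $ i $ j = P i x * \<alpha> j x - P0 i x * \<alpha>0 j x" for i j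
  proof (cases "c > 0")
    case True
    then show ?thesis using weyl_pairs_green_diff[OF w(1) w0(1)] by (simp add: sgn_of_real)
  next
    case False
    then have "c < 0" using c(2) by simp
    then have "green_diff \<kappa> q x x $ i $ j = Q i x * \<beta> j x - Q0 i x * \<beta>0 j x"
      using weyl_pairs_green_diff[OF w(2) w0(2)] by simp
    moreover have "P i x * \<alpha> j x + Q i x * \<beta> j x = P0 i x * \<alpha>0 j x + Q0 i x * \<beta>0 j x"
      by (simp only: unit unit0)
    then have "P i x * \<alpha> j x = P0 i x * \<alpha>0 j x + Q0 i x * \<beta>0 j x - Q i x * \<beta> j x"
      by (simp add: eq_diff_eq)
    ultimately show ?thesis using \<open>c < 0\<close> by (simp add: sgn_of_real)
  qed
  show "gam \<kappa> q x = 2 * (a x * b x) / (1 - a x * b x)"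
    unfolding gam_def c right_diff_distrib D P P0 using nz by (simp add: divide_simps)
  show "g12 \<kappa> q x = - b x / (1 - a x * b x)" "g21 \<kappa> q x = a x / (1 - a x * b x)"
    unfolding g12_def g21_def c D P P0 by simp_all
qed

section \<open>Differentiation in time\<close>

lemma has_vector_derivative_quotient:
  fixes f :: "real \<Rightarrow> 'a::real_normed_algebra_1"
  assumes "\<And>\<epsilon>. \<epsilon> > 0 \<Longrightarrow> \<forall>\<^sub>F \<tau> in at t within I. norm (f \<tau> - f t - of_real (\<tau> - t) * D) \<le> \<epsilon> * \<bar>\<tau> - t\<bar>"
  shows "(f has_vector_derivative D) (at t within I)"
  unfolding has_vector_derivative_def has_derivative_within_alt2
  by (intro conjI allI impI bounded_linear_scaleR_left)
    (use assms in \<open>simp add: scaleR_conv_of_real\<close>)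

text \<open>The weight \<open>1 + x\<^sup>2\<close> makes the remainder integrable in \<open>x\<close>, as needed for differentiating the
  mass under the integral sign.\<close>

definition uniform_derivative ::
  "real set \<Rightarrow> (real \<Rightarrow> real \<Rightarrow> complex) \<Rightarrow> real \<Rightarrow> (real \<Rightarrow> complex) \<Rightarrow> bool" where
  "uniform_derivative I q t d \<longleftrightarrow> (\<forall>\<epsilon>>0. \<forall>\<^sub>F \<tau> in at t within I.
     \<forall>x. (1 + x\<^sup>2) * norm (q \<tau> x - q t x - of_real (\<tau> - t) * d x) \<le> \<epsilon> * \<bar>\<tau> - t\<bar>)"

lemma uniform_derivative_weightless:
  assumes "uniform_derivative I q t d" "\<epsilon> > 0"
  shows "\<forall>\<^sub>F \<tau> in at t within I. \<forall>x. norm (q \<tau> x - q t x - of_real (\<tau> - t) * d x) \<le> \<epsilon> * \<bar>\<tau> - t\<bar>"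
proof -
  have "\<forall>\<^sub>F \<tau> in at t within I.
     \<forall>x. (1 + x\<^sup>2) * norm (q \<tau> x - q t x - of_real (\<tau> - t) * d x) \<le> \<epsilon> * \<bar>\<tau> - t\<bar>"
    using assms by (simp add: uniform_derivative_def)
  then show ?thesis
  proof eventually_elim
    case (elim \<tau>)
    have "1 * norm (q \<tau> x - q t x - of_real (\<tau> - t) * d x)
        \<le> (1 + x\<^sup>2) * norm (q \<tau> x - q t x - of_real (\<tau> - t) * d x)" for x
      by (intro mult_right_mono) auto
    then show ?case using elim by (auto intro: order_trans)
  qed
qed

lemma uniform_derivative_pointwise:
  assumes "uniform_derivative I q t d"
  shows "((\<lambda>\<tau>. q \<tau> x) has_vector_derivative d x) (at t within I)"
  by (rule has_vector_derivative_quotient, rule eventually_mono[OF uniform_derivative_weightless[OF assms]])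
    auto

lemma uniform_derivative_scale:
  assumes "uniform_derivative I q t d"
  shows "uniform_derivative I (\<lambda>\<tau> x. k * q \<tau> x) t (\<lambda>x. k * d x)"
  unfolding uniform_derivative_def
proof (intro allI impI)
  fix \<epsilon> :: real assume "\<epsilon> > 0"
  define \<eta> where "\<eta> = \<epsilon> / (norm k + 1)"
  have "\<eta> > 0" using \<open>\<epsilon> > 0\<close> by (simp add: \<eta>_def add_nonneg_pos)
  then have "\<forall>\<^sub>F \<tau> in at t within I.
     \<forall>x. (1 + x\<^sup>2) * norm (q \<tau> x - q t x - of_real (\<tau> - t) * d x) \<le> \<eta> * \<bar>\<tau> - t\<bar>"
    using assms by (simp add: uniform_derivative_def)
  then show "\<forall>\<^sub>F \<tau> in at t within I.
     \<forall>x. (1 + x\<^sup>2) * norm (k * q \<tau> x - k * q t x - of_real (\<tau> - t) * (k * d x)) \<le> \<epsilon> * \<bar>\<tau> - t\<bar>"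
  proof eventually_elim
    case (elim \<tau>)
    show ?case
    proof
    fix x
    have "k * q \<tau> x - k * q t x - of_real (\<tau> - t) * (k * d x) = k * (q \<tau> x - q t x - of_real (\<tau> - t) * d x)"
      by (simp add: algebra_simps)
    then have "(1 + x\<^sup>2) * norm (k * q \<tau> x - k * q t x - of_real (\<tau> - t) * (k * d x))
        = norm k * ((1 + x\<^sup>2) * norm (q \<tau> x - q t x - of_real (\<tau> - t) * d x))"
      by (simp only: norm_mult mult_ac)
    also have "\<dots> \<le> (norm k + 1) * (\<eta> * \<bar>\<tau> - t\<bar>)"
      by (rule mult_mono[OF _ elim[rule_format]]) auto
    also have "\<dots> = \<epsilon> * \<bar>\<tau> - t\<bar>"
      using add_nonneg_pos[of "norm k" 1] by (simp add: \<eta>_def)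
    finally show "(1 + x\<^sup>2) * norm (k * q \<tau> x - k * q t x - of_real (\<tau> - t) * (k * d x)) \<le> \<epsilon> * \<bar>\<tau> - t\<bar>" .
    qed
  qed
qed

lemma uniform_derivative_conj_pot:
  assumes "uniform_derivative I q t d"
  shows "uniform_derivative I (\<lambda>\<tau>. conj_pot (q \<tau>)) t (conj_pot d)"
proof -
  have "norm (conj_pot (q \<tau>) x - conj_pot (q t) x - of_real (\<tau> - t) * conj_pot d x)
      = norm (q \<tau> x - q t x - of_real (\<tau> - t) * d x)" for \<tau> x
  proof -
    have "conj_pot (q \<tau>) x - conj_pot (q t) x - of_real (\<tau> - t) * conj_pot d x
      = - cnj (q \<tau> x - q t x - of_real (\<tau> - t) * d x)"
      by (simp add: conj_pot_def)
    then show ?thesis by (simp only: norm_minus_cancel complex_mod_cnj)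
  qed
  then show ?thesis using assms unfolding uniform_derivative_def by simp
qed

lemma C1_schwartz_uniform_derivative:
  assumes "C1_schwartz I q"
  obtains d where "\<And>t. t \<in> I \<Longrightarrow> d t \<in> schwartz" "\<And>t. t \<in> I \<Longrightarrow> uniform_derivative I q t (d t)"
proof -
  from assms obtain d where q: "\<And>t. t \<in> I \<Longrightarrow> q t \<in> schwartz" and d: "\<And>t. t \<in> I \<Longrightarrow> d t \<in> schwartz"
    and lim: "\<And>t m n. t \<in> I \<Longrightarrow> ((\<lambda>\<tau>. schwartz_seminorm m n
            (\<lambda>x. (q \<tau> x - q t x) / of_real (\<tau> - t) - d t x)) \<longlongrightarrow> 0) (at t within I)"
  proof -
    have "\<forall>t\<in>I. q t \<in> schwartz" using assms unfolding C1_schwartz_def by (rule conjunct1)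
    moreover obtain d where "\<forall>t\<in>I. d t \<in> schwartz \<and> (\<forall>m n.
        ((\<lambda>\<tau>. schwartz_seminorm m n
            (\<lambda>x. (q \<tau> x - q t x) / of_real (\<tau> - t) - d t x)) \<longlongrightarrow> 0) (at t within I) \<and>
        ((\<lambda>\<tau>. schwartz_seminorm m n (\<lambda>x. d \<tau> x - d t x)) \<longlongrightarrow> 0) (at t within I))"
      using assms unfolding C1_schwartz_def by (elim conjE exE)
    ultimately show thesis using that[of d] by simp
  qed
  have "uniform_derivative I q t (d t)" if t: "t \<in> I" for t
    unfolding uniform_derivative_def
  proof (intro allI impI)
    fix \<epsilon> :: real assume "\<epsilon> > 0"
    let ?g = "\<lambda>\<tau> x. (q \<tau> x - q t x) / of_real (\<tau> - t) - d t x"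
    have ev: "\<forall>\<^sub>F \<tau> in at t within I. schwartz_seminorm m 0 (?g \<tau>) < \<epsilon> / 2" for m
      using order_tendstoD(2)[OF lim[OF t], of "\<epsilon> / 2"] \<open>\<epsilon> > 0\<close> by simp
    have "\<forall>\<^sub>F \<tau> in at t within I. \<tau> \<in> I \<and> \<tau> \<noteq> t"
      by (auto simp: eventually_at_filter)
    then show "\<forall>\<^sub>F \<tau> in at t within I.
      \<forall>x. (1 + x\<^sup>2) * norm (q \<tau> x - q t x - of_real (\<tau> - t) * d t x) \<le> \<epsilon> * \<bar>\<tau> - t\<bar>"
      using ev[of 0] ev[of 2]
    proof eventually_elim
      case (elim \<tau>)
      show ?case
      proof
      fix x
      have "?g \<tau> \<in> schwartz"
      proof -
        have "(\<lambda>x. (1 / of_real (\<tau> - t)) * (q \<tau> x - q t x) - d t x) \<in> schwartz"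
          using elim t by (intro schwartz_diff schwartz_scale q d) auto
        then show ?thesis by simp
      qed
      from schwartz_seminorm_bound[OF this, of x 0 0] schwartz_seminorm_bound[OF this, of x 2 0]
      have "(1 + x\<^sup>2) * norm (?g \<tau> x) \<le> \<epsilon>"
        using elim by (simp add: distrib_right)
      then have "\<bar>\<tau> - t\<bar> * ((1 + x\<^sup>2) * norm (?g \<tau> x)) \<le> \<bar>\<tau> - t\<bar> * \<epsilon>"
        by (intro mult_left_mono) auto
      moreover have "norm (q \<tau> x - q t x - of_real (\<tau> - t) * d t x) = \<bar>\<tau> - t\<bar> * norm (?g \<tau> x)"
      proof -
        have "complex_of_real (\<tau> - t) \<noteq> 0" using elim by (simp del: of_real_diff)
        moreover have "A - w * D = w * (A / w - D)" if "w \<noteq> 0" for A w D :: complex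
          using that by (simp add: right_diff_distrib)
        ultimately have "q \<tau> x - q t x - of_real (\<tau> - t) * d t x = of_real (\<tau> - t) * ?g \<tau> x"
          by blast
        then show ?thesis by (simp only: norm_mult norm_of_real)
      qed
      ultimately show "(1 + x\<^sup>2) * norm (q \<tau> x - q t x - of_real (\<tau> - t) * d t x) \<le> \<epsilon> * \<bar>\<tau> - t\<bar>"
        by (simp add: mult_ac)
      qed
    qed
  qed
  then show thesis using that d by blast
qed

lemma integral_dx_zero:
  assumes "f \<in> schwartz"
  shows "(LBINT x. dx f x) = 0"
proof -
  have si: "set_integrable lborel A (dx f)" if "A \<in> sets borel" for A
    using that schwartz_integrable[OF schwartz_dx[OF assms]]
    unfolding set_integrable_def by (intro integrable_mult_indicator) auto
  obtain C where C: "\<And>x. norm (f x) \<le> C * inverse (1 + x\<^sup>2)"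
    using rapid_decay[OF schwartz_rapid[OF assms]] by metis
  have "((\<lambda>x. C * inverse (1 + x\<^sup>2)) \<longlongrightarrow> 0) at_top" "((\<lambda>x. C * inverse (1 + x\<^sup>2)) \<longlongrightarrow> 0) at_bot"
    by real_asymp+
  then have lim: "(f \<longlongrightarrow> 0) at_top" "(f \<longlongrightarrow> 0) at_bot"
    by (auto intro: Lim_null_comparison[OF always_eventually[OF allI[OF C]]])
  have "(LBINT x:{..0}. dx f x) = f 0" "(LBINT x:{0..}. dx f x) = - f 0"
    using assms by (auto intro!: head_integral_FTC tail_integral_FTC lim si schwartz_has_dx
        schwartz_continuous schwartz_dx)
  moreover have "(LBINT x:{..0} \<union> {0..}. dx f x)
      = (LBINT x:{..0}. dx f x) + (LBINT x:{0..}. dx f x)"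
  proof (rule set_integral_Un_AE)
    show "AE z in lborel. \<not> (z \<in> {..0} \<and> z \<in> {0 :: real..})"
      by (rule AE_mp[OF AE_lborel_singleton[of 0]]) auto
  qed (use si in auto)
  moreover have "{..0} \<union> {0 :: real..} = UNIV" by auto
  ultimately show ?thesis by (simp add: set_lebesgue_integral_def)
qed

text \<open>With \<open>\<Delta> = q \<tau> - q t\<close> one has \<open>\<bar>q \<tau>\<bar>\<^sup>2 - \<bar>q t\<bar>\<^sup>2 = 2 Re (cnj (q t) \<Delta>) + \<bar>\<Delta>\<bar>\<^sup>2\<close>; the remainder
  of the first term is small and the second is quadratic in \<open>\<tau> - t\<close>, both after division by an
  integrable weight.\<close>

lemma mass_derivative:
  assumes q: "\<And>\<tau>. \<tau> \<in> I \<Longrightarrow> q \<tau> \<in> schwartz" and t: "t \<in> I" and d: "d \<in> schwartz"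
    and deriv: "uniform_derivative I q t d"
  shows "((\<lambda>\<tau>. LBINT x. (norm (q \<tau> x))\<^sup>2) has_vector_derivative
    (LBINT x. 2 * Re (cnj (q t x) * d x))) (at t within I)"
proof (rule has_vector_derivative_quotient)
  fix \<epsilon> :: real assume \<epsilon>: "\<epsilon> > 0"
  let ?w = "\<lambda>x::real. inverse (1 + x\<^sup>2)"
  define m where "m = (LBINT x. ?w x)"
  have w_int: "integrable lborel ?w" by (rule integrable_inverse_1_plus_square_lborel)
  have m0: "m \<ge> 0" unfolding m_def by (rule Bochner_Integration.integral_nonneg) auto
  obtain K where K: "K > 0" "\<And>x. norm (q t x) \<le> K * ?w x" using rapid_decay[OF schwartz_rapid[OF q[OF t]]] by metis
  obtain K' where K': "K' > 0" "\<And>x. norm (d x) \<le> K' * ?w x" using rapid_decay[OF schwartz_rapid[OF d]] by metis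
  \<comment> \<open>\<open>\<eta>\<close> and \<open>r\<close> make the linear and the quadratic error contribute \<open>\<epsilon> / 2\<close> each\<close>
  define \<eta> where "\<eta> = min 1 (\<epsilon> / (2 * (2 * K + 1) * (m + 1)))"
  have den: "2 * (2 * K + 1) * (m + 1) > 0" using K(1) m0 by (intro mult_pos_pos) auto
  have \<eta>: "\<eta> > 0" "\<eta> \<le> 1" using \<epsilon> den by (auto simp: \<eta>_def)
  have \<eta>2: "2 * K * \<eta> * m \<le> \<epsilon> / 2"
  proof -
    have "2 * K * \<eta> * m \<le> ((2 * K + 1) * (m + 1)) * \<eta>"
      using K(1) m0 \<eta> mult_mono[of "2 * K" "2 * K + 1" m "m + 1"] by (simp add: mult_ac mult_right_mono)
    also have "\<dots> \<le> ((2 * K + 1) * (m + 1)) * (\<epsilon> / (2 * (2 * K + 1) * (m + 1)))"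
      using K(1) m0 by (intro mult_left_mono) (auto simp: \<eta>_def)
    also have "\<dots> = \<epsilon> / 2" using den by (simp add: field_simps)
    finally show ?thesis .
  qed
  define r where "r = \<epsilon> / (2 * ((K' + 1)\<^sup>2 * (m + 1)))"
  have rm: "r * ((K' + 1)\<^sup>2 * (m + 1)) = \<epsilon> / 2"
  proof -
    have pos: "(K' + 1)\<^sup>2 * (m + 1) > 0" using K'(1) m0 by (intro mult_pos_pos) auto
    have "\<epsilon> / (2 * z) * z = \<epsilon> / 2" if "z > 0" for z :: real using that by simp
    from this[OF pos] show ?thesis unfolding r_def .
  qed
  have r: "r > 0" using \<epsilon> K'(1) m0 unfolding r_def by (intro divide_pos_pos mult_pos_pos) auto
  have "\<forall>\<^sub>F \<tau> in at t within I. \<tau> \<in> I \<and> \<bar>\<tau> - t\<bar> < r"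
    using r by (auto simp: eventually_at dist_real_def intro!: exI[of _ r])
  moreover have "\<forall>\<^sub>F \<tau> in at t within I.
     \<forall>x. (1 + x\<^sup>2) * norm (q \<tau> x - q t x - of_real (\<tau> - t) * d x) \<le> \<eta> * \<bar>\<tau> - t\<bar>"
    using deriv \<eta> by (simp add: uniform_derivative_def)
  ultimately show "\<forall>\<^sub>F \<tau> in at t within I. norm ((LBINT x. (norm (q \<tau> x))\<^sup>2) - (LBINT x. (norm (q t x))\<^sup>2)
      - of_real (\<tau> - t) * (LBINT x. 2 * Re (cnj (q t x) * d x))) \<le> \<epsilon> * \<bar>\<tau> - t\<bar>"
  proof eventually_elim
    case (elim \<tau>)
    define h where "h = \<tau> - t"
    let ?E = "\<lambda>x. (norm (q \<tau> x))\<^sup>2 - (norm (q t x))\<^sup>2 - h * (2 * Re (cnj (q t x) * d x))"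
    have E_le: "norm (?E x) \<le> (\<bar>h\<bar> * (2 * K * \<eta> + \<bar>h\<bar> * (K' + 1)\<^sup>2)) * ?w x" for x
    proof -
      define \<rho> where "\<rho> = q \<tau> x - q t x - of_real h * d x"
      define \<Delta> where "\<Delta> = q \<tau> x - q t x"
      have w: "0 < ?w x" "?w x \<le> 1"
        by (auto simp: add_pos_nonneg inverse_le_1_iff)
      have \<rho>: "norm \<rho> \<le> \<eta> * \<bar>h\<bar> * ?w x"
        using elim by (simp add: \<rho>_def h_def divide_inverse[symmetric] pos_le_divide_eq add_pos_nonneg mult.commute)
      have "\<Delta> = \<rho> + of_real h * d x" by (simp add: \<rho>_def \<Delta>_def)
      then have "norm \<Delta> \<le> norm \<rho> + \<bar>h\<bar> * norm (d x)"
        using norm_triangle_ineq[of \<rho> "of_real h * d x"] by (simp add: norm_mult)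
      also have "\<dots> \<le> 1 * \<bar>h\<bar> * ?w x + \<bar>h\<bar> * (K' * ?w x)"
        using \<eta> w K'(2)[of x] by (intro add_mono order_trans[OF \<rho>] mult_right_mono mult_left_mono) auto
      finally have \<Delta>: "norm \<Delta> \<le> \<bar>h\<bar> * (K' + 1) * ?w x" by (simp add: algebra_simps)
      have E_eq: "?E x = 2 * Re (cnj (q t x) * \<rho>) + (norm \<Delta>)\<^sup>2"
        unfolding \<rho>_def \<Delta>_def cmod_power2 by (simp add: power2_eq_square algebra_simps)
      have re_le: "\<bar>Re (cnj (q t x) * \<rho>)\<bar> \<le> norm (q t x) * norm \<rho>"
        using abs_Re_le_cmod[of "cnj (q t x) * \<rho>"] by (simp only: norm_mult complex_mod_cnj)
      have abs_le: "\<bar>2 * a + b\<bar> \<le> 2 * c + d" if "\<bar>a\<bar> \<le> c" "b \<ge> 0" "b \<le> d" for a b c d :: real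
        using that by linarith
      have "K * ?w x \<le> K * 1" using K(1) w by (intro mult_left_mono) auto
      then have "norm (q t x) \<le> K" using K(2)[of x] by linarith
      then have "norm (q t x) * norm \<rho> \<le> K * (\<eta> * \<bar>h\<bar> * ?w x)"
        by (rule mult_mono[OF _ \<rho>]) (use K(1) in auto)
      with re_le have 1: "\<bar>Re (cnj (q t x) * \<rho>)\<bar> \<le> K * (\<eta> * \<bar>h\<bar> * ?w x)"
        by (rule order_trans)
      have w2: "(?w x)\<^sup>2 \<le> ?w x"
        unfolding power2_eq_square[of "?w x"] by (rule mult_left_le) (use w in linarith)+
      have "(norm \<Delta>)\<^sup>2 \<le> (\<bar>h\<bar> * (K' + 1) * ?w x)\<^sup>2"
        by (rule power_mono[OF \<Delta> norm_ge_zero])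
      also have "\<dots> \<le> (\<bar>h\<bar> * (K' + 1))\<^sup>2 * ?w x"
        unfolding power_mult_distrib[of _ "?w x"] by (rule mult_left_mono[OF w2 zero_le_power2])
      finally have 2: "(norm \<Delta>)\<^sup>2 \<le> (\<bar>h\<bar> * (K' + 1))\<^sup>2 * ?w x" .
      have "norm (?E x) \<le> 2 * (K * (\<eta> * \<bar>h\<bar> * ?w x)) + (\<bar>h\<bar> * (K' + 1))\<^sup>2 * ?w x"
        unfolding E_eq real_norm_def by (rule abs_le[OF 1 zero_le_power2 2])
      also have "\<dots> = (\<bar>h\<bar> * (2 * K * \<eta> + \<bar>h\<bar> * (K' + 1)\<^sup>2)) * ?w x"
      proof -
        have "2 * (K * (\<eta> * a * b)) + (a * k)\<^sup>2 * b = (a * (2 * K * \<eta> + a * k\<^sup>2)) * b" for a b k :: real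
          by (simp add: power_mult_distrib power2_eq_square[of a] algebra_simps)
        then show ?thesis .
      qed
      finally show ?thesis .
    qed
    have sq: "integrable lborel (\<lambda>x. (norm (q \<tau> x))\<^sup>2)" "integrable lborel (\<lambda>x. (norm (q t x))\<^sup>2)"
      using schwartz_L2[OF q] elim t by (auto simp: L2_def)
    have re: "integrable lborel (\<lambda>x. 2 * Re (cnj (q t x) * d x))"
      by (intro integrable_mult_right integrable_Re schwartz_integrable schwartz_mult schwartz_cnj q t d)
    have split: "(LBINT x. (norm (q \<tau> x))\<^sup>2) - (LBINT x. (norm (q t x))\<^sup>2)
      - of_real (\<tau> - t) * (LBINT x. 2 * Re (cnj (q t x) * d x)) = (LBINT x. ?E x)"
      using sq re by (simp add: h_def)
    have "norm (LBINT x. ?E x) \<le> (LBINT x. (\<bar>h\<bar> * (2 * K * \<eta> + \<bar>h\<bar> * (K' + 1)\<^sup>2)) * ?w x)"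
      by (rule Bochner_Integration.integral_norm_bound_integral[OF _ _ E_le])
        (use sq re w_int in auto)
    moreover have "(LBINT x. (\<bar>h\<bar> * (2 * K * \<eta> + \<bar>h\<bar> * (K' + 1)\<^sup>2)) * ?w x)
        = \<bar>h\<bar> * (2 * K * \<eta> * m + \<bar>h\<bar> * ((K' + 1)\<^sup>2 * m))"
      unfolding m_def integral_mult_right_zero by (simp only: distrib_left distrib_right mult.assoc)
    moreover have "\<bar>h\<bar> * (2 * K * \<eta> * m + \<bar>h\<bar> * ((K' + 1)\<^sup>2 * m)) \<le> \<bar>h\<bar> * \<epsilon>"
    proof (rule mult_left_mono)
      have "\<bar>h\<bar> * ((K' + 1)\<^sup>2 * m) \<le> r * ((K' + 1)\<^sup>2 * (m + 1))"
        using elim m0 r by (intro mult_mono) (auto simp: h_def)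
      then show "2 * K * \<eta> * m + \<bar>h\<bar> * ((K' + 1)\<^sup>2 * m) \<le> \<epsilon>"
        using \<eta>2 rm by linarith
    qed simp
    ultimately have "norm (LBINT x. ?E x) \<le> \<epsilon> * \<bar>h\<bar>"
      by (simp only: mult.commute[of \<epsilon>])
    then show ?case unfolding split by (simp only: h_def)
  qed
qed

text \<open>The difference \<open>D = a \<tau> - a t\<close> solves a linear equation with coefficient
  \<open>2 c - p \<tau> (a \<tau> + a t)\<close>, and so does \<open>e = D - (\<tau> - t) R\<close>.  A first application of
  \<open>linear_estimate\<close> shows that \<open>D\<close> is of order \<open>\<tau> - t\<close>; hence the inhomogeneity in the
  equation for \<open>e\<close> is \<open>o(\<tau> - t)\<close>, and a second application shows that \<open>e\<close> is, too.\<close>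

lemma riccati_time_derivative:
  fixes p s a :: "real \<Rightarrow> real \<Rightarrow> complex" and p' s' R :: "real \<Rightarrow> complex"
  assumes c: "c \<noteq> 0" and t: "t \<in> I"
    and small: "\<And>\<tau>. \<tau> \<in> I \<Longrightarrow> small_potential c (p \<tau>)"
    and cont: "\<And>\<tau>. \<tau> \<in> I \<Longrightarrow> continuous_on UNIV (s \<tau>)"
    and a: "\<And>\<tau> x. \<tau> \<in> I \<Longrightarrow> norm (a \<tau> x) \<le> 1 / 2"
    "\<And>\<tau> x. \<tau> \<in> I \<Longrightarrow> (a \<tau> has_vector_derivative 2 * of_real c * a \<tau> x + s \<tau> x - p \<tau> x * (a \<tau> x)\<^sup>2) (at x)"
    and p': "uniform_derivative I p t p'" "continuous_on UNIV p'" "bounded (range p')"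
    and s': "uniform_derivative I s t s'" "continuous_on UNIV s'" "bounded (range s')"
    and pt: "bounded (range (p t))" and R_bounded: "bounded (range R)"
    and R: "\<And>x. (R has_vector_derivative
      (2 * of_real c - 2 * p t x * a t x) * R x + s' x - p' x * (a t x)\<^sup>2) (at x)"
  shows "((\<lambda>\<tau>. a \<tau> x) has_vector_derivative R x) (at t within I)"
proof (rule has_vector_derivative_quotient)
  fix \<epsilon> :: real assume \<epsilon>: "\<epsilon> > 0"
  obtain K where K: "\<And>x. norm (p' x) \<le> K" "\<And>x. norm (s' x) \<le> K" "\<And>x. norm (p t x) \<le> K" "\<And>x. norm (R x) \<le> K"
  proof -
    have "bounded (range p' \<union> range s' \<union> range (p t) \<union> range R)"
      using p' s' pt R_bounded by simp
    then show thesis using that unfolding bounded_iff by blast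
  qed
  have K0: "K \<ge> 0" using order_trans[OF norm_ge_zero K(1)] .
  have p_cont: "continuous_on UNIV (p \<tau>)" if "\<tau> \<in> I" for \<tau>
    using small[OF that] by (simp add: small_potential_def)
  have a_cont: "continuous_on UNIV (a \<tau>)" if "\<tau> \<in> I" for \<tau>
    using a(2)[OF that] by (blast intro: continuous_at_imp_continuous_on has_vector_derivative_continuous)
  have R_cont: "continuous_on UNIV R"
    using R by (blast intro: continuous_at_imp_continuous_on has_vector_derivative_continuous)
  \<comment> \<open>\<open>L\<close> is a Lipschitz constant for \<open>a\<close> in time, and \<open>M\<close> bounds the quadratic error in \<open>f\<close> below\<close>
  define L where "L = 2 * (K + 1) / \<bar>c\<bar>"
  define M where "M = ((2 * K + 1) * L + (K + 1)) * K"
  have L0: "L \<ge> 0" using K0 by (simp add: L_def)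
  have M0: "M \<ge> 0" using K0 L0 by (simp add: M_def)
  define \<eta> where "\<eta> = min 1 (\<epsilon> * \<bar>c\<bar> / 4)"
  have \<eta>: "\<eta> > 0" "\<eta> \<le> 1" "2 * \<eta> \<le> \<epsilon> * \<bar>c\<bar> / 2" using \<epsilon> c by (auto simp: \<eta>_def)
  define r where "r = min 1 (\<epsilon> * \<bar>c\<bar> / (2 * (M + 1)))"
  have r: "r > 0" "r \<le> 1" using \<epsilon> c M0 by (auto simp: r_def)
  have rM: "r * M \<le> \<epsilon> * \<bar>c\<bar> / 2"
  proof -
    have "r * M \<le> (\<epsilon> * \<bar>c\<bar> / (2 * (M + 1))) * (M + 1)"
      using M0 \<epsilon> by (intro mult_mono) (auto simp: r_def)
    also have "\<dots> = \<epsilon> * \<bar>c\<bar> / 2"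
    proof -
      have *: "y / (2 * z) * z = y / 2" if "z > 0" for y z :: real using that by simp
      show ?thesis by (rule *) (use M0 in simp)
    qed
    finally show ?thesis .
  qed
  have "\<forall>\<^sub>F \<tau> in at t within I. \<tau> \<in> I \<and> \<tau> \<noteq> t \<and> \<bar>\<tau> - t\<bar> < r"
    using r by (auto simp: eventually_at dist_real_def intro!: exI[of _ r])
  then show "\<forall>\<^sub>F \<tau> in at t within I. norm (a \<tau> x - a t x - of_real (\<tau> - t) * R x) \<le> \<epsilon> * \<bar>\<tau> - t\<bar>"
    using uniform_derivative_weightless[OF p'(1) \<eta>(1)] uniform_derivative_weightless[OF s'(1) \<eta>(1)]
  proof eventually_elim
    case (elim \<tau>)
    then have \<tau>: "\<tau> \<in> I" and ne: "\<tau> \<noteq> t" and near: "\<bar>\<tau> - t\<bar> < r" by auto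
    define h where "h = \<tau> - t"
    have h: "\<bar>h\<bar> < r" "\<bar>h\<bar> \<le> 1" using near r by (auto simp: h_def)
    have dp: "norm (p \<tau> y - p t y - of_real h * p' y) \<le> \<eta> * \<bar>h\<bar>"
      and ds: "norm (s \<tau> y - s t y - of_real h * s' y) \<le> \<eta> * \<bar>h\<bar>" for y
      using elim by (auto simp: h_def)
    have lip: "norm z \<le> (K + 1) * \<bar>h\<bar>" if "norm (z - of_real h * w) \<le> \<eta> * \<bar>h\<bar>" "norm w \<le> K" for z w :: complex
    proof -
      have "norm z \<le> norm (z - of_real h * w) + norm (of_real h * w)"
        using norm_triangle_ineq[of "z - of_real h * w" "of_real h * w"] by simp
      also have "\<dots> \<le> 1 * \<bar>h\<bar> + \<bar>h\<bar> * K"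
        unfolding norm_mult norm_of_real
        using \<eta> by (intro add_mono order_trans[OF that(1)] mult_right_mono mult_left_mono that) auto
      finally show ?thesis by (simp add: algebra_simps)
    qed
    have p_lip: "norm (p \<tau> y - p t y) \<le> (K + 1) * \<bar>h\<bar>" and s_lip: "norm (s \<tau> y - s t y) \<le> (K + 1) * \<bar>h\<bar>" for y
      by (rule lip[OF dp K(1)], rule lip[OF ds K(2)])
    have a_sq: "norm ((a t y)\<^sup>2) \<le> 1" for y
      unfolding norm_power using a(1)[OF t, of y] by (intro power_le_one) auto
    define m where "m y = p \<tau> y * (a \<tau> y + a t y)" for y
    have m_cont: "continuous_on UNIV m"
      unfolding m_def by (intro continuous_intros p_cont a_cont \<tau> t)
    have m_le: "norm (m y) \<le> norm (p \<tau> y)" for y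
    proof -
      have "norm (a \<tau> y + a t y) \<le> 1"
        using norm_triangle_ineq[of "a \<tau> y" "a t y"] a(1)[OF \<tau>, of y] a(1)[OF t, of y] by simp
      then show ?thesis unfolding m_def norm_mult by (intro mult_left_le) auto
    qed
    define D where "D y = a \<tau> y - a t y" for y
    have D_bounded: "bounded (range D)"
    proof -
      have "norm (D y) \<le> 1" for y
        using norm_triangle_ineq4[of "a \<tau> y" "a t y"] a(1)[OF \<tau>, of y] a(1)[OF t, of y] by (simp add: D_def)
      then show ?thesis by (auto simp: bounded_iff)
    qed
    have D_deriv: "(D has_vector_derivative (2 * of_real c - m y) * D y
        + ((s \<tau> y - s t y) - (p \<tau> y - p t y) * (a t y)\<^sup>2)) (at y)" for y
    proof -
      have "(D has_vector_derivative (2 * of_real c * a \<tau> y + s \<tau> y - p \<tau> y * (a \<tau> y)\<^sup>2)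
          - (2 * of_real c * a t y + s t y - p t y * (a t y)\<^sup>2)) (at y)"
        unfolding D_def[abs_def] by (intro has_vector_derivative_diff a \<tau> t)
      then show ?thesis by (simp add: D_def m_def power2_eq_square algebra_simps)
    qed
    have D_le: "norm (D y) \<le> L * \<bar>h\<bar>" for y
    proof -
      have "norm (D y) \<le> (2 * (K + 1) * \<bar>h\<bar>) / \<bar>c\<bar>"
      proof (rule linear_estimate[OF c small[OF \<tau>] D_deriv D_bounded m_cont m_le])
        show "continuous_on UNIV (\<lambda>y. (s \<tau> y - s t y) - (p \<tau> y - p t y) * (a t y)\<^sup>2)"
          by (intro continuous_intros p_cont a_cont cont \<tau> t)
        show "norm ((s \<tau> y - s t y) - (p \<tau> y - p t y) * (a t y)\<^sup>2) \<le> 2 * (K + 1) * \<bar>h\<bar>" for y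
        proof -
          have "norm ((p \<tau> y - p t y) * (a t y)\<^sup>2) \<le> norm (p \<tau> y - p t y)"
            unfolding norm_mult by (intro mult_left_le a_sq) auto
          then show ?thesis
            using norm_triangle_ineq4[of "s \<tau> y - s t y" "(p \<tau> y - p t y) * (a t y)\<^sup>2"] p_lip[of y] s_lip[of y]
            by linarith
        qed
      qed
      then show ?thesis by (simp add: L_def)
    qed
    define e where "e y = D y - of_real h * R y" for y
    define f where "f y = (s \<tau> y - s t y - of_real h * s' y) - (p \<tau> y - p t y - of_real h * p' y) * (a t y)\<^sup>2
        - of_real h * ((p \<tau> y * D y + 2 * (p \<tau> y - p t y) * a t y) * R y)" for y
    have f_cont: "continuous_on UNIV f"
      unfolding f_def D_def by (intro continuous_intros p_cont a_cont cont R_cont \<tau> t p' s')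
    have e_deriv: "(e has_vector_derivative (2 * of_real c - m y) * e y + f y) (at y)" for y
    proof -
      have "(e has_vector_derivative ((2 * of_real c - m y) * D y
          + ((s \<tau> y - s t y) - (p \<tau> y - p t y) * (a t y)\<^sup>2))
          - of_real h * ((2 * of_real c - 2 * p t y * a t y) * R y + s' y - p' y * (a t y)\<^sup>2)) (at y)"
        unfolding e_def[abs_def]
        by (intro has_vector_derivative_diff D_deriv has_vector_derivative_mult_right R)
      then show ?thesis by (simp add: e_def f_def m_def D_def power2_eq_square algebra_simps)
    qed
    have e_bounded: "bounded (range e)"
    proof -
      obtain d where "\<And>y. norm (D y) \<le> d" using D_bounded by (auto simp: bounded_iff)
      then have "norm (e y) \<le> d + \<bar>h\<bar> * K" for y
        using norm_triangle_ineq4[of "D y" "of_real h * R y"] mult_left_mono[OF K(4)[of y] abs_ge_zero[of h]]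
        by (simp add: e_def norm_mult) (smt (verit))
      then show ?thesis by (auto simp: bounded_iff)
    qed
    have f_le: "norm (f y) \<le> (2 * \<eta> + r * M) * \<bar>h\<bar>" for y
    proof -
      have 1: "norm ((p \<tau> y - p t y - of_real h * p' y) * (a t y)\<^sup>2) \<le> \<eta> * \<bar>h\<bar>"
        unfolding norm_mult by (rule order_trans[OF mult_left_le[OF a_sq norm_ge_zero] dp])
      have pt_le: "norm (p \<tau> y) \<le> 2 * K + 1"
      proof -
        have "norm (p \<tau> y) \<le> norm (p t y) + norm (p \<tau> y - p t y)"
          using norm_triangle_ineq[of "p t y" "p \<tau> y - p t y"] by simp
        also have "\<dots> \<le> K + (K + 1) * 1"
          using K(3)[of y] p_lip[of y] mult_left_mono[OF h(2), of "K + 1"] K0 by linarith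
        finally show ?thesis by simp
      qed
      have 2: "norm (p \<tau> y * D y) \<le> (2 * K + 1) * (L * \<bar>h\<bar>)"
        unfolding norm_mult using K0 by (intro mult_mono pt_le D_le) auto
      have 3: "norm (2 * (p \<tau> y - p t y) * a t y) \<le> (K + 1) * \<bar>h\<bar>"
      proof -
        have "norm (2 * (p \<tau> y - p t y) * a t y) = norm (p \<tau> y - p t y) * (2 * norm (a t y))"
          unfolding norm_mult norm_numeral by (simp only: mult_ac)
        also have "\<dots> \<le> norm (p \<tau> y - p t y)"
          using a(1)[OF t, of y] by (intro mult_left_le) auto
        finally show ?thesis using p_lip[of y] by linarith
      qed
      have "norm (p \<tau> y * D y + 2 * (p \<tau> y - p t y) * a t y) \<le> ((2 * K + 1) * L + (K + 1)) * \<bar>h\<bar>"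
        using norm_triangle_ineq[of "p \<tau> y * D y" "2 * (p \<tau> y - p t y) * a t y"] 2 3
        by (simp add: algebra_simps)
      then have "norm ((p \<tau> y * D y + 2 * (p \<tau> y - p t y) * a t y) * R y) \<le> (((2 * K + 1) * L + (K + 1)) * \<bar>h\<bar>) * K"
        unfolding norm_mult using K0 L0 by (intro mult_mono K) auto
      also have "\<dots> = \<bar>h\<bar> * M" by (simp add: M_def)
      also have "\<dots> \<le> r * M" using h M0 by (intro mult_right_mono) auto
      finally have "norm (of_real h * ((p \<tau> y * D y + 2 * (p \<tau> y - p t y) * a t y) * R y)) \<le> \<bar>h\<bar> * (r * M)"
        unfolding norm_mult[of "of_real h"] norm_of_real by (intro mult_left_mono) auto
      then have "norm (f y) \<le> \<eta> * \<bar>h\<bar> + \<eta> * \<bar>h\<bar> + \<bar>h\<bar> * (r * M)"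
        unfolding f_def
        by (intro order_trans[OF norm_triangle_ineq4] add_mono ds 1)
      then show ?thesis by (simp add: algebra_simps)
    qed
    have "norm (e x) \<le> ((2 * \<eta> + r * M) * \<bar>h\<bar>) / \<bar>c\<bar>"
      by (rule linear_estimate[OF c small[OF \<tau>] e_deriv e_bounded m_cont m_le f_cont f_le])
    also have "\<dots> \<le> ((\<epsilon> * \<bar>c\<bar>) * \<bar>h\<bar>) / \<bar>c\<bar>"
      using \<eta>(3) rM by (intro divide_right_mono mult_right_mono) auto
    also have "\<dots> = \<epsilon> * \<bar>h\<bar>" using c by simp
    finally show ?case by (simp add: e_def D_def h_def)
  qed
qed

section \<open>Conservation of mass\<close>

text \<open>Expanding the nonlinearity with \<open>r = conj_pot q\<close> gives polynomial evolution equations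
  for the pair \<open>(q, r)\<close>.\<close>

lemma dnls_evolution:
  assumes q: "q \<in> schwartz"
    and eq: "\<And>x. \<i> * d x + dx (dx q) x + \<i> * dx (\<lambda>y. of_real ((cmod (q y))\<^sup>2) * q y) x = 0"
  defines "r \<equiv> conj_pot q"
  shows "d x = \<i> * dx (dx q) x + 2 * q x * dx q x * r x + (q x)\<^sup>2 * dx r x"
    and "conj_pot d x = - \<i> * dx (dx r) x + 2 * r x * dx r x * q x + (r x)\<^sup>2 * dx q x"
proof -
  note r = schwartz_conj_pot[OF q, folded r_def]
  have "(\<lambda>y. of_real ((cmod (q y))\<^sup>2) * q y) = (\<lambda>y. - (q y * q y * r y))"
    unfolding complex_norm_square by (auto simp: r_def conj_pot_def)
  moreover have "((\<lambda>y. - (q y * q y * r y)) has_vector_derivative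
      - (q x * q x * dx r x + (q x * dx q x + dx q x * q x) * r x)) (at x)" for x
    by (intro has_vector_derivative_minus has_vector_derivative_mult schwartz_has_dx q r)
  ultimately have *: "dx (\<lambda>y. of_real ((cmod (q y))\<^sup>2) * q y) x
      = - (q x * q x * dx r x + (q x * dx q x + dx q x * q x) * r x)" for x
    by (simp add: dx_eqI)
  have solve: "D = \<i> * Q2 + 2 * Q * Q1 * R + Q\<^sup>2 * R1"
    if "\<i> * D + Q2 + \<i> * - (Q * Q * R1 + (Q * Q1 + Q1 * Q) * R) = 0" for D Q Q1 Q2 R R1 :: complex
  proof -
    have "\<i> * \<i> = -1" by simp
    then show ?thesis using that by algebra
  qed
  show d: "d x = \<i> * dx (dx q) x + 2 * q x * dx q x * r x + (q x)\<^sup>2 * dx r x" for x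
    by (rule solve) (use eq[of x] * in simp)
  have "dx r x = - cnj (dx q x)" "dx (dx r) x = - cnj (dx (dx q) x)" "r x = - cnj (q x)"
    using r(2) schwartz_conj_pot(2)[OF schwartz_dx[OF q]] by (simp_all add: conj_pot_def r_def)
  then show "conj_pot d x = - \<i> * dx (dx r) x + 2 * r x * dx r x * q x + (r x)\<^sup>2 * dx q x"
    unfolding conj_pot_def d by (simp add: power2_eq_square algebra_simps)
qed

text \<open>The integrand is the derivative of
  \<open>\<i> (q r' - r q') - (3/2) (q r)\<^sup>2\<close>, a Schwartz function.\<close>

lemma dnls_mass_stationary:
  assumes q: "q \<in> schwartz"
    and eq: "\<And>x. \<i> * d x + dx (dx q) x + \<i> * dx (\<lambda>y. of_real ((cmod (q y))\<^sup>2) * q y) x = 0"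
  shows "(LBINT x. 2 * Re (cnj (q x) * d x)) = 0"
proof -
  define r where "r = conj_pot q"
  note r = schwartz_conj_pot[OF q, folded r_def]
  note ev = dnls_evolution[OF q eq, folded r_def]
  define \<Phi> where "\<Phi> x = (\<i> * (q x * dx r x) - \<i> * (r x * dx q x)) - (3/2) * ((q x * r x) * (q x * r x))" for x
  have \<Phi>: "\<Phi> \<in> schwartz"
    unfolding \<Phi>_def by (intro schwartz_diff schwartz_scale schwartz_mult schwartz_dx q r)
  have "dx \<Phi> x = of_real (2 * Re (cnj (q x) * d x))" for x
  proof -
    have "(\<Phi> has_vector_derivative
        (\<i> * (q x * dx (dx r) x + dx q x * dx r x) - \<i> * (r x * dx (dx q) x + dx r x * dx q x))
        - (3/2) * ((q x * r x) * (q x * dx r x + dx q x * r x) + (q x * dx r x + dx q x * r x) * (q x * r x))) (at x)"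
      unfolding \<Phi>_def[abs_def]
      by (intro has_vector_derivative_diff has_vector_derivative_mult_right has_vector_derivative_mult
          schwartz_has_dx schwartz_dx q r)
    then have "dx \<Phi> x = (\<i> * (q x * dx (dx r) x + dx q x * dx r x) - \<i> * (r x * dx (dx q) x + dx r x * dx q x))
        - (3/2) * ((q x * r x) * (q x * dx r x + dx q x * r x) + (q x * dx r x + dx q x * r x) * (q x * r x))"
      by (rule dx_eqI)
    also have "\<dots> = - r x * d x - q x * conj_pot d x"
      unfolding ev by (simp add: power2_eq_square algebra_simps)
    also have "\<dots> = of_real (2 * Re (cnj (q x) * d x))"
      by (simp add: r_def conj_pot_def complex_eq_iff algebra_simps)
    finally show ?thesis .
  qed
  then have "complex_of_real (LBINT x. 2 * Re (cnj (q x) * d x)) = (LBINT x. dx \<Phi> x)"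
    by (simp only: integral_complex_of_real)
  then show ?thesis using integral_dx_zero[OF \<Phi>] by (simp only: of_real_eq_0_iff)
qed

text \<open>One-sided time derivatives at end points of \<open>I\<close> are unique because \<open>I\<close> contains more than one
  point.\<close>

lemma interval_at_within_nontrivial:
  fixes I :: "real set"
  assumes "is_interval I" "t \<in> I" "0 \<in> I" "I \<noteq> {0}"
  shows "at t within I \<noteq> bot"
proof -
  have "t islimpt I"
    by (rule connected_imp_perfect) (use assms in \<open>auto simp: is_interval_connected\<close>)
  then show ?thesis by (simp add: trivial_limit_within)
qed

section \<open>Evolution of the Riccati solutions\<close>

lemma small_potential_of_mass:
  assumes q: "q \<in> schwartz" and c: "\<i> * \<kappa>\<^sup>2 = of_real c" and mass: "L2_norm q \<le> 1 / 2"
  shows "small_potential c (\<lambda>x. \<kappa> * q x)"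
proof -
  have "norm (\<i> * \<kappa>\<^sup>2) = \<bar>c\<bar>" unfolding c by simp
  then have \<kappa>: "(norm \<kappa>)\<^sup>2 = \<bar>c\<bar>" by (simp add: norm_mult norm_power)
  have sq: "integrable lborel (\<lambda>x. (norm (q x))\<^sup>2)" using schwartz_L2[OF q] by (simp add: L2_def)
  have "(LBINT x. (norm (q x))\<^sup>2) = (L2_norm q)\<^sup>2" by (simp add: L2_norm_def)
  also have "\<dots> \<le> (1/2)\<^sup>2" by (rule power_mono[OF mass]) (simp add: L2_norm_def)
  finally have "\<bar>c\<bar> * (LBINT x. (norm (q x))\<^sup>2) \<le> \<bar>c\<bar> * (1/4)"
    by (intro mult_left_mono) (auto simp: power2_eq_square)
  moreover have "continuous_on UNIV (\<lambda>x. \<kappa> * q x)"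
    by (intro continuous_intros schwartz_continuous q)
  ultimately show ?thesis
    using sq by (simp add: small_potential_def norm_mult power_mult_distrib \<kappa>)
qed

lemma L2_norm_conj_pot: "L2_norm (conj_pot q) = L2_norm q"
  by (simp add: L2_norm_def conj_pot_def)

lemma riccati_pair_exists:
  assumes q: "q \<in> schwartz" and c: "\<i> * \<kappa>\<^sup>2 = of_real c" "c \<noteq> 0" and mass: "L2_norm q \<le> 1 / 2"
  shows "\<exists>a b. riccati_pair c (\<lambda>x. \<kappa> * q x) (\<lambda>x. \<kappa> * conj_pot q x) a b"
proof -
  have p: "small_potential c (\<lambda>x. \<kappa> * q x)" by (rule small_potential_of_mass[OF q c(1) mass])
  have s: "small_potential c (\<lambda>x. \<kappa> * conj_pot q x)"
    by (rule small_potential_of_mass[OF _ c(1)]) (use schwartz_conj_pot[OF q] mass in \<open>auto simp: L2_norm_conj_pot\<close>)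
  have flip: "small_potential (- c) f" if "small_potential c f" for f
    using that by (simp add: small_potential_def)
  obtain a where "\<And>x. norm (a x) \<le> 1 / 2"
    "\<And>x. (a has_vector_derivative 2 * of_real c * a x + \<kappa> * conj_pot q x - \<kappa> * q x * (a x)\<^sup>2) (at x)"
    using riccati_solution[OF c(2) p s] by metis
  moreover have "- c \<noteq> 0" using c(2) by simp
  then obtain b where "\<And>x. norm (b x) \<le> 1 / 2"
    "\<And>x. (b has_vector_derivative 2 * of_real (- c) * b x + \<kappa> * q x - \<kappa> * conj_pot q x * (b x)\<^sup>2) (at x)"
    using riccati_solution[OF _ flip[OF s] flip[OF p]] by metis
  ultimately have "riccati_pair c (\<lambda>x. \<kappa> * q x) (\<lambda>x. \<kappa> * conj_pot q x) a b"
    by (simp add: riccati_pair_def)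
  then show ?thesis by blast
qed

text \<open>Since \<open>2 + \<gamma> = 2 / (1 - a b)\<close>, all denominators cancel.\<close>

lemma rho_riccati:
  assumes "q \<in> schwartz" "\<i> * \<kappa>\<^sup>2 = of_real c" "c \<noteq> 0"
    and ab: "riccati_pair c (\<lambda>x. \<kappa> * q x) (\<lambda>x. \<kappa> * conj_pot q x) a b"
  shows "rho \<kappa> q x = - (\<kappa> / 2) * (q x * a x - conj_pot q x * b x)"
    and "j_dnls \<kappa> q x = \<i> * (\<kappa> / 2) * (dx q x * a x + dx (conj_pot q) x * b x)
      - \<i> * \<kappa>\<^sup>2 * (q x * conj_pot q x) - (2 * \<kappa>\<^sup>2 + q x * conj_pot q x) * rho \<kappa> q x"
proof -
  define w where "w = 1 - a x * b x"
  have w: "w \<noteq> 0" using ab one_minus_product(2) by (auto simp: riccati_pair_def w_def)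
  have g: "2 + gam \<kappa> q x = 2 / w" "g12 \<kappa> q x = - b x / w" "g21 \<kappa> q x = a x / w"
    using diagonal_green[OF assms, of x] w by (simp_all add: w_def[symmetric] divide_simps) (simp add: w_def algebra_simps)
  show "rho \<kappa> q x = - (\<kappa> / 2) * (q x * a x - conj_pot q x * b x)"
    unfolding rho_def g using w by (simp add: divide_simps)
  have frac: "(dx q x * g21 \<kappa> q x - dx (conj_pot q) x * g12 \<kappa> q x) / (2 + gam \<kappa> q x)
      = (dx q x * a x + dx (conj_pot q) x * b x) / 2"
    unfolding g using w by (simp add: divide_simps)
  show "j_dnls \<kappa> q x = \<i> * (\<kappa> / 2) * (dx q x * a x + dx (conj_pot q) x * b x)
      - \<i> * \<kappa>\<^sup>2 * (q x * conj_pot q x) - (2 * \<kappa>\<^sup>2 + q x * conj_pot q x) * rho \<kappa> q x"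
    unfolding j_dnls_def frac by (simp add: algebra_simps)
qed

text \<open>The time component of the Lax pair is the trace-free matrix with
  \<open>A = - \<i> \<kappa>\<^sup>2 q r - 2 \<i> \<kappa>\<^sup>4\<close>, \<open>B = \<kappa> (\<i> q' + q\<^sup>2 r + 2 \<kappa>\<^sup>2 q)\<close> and
  \<open>C = \<kappa> (- \<i> r' + r\<^sup>2 q + 2 \<kappa>\<^sup>2 r)\<close>.  For \<open>j = \<i>\<close>, this is \<open>C - 2 A a - B a\<^sup>2\<close>, the rate of change of
  the ratio \<open>a\<close> of the components of a solution.\<close>

definition lax_time :: "complex \<Rightarrow> (real \<Rightarrow> complex) \<Rightarrow> (real \<Rightarrow> complex) \<Rightarrow> complex \<Rightarrow> (real \<Rightarrow> complex)
    \<Rightarrow> real \<Rightarrow> complex" where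
  "lax_time \<kappa> q r j a x =
     \<kappa> * (- (j * dx r x) + r x * r x * q x + 2 * \<kappa>\<^sup>2 * r x)
     + 2 * j * \<kappa>\<^sup>2 * ((q x * r x + 2 * \<kappa>\<^sup>2) * a x)
     - \<kappa> * ((j * dx q x + q x * q x * r x + 2 * \<kappa>\<^sup>2 * q x) * (a x * a x))"

text \<open>The algebra behind \<open>lax_time_deriv\<close>, with \<open>q1\<close>, \<open>q2\<close>, \<open>r1\<close>, \<open>r2\<close> for the first two derivatives
  of \<open>q\<close> and \<open>r\<close>.\<close>

lemma zero_curvature_identity:
  fixes j k q q1 q2 r r1 r2 a a1 :: complex
  assumes j: "j * j = -1" and a1: "a1 = 2 * (j * k\<^sup>2) * a + k * r - k * q * a\<^sup>2"
  shows "k * (- (j * r2) + (r * r * q1 + (r * r1 + r1 * r) * q) + 2 * k\<^sup>2 * r1)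
      + 2 * j * k\<^sup>2 * ((q * r + 2 * k\<^sup>2) * a1 + (q * r1 + q1 * r + 0) * a)
      - k * ((j * q1 + q * q * r + 2 * k\<^sup>2 * q) * (a * a1 + a1 * a)
        + (j * q2 + (q * q * r1 + (q * q1 + q1 * q) * r) + 2 * k\<^sup>2 * q1) * (a * a))
      = (2 * (j * k\<^sup>2) - 2 * (k * q) * a) * (k * (- (j * r1) + r * r * q + 2 * k\<^sup>2 * r)
     + 2 * j * k\<^sup>2 * ((q * r + 2 * k\<^sup>2) * a)
     - k * ((j * q1 + q * q * r + 2 * k\<^sup>2 * q) * (a * a)))
    + k * (- j * r2 + 2 * r * r1 * q + r\<^sup>2 * q1)
    - k * (j * q2 + 2 * q * q1 * r + q\<^sup>2 * r1) * a\<^sup>2"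
proof -
  have jj: "j * (j * x) = - x" for x using j by (simp add: mult.assoc[symmetric])
  show ?thesis unfolding a1 by (simp add: algebra_simps power2_eq_square j jj)
qed

text \<open>The zero curvature condition, read off at the level of the Riccati equation: \<open>lax_time\<close> solves
  the equation obtained by differentiating the Riccati equation in time along the flow.  The
  choice \<open>j = \<i>\<close> serves \<open>a\<close>; exchanging \<open>q\<close> and \<open>r\<close> and taking \<open>j = - \<i>\<close> serves \<open>b\<close>.\<close>

lemma lax_time_deriv:
  assumes q: "q \<in> schwartz" and r: "r \<in> schwartz" and j: "j * j = -1"
    and a: "\<And>x. (a has_vector_derivative 2 * (j * \<kappa>\<^sup>2) * a x + \<kappa> * r x - \<kappa> * q x * (a x)\<^sup>2) (at x)"
  shows "(lax_time \<kappa> q r j a has_vector_derivative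
    (2 * (j * \<kappa>\<^sup>2) - 2 * (\<kappa> * q x) * a x) * lax_time \<kappa> q r j a x
    + \<kappa> * (- j * dx (dx r) x + 2 * r x * dx r x * q x + (r x)\<^sup>2 * dx q x)
    - \<kappa> * (j * dx (dx q) x + 2 * q x * dx q x * r x + (q x)\<^sup>2 * dx r x) * (a x)\<^sup>2) (at x)"
proof -
  define a1 where "a1 = 2 * (j * \<kappa>\<^sup>2) * a x + \<kappa> * r x - \<kappa> * q x * (a x)\<^sup>2"
  have a': "(a has_vector_derivative a1) (at x)" unfolding a1_def by (rule a)
  show ?thesis
    unfolding lax_time_def[abs_def]
  proof (rule has_vector_derivative_eq_rhs)
    show "((\<lambda>x. \<kappa> * (- (j * dx r x) + r x * r x * q x + 2 * \<kappa>\<^sup>2 * r x)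
     + 2 * j * \<kappa>\<^sup>2 * ((q x * r x + 2 * \<kappa>\<^sup>2) * a x)
     - \<kappa> * ((j * dx q x + q x * q x * r x + 2 * \<kappa>\<^sup>2 * q x) * (a x * a x))) has_vector_derivative
      \<kappa> * (- (j * dx (dx r) x) + (r x * r x * dx q x + (r x * dx r x + dx r x * r x) * q x) + 2 * \<kappa>\<^sup>2 * dx r x)
      + 2 * j * \<kappa>\<^sup>2 * ((q x * r x + 2 * \<kappa>\<^sup>2) * a1 + (q x * dx r x + dx q x * r x + 0) * a x)
      - \<kappa> * ((j * dx q x + q x * q x * r x + 2 * \<kappa>\<^sup>2 * q x) * (a x * a1 + a1 * a x)
        + (j * dx (dx q) x + (q x * q x * dx r x + (q x * dx q x + dx q x * q x) * r x) + 2 * \<kappa>\<^sup>2 * dx q x) * (a x * a x))) (at x)"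
      by (intro has_vector_derivative_diff has_vector_derivative_add has_vector_derivative_minus
          has_vector_derivative_mult_right has_vector_derivative_mult has_vector_derivative_const
          schwartz_has_dx schwartz_dx q r a')
    show "\<kappa> * (- (j * dx (dx r) x) + (r x * r x * dx q x + (r x * dx r x + dx r x * r x) * q x) + 2 * \<kappa>\<^sup>2 * dx r x)
      + 2 * j * \<kappa>\<^sup>2 * ((q x * r x + 2 * \<kappa>\<^sup>2) * a1 + (q x * dx r x + dx q x * r x + 0) * a x)
      - \<kappa> * ((j * dx q x + q x * q x * r x + 2 * \<kappa>\<^sup>2 * q x) * (a x * a1 + a1 * a x)
        + (j * dx (dx q) x + (q x * q x * dx r x + (q x * dx q x + dx q x * q x) * r x) + 2 * \<kappa>\<^sup>2 * dx q x) * (a x * a x))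
      = (2 * (j * \<kappa>\<^sup>2) - 2 * (\<kappa> * q x) * a x) * (\<kappa> * (- (j * dx r x) + r x * r x * q x + 2 * \<kappa>\<^sup>2 * r x)
     + 2 * j * \<kappa>\<^sup>2 * ((q x * r x + 2 * \<kappa>\<^sup>2) * a x)
     - \<kappa> * ((j * dx q x + q x * q x * r x + 2 * \<kappa>\<^sup>2 * q x) * (a x * a x)))
    + \<kappa> * (- j * dx (dx r) x + 2 * r x * dx r x * q x + (r x)\<^sup>2 * dx q x)
    - \<kappa> * (j * dx (dx q) x + 2 * q x * dx q x * r x + (q x)\<^sup>2 * dx r x) * (a x)\<^sup>2"
      by (rule zero_curvature_identity[OF j a1_def])
  qed
qed

lemma bounded_range_mult:
  fixes f g :: "real \<Rightarrow> complex"
  assumes "bounded (range f)" "bounded (range g)"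
  shows "bounded (range (\<lambda>x. f x * g x))"
proof -
  obtain B C where "\<And>x. norm (f x) \<le> B" "\<And>x. norm (g x) \<le> C"
    using assms by (auto simp: bounded_iff)
  moreover from this have "B \<ge> 0" using norm_ge_zero order_trans by blast
  ultimately have "norm (f x * g x) \<le> B * C" for x
    unfolding norm_mult by (intro mult_mono) auto
  then show ?thesis by (auto simp: bounded_iff)
qed

lemma lax_time_bounded:
  assumes q: "q \<in> schwartz" and r: "r \<in> schwartz" and a: "bounded (range a)"
  shows "bounded (range (lax_time \<kappa> q r j a))"
proof -
  have b: "bounded (range q)" "bounded (range r)" "bounded (range (dx q))" "bounded (range (dx r))"
    by (auto intro: schwartz_bounded schwartz_dx q r)
  have const: "bounded (range (\<lambda>x::real. k))" for k :: complex by simp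
  have "bounded (range (\<lambda>x. \<kappa> * (- j * dx r x + r x * r x * q x + 2 * \<kappa>\<^sup>2 * r x)
     + 2 * j * \<kappa>\<^sup>2 * ((q x * r x + 2 * \<kappa>\<^sup>2) * a x)
     - \<kappa> * ((j * dx q x + q x * q x * r x + 2 * \<kappa>\<^sup>2 * q x) * (a x * a x))))"
    by (intro bounded_plus_comp bounded_minus_comp bounded_range_mult a b const)
  then show ?thesis by (simp add: lax_time_def[abs_def])
qed

lemma riccati_evolution:
  fixes q r a :: "real \<Rightarrow> real \<Rightarrow> complex" and q' r' :: "real \<Rightarrow> complex"
  assumes c: "j * \<kappa>\<^sup>2 = of_real c" "c \<noteq> 0" and j: "j * j = -1" and t: "t \<in> I"
    and qr: "\<And>\<tau>. \<tau> \<in> I \<Longrightarrow> q \<tau> \<in> schwartz" "\<And>\<tau>. \<tau> \<in> I \<Longrightarrow> r \<tau> \<in> schwartz"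
    and small: "\<And>\<tau>. \<tau> \<in> I \<Longrightarrow> small_potential c (\<lambda>x. \<kappa> * q \<tau> x)"
    and a: "\<And>\<tau> x. \<tau> \<in> I \<Longrightarrow> norm (a \<tau> x) \<le> 1 / 2"
    "\<And>\<tau> x. \<tau> \<in> I \<Longrightarrow> (a \<tau> has_vector_derivative
      2 * of_real c * a \<tau> x + \<kappa> * r \<tau> x - \<kappa> * q \<tau> x * (a \<tau> x)\<^sup>2) (at x)"
    and d: "q' \<in> schwartz" "r' \<in> schwartz" "uniform_derivative I q t q'" "uniform_derivative I r t r'"
    and q': "\<And>x. q' x = j * dx (dx (q t)) x + 2 * q t x * dx (q t) x * r t x + (q t x)\<^sup>2 * dx (r t) x"
    and r': "\<And>x. r' x = - j * dx (dx (r t)) x + 2 * r t x * dx (r t) x * q t x + (r t x)\<^sup>2 * dx (q t) x"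
  shows "((\<lambda>\<tau>. a \<tau> x) has_vector_derivative lax_time \<kappa> (q t) (r t) j (a t) x) (at t within I)"
proof (rule riccati_time_derivative[OF c(2) t small, where s = "\<lambda>\<tau> x. \<kappa> * r \<tau> x"
      and a = a and R = "lax_time \<kappa> (q t) (r t) j (a t)" and x = x
      and p' = "\<lambda>x. \<kappa> * q' x" and s' = "\<lambda>x. \<kappa> * r' x"])
  show "continuous_on UNIV (\<lambda>x. \<kappa> * r \<tau> x)" if "\<tau> \<in> I" for \<tau>
    by (intro continuous_intros schwartz_continuous qr that)
  show "continuous_on UNIV (\<lambda>x. \<kappa> * q' x)" "continuous_on UNIV (\<lambda>x. \<kappa> * r' x)"
    by (intro continuous_intros schwartz_continuous d)+
  show "bounded (range (\<lambda>x. \<kappa> * q' x))" "bounded (range (\<lambda>x. \<kappa> * r' x))" "bounded (range (\<lambda>x. \<kappa> * q t x))"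
    by (intro schwartz_bounded schwartz_scale d qr t)+
  show "uniform_derivative I (\<lambda>\<tau> x. \<kappa> * q \<tau> x) t (\<lambda>x. \<kappa> * q' x)"
    "uniform_derivative I (\<lambda>\<tau> x. \<kappa> * r \<tau> x) t (\<lambda>x. \<kappa> * r' x)"
    by (intro uniform_derivative_scale d)+
  have "bounded (range (a t))" using a(1)[OF t] unfolding bounded_iff by blast
  then show "bounded (range (lax_time \<kappa> (q t) (r t) j (a t)))"
    by (intro lax_time_bounded qr t)
  show "(lax_time \<kappa> (q t) (r t) j (a t) has_vector_derivative
      (2 * of_real c - 2 * (\<kappa> * q t x) * a t x) * lax_time \<kappa> (q t) (r t) j (a t) x
      + \<kappa> * r' x - \<kappa> * q' x * (a t x)\<^sup>2) (at x)" for x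
    using lax_time_deriv[OF qr(1)[OF t] qr(2)[OF t] j, of "a t" \<kappa> x] a(2)[OF t]
    unfolding q' r' c(1) by simp
qed (use a in auto)

text \<open>The algebra behind the conservation law: on the left the time derivative of
  \<open>- (\<kappa> / 2) (q a - r b)\<close>, on the right minus the space derivative of the current.  It holds
  because \<open>q a\<close> and \<open>r b\<close> are separately conserved, with currents \<open>- (A + B a) / \<kappa>\<close> and
  \<open>(A - C b) / \<kappa>\<close>, where \<open>A\<close>, \<open>B\<close> and \<open>C\<close> are the entries of the time component of the Lax pair.\<close>

lemma conservation_identity:
  fixes j k q q1 q2 r r1 r2 a a1 b b1 qt rt a_t b_t :: complex
  assumes j: "j * j = -1"
    and a1: "a1 = 2 * (j * k\<^sup>2) * a + k * r - k * q * a\<^sup>2"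
    and b1: "b1 = - 2 * (j * k\<^sup>2) * b + k * q - k * r * b\<^sup>2"
    and qt: "qt = j * q2 + 2 * q * q1 * r + q\<^sup>2 * r1"
    and rt: "rt = - j * r2 + 2 * r * r1 * q + r\<^sup>2 * q1"
    and a_t: "a_t = k * (- (j * r1) + r * r * q + 2 * k\<^sup>2 * r)
     + 2 * j * k\<^sup>2 * ((q * r + 2 * k\<^sup>2) * a) - k * ((j * q1 + q * q * r + 2 * k\<^sup>2 * q) * (a * a))"
    and b_t: "b_t = k * (- (- j * q1) + q * q * r + 2 * k\<^sup>2 * q)
     + 2 * (- j) * k\<^sup>2 * ((r * q + 2 * k\<^sup>2) * b) - k * ((- j * r1 + r * r * q + 2 * k\<^sup>2 * r) * (b * b))"
  shows "- (k / 2) * ((q * a_t + qt * a) - (r * b_t + rt * b))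
    = - (j * (k / 2) * ((q1 * a1 + q2 * a) + (r1 * b1 + r2 * b))
      - j * k\<^sup>2 * (q * r1 + q1 * r)
      - ((2 * k\<^sup>2 + q * r) * (- (k / 2) * ((q * a1 + q1 * a) - (r * b1 + r1 * b)))
        + (0 + (q * r1 + q1 * r)) * (- (k / 2) * (q * a - r * b))))"
proof -
  have jj: "j * (j * x) = - x" for x using j by (simp add: mult.assoc[symmetric])
  define h where "h = k / 2"
  have k: "k = 2 * h" by (simp add: h_def)
  show ?thesis unfolding h_def[symmetric] unfolding a1 b1 qt rt a_t b_t k
    by (simp add: algebra_simps power2_eq_square j jj)
qed

section \<open>The microscopic conservation law\<close>

text \<open>On the time interval the diagonal Green's function may be replaced by Riccati solutions
  chosen independently at each time; that they depend differentiably on time is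
  a consequence of \<open>riccati_evolution\<close>.\<close>

theorem microscopic_conservation:
  assumes c: "\<i> * \<kappa>\<^sup>2 = of_real c" "c \<noteq> 0" and I: "is_interval I" "0 \<in> I" "I \<noteq> {0}"
    and C1: "C1_schwartz I q" and dnls: "dnls_solution I q" and mass: "L2_norm (q 0) \<le> 1 / 2"
    and t: "t \<in> I"
  obtains D where "((\<lambda>\<tau>. rho \<kappa> (q \<tau>) x) has_vector_derivative - D) (at t within I)"
    "((\<lambda>y. j_dnls \<kappa> (q t) y) has_vector_derivative D) (at x)"
proof -
  have q: "q \<tau> \<in> schwartz" if "\<tau> \<in> I" for \<tau> using C1 that by (simp add: C1_schwartz_def)
  obtain d where d: "\<And>t. t \<in> I \<Longrightarrow> d t \<in> schwartz" "\<And>t. t \<in> I \<Longrightarrow> uniform_derivative I q t (d t)"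
    using C1_schwartz_uniform_derivative[OF C1] by blast
  have eq: "\<i> * d t x + dx (dx (q t)) x + \<i> * dx (\<lambda>y. of_real ((cmod (q t y))\<^sup>2) * q t y) x = 0"
    if "t \<in> I" for t x
  proof -
    have "vector_derivative (\<lambda>\<tau>. q \<tau> x) (at t within I) = d t x"
      by (rule vector_derivative_within[OF interval_at_within_nontrivial[OF I(1) that I(2,3)]
            uniform_derivative_pointwise[OF d(2)[OF that]]])
    then show ?thesis using dnls that unfolding dnls_solution_def by metis
  qed
  have "\<exists>m. \<forall>\<tau>\<in>I. (LBINT x. (norm (q \<tau> x))\<^sup>2) = m"
  proof (rule has_field_derivative_zero_constant)
    show "convex I" using I(1) by (rule is_interval_convex)
    fix \<tau> assume "\<tau> \<in> I"
    then show "((\<lambda>\<tau>. LBINT x. (norm (q \<tau> x))\<^sup>2) has_field_derivative 0) (at \<tau> within I)"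
      using mass_derivative[OF q _ d(1) d(2)] dnls_mass_stationary[OF q eq]
      by (simp add: has_real_derivative_iff_has_vector_derivative)
  qed
  then have mass: "L2_norm (q \<tau>) \<le> 1 / 2" if "\<tau> \<in> I" for \<tau>
    using mass that I(2) by (auto simp: L2_norm_def)
  have "\<forall>\<tau>\<in>I. \<exists>a b. riccati_pair c (\<lambda>x. \<kappa> * q \<tau> x) (\<lambda>x. \<kappa> * conj_pot (q \<tau>) x) a b"
    using riccati_pair_exists[OF q c mass] by blast
  then obtain a b where ab: "\<And>\<tau>. \<tau> \<in> I \<Longrightarrow> riccati_pair c (\<lambda>x. \<kappa> * q \<tau> x) (\<lambda>x. \<kappa> * conj_pot (q \<tau>) x) (a \<tau>) (b \<tau>)"
    by metis
  define r where "r \<tau> = conj_pot (q \<tau>)" for \<tau>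
  have r: "r \<tau> \<in> schwartz" if "\<tau> \<in> I" for \<tau> unfolding r_def by (intro schwartz_conj_pot q that)
  have aD: "norm (a \<tau> x) \<le> 1 / 2" "(a \<tau> has_vector_derivative 2 * of_real c * a \<tau> x + \<kappa> * r \<tau> x - \<kappa> * q \<tau> x * (a \<tau> x)\<^sup>2) (at x)"
    and bD: "norm (b \<tau> x) \<le> 1 / 2" "(b \<tau> has_vector_derivative - 2 * of_real c * b \<tau> x + \<kappa> * q \<tau> x - \<kappa> * r \<tau> x * (b \<tau> x)\<^sup>2) (at x)"
    if "\<tau> \<in> I" for \<tau> x
    using ab[OF that] by (simp_all add: riccati_pair_def r_def)
  have small: "small_potential c (\<lambda>x. \<kappa> * q \<tau> x)" "small_potential (- c) (\<lambda>x. \<kappa> * r \<tau> x)" if "\<tau> \<in> I" for \<tau>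
    using small_potential_of_mass[OF q c(1) mass, OF that that]
      small_potential_of_mass[OF r c(1), of \<tau>] mass[OF that] that
    by (auto simp: r_def L2_norm_conj_pot small_potential_def)
  note ev = dnls_evolution[OF q[OF t] eq[OF t], folded r_def]
  have r_deriv: "uniform_derivative I r t (conj_pot (d t))"
    unfolding r_def[abs_def] by (rule uniform_derivative_conj_pot[OF d(2)[OF t]])
  have cd: "conj_pot (d t) \<in> schwartz" by (intro schwartz_conj_pot d t)
  have a_t: "((\<lambda>\<tau>. a \<tau> x) has_vector_derivative lax_time \<kappa> (q t) (r t) \<i> (a t) x) (at t within I)" for x
    by (rule riccati_evolution[OF c _ t q r small(1) aD(1) aD(2) d(1)[OF t] cd d(2)[OF t] r_deriv ev]) auto
  have ev1': "d t x = - (- \<i>) * dx (dx (q t)) x + 2 * q t x * dx (q t) x * r t x + (q t x)\<^sup>2 * dx (r t) x" for x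
    by (simp add: ev(1))
  have bD': "(b \<tau> has_vector_derivative 2 * of_real (- c) * b \<tau> x + \<kappa> * q \<tau> x - \<kappa> * r \<tau> x * (b \<tau> x)\<^sup>2) (at x)"
    if "\<tau> \<in> I" for \<tau> x
    using bD(2)[OF that, of x] by simp
  have b_t: "((\<lambda>\<tau>. b \<tau> x) has_vector_derivative lax_time \<kappa> (r t) (q t) (- \<i>) (b t) x) (at t within I)" for x
    by (rule riccati_evolution[where c = "- c", OF _ _ _ t r q small(2) bD(1) bD' cd d(1)[OF t]
          r_deriv d(2)[OF t] ev(2) ev1']) (use c in auto)
  let ?\<rho> = "\<lambda>\<tau> x. - (\<kappa> / 2) * (q \<tau> x * a \<tau> x - r \<tau> x * b \<tau> x)"
  have rho_eq: "rho \<kappa> (q \<tau>) x = ?\<rho> \<tau> x" if "\<tau> \<in> I" for \<tau> x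
    unfolding r_def by (rule rho_riccati(1)[OF q[OF that] c ab[OF that]])
  let ?qt = "d t x" and ?rt = "conj_pot (d t) x"
  let ?at = "lax_time \<kappa> (q t) (r t) \<i> (a t) x" and ?bt = "lax_time \<kappa> (r t) (q t) (- \<i>) (b t) x"
  have "((\<lambda>\<tau>. ?\<rho> \<tau> x) has_vector_derivative
      - (\<kappa> / 2) * ((q t x * ?at + ?qt * a t x) - (r t x * ?bt + ?rt * b t x))) (at t within I)"
    by (intro has_vector_derivative_mult_right has_vector_derivative_diff has_vector_derivative_mult
        a_t b_t uniform_derivative_pointwise d t r_deriv)
  then have rho_t: "((\<lambda>\<tau>. rho \<kappa> (q \<tau>) x) has_vector_derivative
      - (\<kappa> / 2) * ((q t x * ?at + ?qt * a t x) - (r t x * ?bt + ?rt * b t x))) (at t within I)"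
    by (rule has_vector_derivative_transform[OF t, rotated]) (simp add: rho_eq)
  define a1 where "a1 = 2 * of_real c * a t x + \<kappa> * r t x - \<kappa> * q t x * (a t x)\<^sup>2"
  define b1 where "b1 = - 2 * of_real c * b t x + \<kappa> * q t x - \<kappa> * r t x * (b t x)\<^sup>2"
  have a1: "(a t has_vector_derivative a1) (at x)" unfolding a1_def by (rule aD(2)[OF t])
  have b1: "(b t has_vector_derivative b1) (at x)" unfolding b1_def by (rule bD(2)[OF t])
  let ?q = "q t x" and ?q1 = "dx (q t) x" and ?q2 = "dx (dx (q t)) x"
  let ?r = "r t x" and ?r1 = "dx (r t) x" and ?r2 = "dx (dx (r t)) x"
  let ?\<rho>1 = "- (\<kappa> / 2) * ((?q * a1 + ?q1 * a t x) - (?r * b1 + ?r1 * b t x))"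
  let ?J = "\<i> * (\<kappa> / 2) * ((?q1 * a1 + ?q2 * a t x) + (?r1 * b1 + ?r2 * b t x))
      - \<i> * \<kappa>\<^sup>2 * (?q * ?r1 + ?q1 * ?r)
      - ((2 * \<kappa>\<^sup>2 + ?q * ?r) * ?\<rho>1 + (0 + (?q * ?r1 + ?q1 * ?r)) * ?\<rho> t x)"
  have j_eq: "j_dnls \<kappa> (q t) = (\<lambda>x. \<i> * (\<kappa> / 2) * (dx (q t) x * a t x + dx (r t) x * b t x)
      - \<i> * \<kappa>\<^sup>2 * (q t x * r t x) - (2 * \<kappa>\<^sup>2 + q t x * r t x) * ?\<rho> t x)"
    by (rule ext) (simp add: rho_riccati(2)[OF q[OF t] c ab[OF t]] rho_eq[OF t] r_def)
  have j_x: "(j_dnls \<kappa> (q t) has_vector_derivative ?J) (at x)"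
    unfolding j_eq
    by (intro has_vector_derivative_diff has_vector_derivative_add has_vector_derivative_mult_right
        has_vector_derivative_mult has_vector_derivative_const schwartz_has_dx schwartz_dx q r t a1 b1)
  have "- (\<kappa> / 2) * ((q t x * ?at + ?qt * a t x) - (r t x * ?bt + ?rt * b t x)) = - ?J"
    by (rule conservation_identity[OF _ a1_def[folded c(1)] b1_def[folded c(1)] ev(1)[of x] ev(2)[of x]
          lax_time_def[of \<kappa> "q t" "r t" \<i> "a t" x] lax_time_def[of \<kappa> "r t" "q t" "- \<i>" "b t" x]]) simp
  then show thesis using that[OF _ j_x] rho_t by simp
qed

theorem theorem1p2:
  fixes s :: real
  assumes "0 < s" and "s < 1/2"
  shows "\<exists>\<delta>>0. \<forall>(\<kappa>::complex) (I::real set) (q :: real \<Rightarrow> real \<Rightarrow> complex).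
    \<i> * \<kappa>\<^sup>2 \<in> complex_of_real ` (UNIV - {-1<..<1}) \<longrightarrow>
    is_interval I \<longrightarrow> 0 \<in> I \<longrightarrow> I \<noteq> {0} \<longrightarrow>
    C1_schwartz I q \<longrightarrow> dnls_solution I q \<longrightarrow>
    q 0 \<in> sobolev s \<inter> schwartz \<longrightarrow> L2_norm (q 0) \<le> \<delta> \<longrightarrow>
    (\<forall>t\<in>I. \<forall>x.
      (\<lambda>\<tau>. rho \<kappa> (q \<tau>) x) differentiable (at t within I) \<and>
      (\<lambda>y. j_dnls \<kappa> (q t) y) differentiable (at x) \<and>
      vector_derivative (\<lambda>\<tau>. rho \<kappa> (q \<tau>) x) (at t within I)
        + vector_derivative (\<lambda>y. j_dnls \<kappa> (q t) y) (at x) = 0)"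
proof (rule exI[of _ "1/2"], intro conjI allI impI ballI)
  \<comment> \<open>\<open>1/2\<close> is the threshold built into \<open>small_potential\<close>\<close>
  fix \<kappa> :: complex and I :: "real set" and q :: "real \<Rightarrow> real \<Rightarrow> complex" and t x :: real
  assume \<kappa>: "\<i> * \<kappa>\<^sup>2 \<in> complex_of_real ` (UNIV - {-1<..<1})"
    and I: "is_interval I" "0 \<in> I" "I \<noteq> {0}"
    and sol: "C1_schwartz I q" "dnls_solution I q" and mass: "L2_norm (q 0) \<le> 1/2" and t: "t \<in> I"
  from \<kappa> obtain c where c: "\<i> * \<kappa>\<^sup>2 = of_real c" "c \<noteq> 0" by auto
  obtain D where D: "((\<lambda>\<tau>. rho \<kappa> (q \<tau>) x) has_vector_derivative - D) (at t within I)"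
    "((\<lambda>y. j_dnls \<kappa> (q t) y) has_vector_derivative D) (at x)"
    using microscopic_conservation[OF c I sol mass t] by metis
  then show "(\<lambda>\<tau>. rho \<kappa> (q \<tau>) x) differentiable (at t within I)"
    "(\<lambda>y. j_dnls \<kappa> (q t) y) differentiable (at x)"
    by (auto intro: differentiableI_vector)
  show "vector_derivative (\<lambda>\<tau>. rho \<kappa> (q \<tau>) x) (at t within I)
        + vector_derivative (\<lambda>y. j_dnls \<kappa> (q t) y) (at x) = 0"
    using vector_derivative_within[OF interval_at_within_nontrivial[OF I(1) t I(2,3)] D(1)]
      vector_derivative_at[OF D(2)] by simp
qed simp

end
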